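(* Suppose that $f\colon[-1,1]^2\to\mathbb{C}$ and $g\colon[-1,1]^2\to\mathbb{R}$ admit infinitely differentiable extensions to an open neighborhood of $[-1,1]^2$. Let $g_x=\partial g/\partial x$ and $G_1=\max_{(x,y)\in[-1,1]^2}|g_x(x,y)|$, and suppose $G_1<1/2$. Let $0<\varepsilon<1$, suppose that $c_f(\varepsilon)>0$ and $c_{g_x}(\varepsilon)>0$ (equivalently, $f$ and $g_x$ are not identically zero on $[-1,1]^2$), and let $$n=\left\lfloor\frac{\log(\varepsilon)}{\log(2G_1)}\right\rfloor.$$ Then there exists an entire function $p_b\in\mathcal{S}'(\mathbb{R}^2)$ such that 1. $\hat p_b$ is a tempered distribution of order at most $1$ supported in $\left[-c_f(\varepsilon)-n\,c_{g_x}(\varepsilon),\;c_f(\varepsilon)+n\,c_{g_x}(\varepsilon)\right]^2$; 2. $\left|\dfrac{\partial p_b}{\partial x}(x,y)+i\,\dfrac{\partial g}{\partial x}(x,y)\,p_b(x,y)-f(x,y)\right|\le3\varepsilon\left(1+\dfrac{G_1}{1-2G_1}\right)\|f\|_{L^\infty([-1,1]^2)}$ for all $(x,y)\in[-1,1]^2$; 3. $\|p_b\|_{L^\infty([-1,1]^2)}\le\dfrac{2}{1-2G_1}\,\|f\|_{L^\infty([-1,1]^2)}$; 4. $\left\|\dfrac{\partial p_b}{\partial x}\right\|_{L^\infty([-1,1]^2)}\le4\left(1+\dfrac{G_1}{1-2G_1}\right)\|f\|_{L^\infty([-1,1]^2)}$.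
   Context: $\mathcal{S}(\mathbb{R}^2)$ is the Schwartz space and $\mathcal{S}'(\mathbb{R}^2)$ the space of tempered distributions. The Fourier transform is $\hat\varphi(\xi_1,\xi_2)=\frac{1}{4\pi^2}\int_{\mathbb{R}^2}\varphi(x,y)e^{-i(\xi_1x+\xi_2y)}\,\mathrm{d}x\,\mathrm{d}y$ for $\varphi\in\mathcal S(\mathbb{R}^2)$, extended to $\mathcal{S}'(\mathbb{R}^2)$ by $\langle\hat T,\varphi\rangle=\langle T,\hat\varphi\rangle$. A function has bandlimit $c$ if its Fourier transform is supported in $[-c,c]^2$ ($c$ need not be minimal). Order: $T\in\mathcal S'(\mathbb{R}^2)$ is of order at most $m$ if for each compact $K$ there is a constant $M_K$ with $|\langle T,\varphi\rangle|\le M_K\sup_{|\alpha|\le m}\sup_{K}|D^\alpha\varphi|$ for every $\varphi\in\mathcal S(\mathbb{R}^2)$ supported in $K$; its order is the least such $m$. $\varepsilon$-bandlimited approximation: let $\Omega\subset[-1,1]^2$ be closed (here $\Omega=[-1,1]^2$), let $f\colon\Omega\to\mathbb{C}$ admit an infinitely differentiable extension to an open neighborhood of $\Omega$, and let $0<\varepsilon<1$. A function $f_b\in\mathcal S(\mathbb{R}^2)$ is an $\varepsilon$-bandlimited approximation of $f$ if it has some finite bandlimit and (1) $\|f_b-f\|_{L^\infty(\Omega)}\le\varepsilon\|f\|_{L^\infty(\Omega)}$; (2) $\|f_b\|_{L^\infty(\mathbb{R}^2)}\le3\|f\|_{L^\infty(\Omega)}$; (3) $\|D^{\alpha}\hat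 f_b\|_{L^\infty(\mathbb{R}^2)}\le10\|f\|_{L^\infty(\Omega)}$ for all multi-indices $|\alpha|\le2$. The number $c_f(\varepsilon)$ is the infimum of the set of $c>0$ such that there exists an $\varepsilon$-bandlimited approximation of $f$ with bandlimit $c$ (this set is nonempty, so $c_f(\varepsilon)<\infty$); $c_{g_x}(\varepsilon)$ is the same quantity for the function $g_x$ on $[-1,1]^2$. *)

theory Defs
  imports "HOL-Analysis.Analysis" "HOL-Probability.Essential_Supremum"
begin

section \<open>Partial derivatives and smoothness\<close>

text \<open>Partial derivatives relative to a set \<open>S\<close>: derivatives along the slices of \<open>S\<close>. On the
  boundary of a closed square they are one-sided, so they depend only on the values on the square;
  for \<open>S = UNIV\<close> they are the usual partial derivatives.\<close>

definition partial_x :: "(real \<times> real) set \<Rightarrow> (real \<times> real \<Rightarrow> 'a::real_normed_vector) \<Rightarrow> real \<times> real \<Rightarrow> 'a" where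
  "partial_x S f = (\<lambda>(x, y). vector_derivative (\<lambda>t. f (t, y)) (at x within {t. (t, y) \<in> S}))"

definition partial_y :: "(real \<times> real) set \<Rightarrow> (real \<times> real \<Rightarrow> 'a::real_normed_vector) \<Rightarrow> real \<times> real \<Rightarrow> 'a" where
  "partial_y S f = (\<lambda>(x, y). vector_derivative (\<lambda>t. f (x, t)) (at y within {t. (x, t) \<in> S}))"

text \<open>\<open>mderiv a b f\<close> is \<open>D\<^sup>\<alpha> f\<close> for the multi-index \<open>\<alpha> = (a, b)\<close>.\<close>

definition mderiv :: "nat \<Rightarrow> nat \<Rightarrow> (real \<times> real \<Rightarrow> 'a::real_normed_vector) \<Rightarrow> real \<times> real \<Rightarrow> 'a" where
  "mderiv a b f = (partial_x UNIV ^^ a) ((partial_y UNIV ^^ b) f)"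

text \<open>\<open>C\<^sup>k\<close> on an open set.\<close>

fun Ck_on :: "nat \<Rightarrow> (real \<times> real) set \<Rightarrow> (real \<times> real \<Rightarrow> 'a::real_normed_vector) \<Rightarrow> bool" where
  "Ck_on 0 U f \<longleftrightarrow> continuous_on U f"
| "Ck_on (Suc k) U f \<longleftrightarrow> (\<forall>z\<in>U. f differentiable (at z)) \<and>
     Ck_on k U (partial_x UNIV f) \<and> Ck_on k U (partial_y UNIV f)"

definition smooth_on :: "(real \<times> real) set \<Rightarrow> (real \<times> real \<Rightarrow> 'a::real_normed_vector) \<Rightarrow> bool" where
  "smooth_on U f \<longleftrightarrow> (\<forall>k. Ck_on k U f)"

definition has_smooth_extension :: "(real \<times> real) set \<Rightarrow> (real \<times> real \<Rightarrow> 'a::real_normed_vector) \<Rightarrow> bool" where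
  "has_smooth_extension \<Omega> f \<longleftrightarrow>
     (\<exists>U F. open U \<and> \<Omega> \<subseteq> U \<and> smooth_on U F \<and> (\<forall>z\<in>\<Omega>. F z = f z))"

definition box_sq :: "real \<Rightarrow> (real \<times> real) set" where
  "box_sq c = {- c..c} \<times> {- c..c}"

definition Linf_norm :: "(real \<times> real) set \<Rightarrow> (real \<times> real \<Rightarrow> complex) \<Rightarrow> ennreal" where
  "Linf_norm \<Omega> f = esssup (lebesgue_on \<Omega>) (\<lambda>z. ennreal (cmod (f z)))"

section \<open>Schwartz functions and tempered distributions\<close>

definition schwartz_seminorm :: "nat \<Rightarrow> nat \<Rightarrow> nat \<Rightarrow> nat \<Rightarrow> (real \<times> real \<Rightarrow> complex) \<Rightarrow> real" where
  "schwartz_seminorm i j a b \<phi> =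
     (SUP z. \<bar>fst z\<bar> ^ i * \<bar>snd z\<bar> ^ j * cmod (mderiv a b \<phi> z))"

definition schwartz :: "(real \<times> real \<Rightarrow> complex) \<Rightarrow> bool" where
  "schwartz \<phi> \<longleftrightarrow> smooth_on UNIV \<phi> \<and>
     (\<forall>i j a b. bdd_above (range (\<lambda>z. \<bar>fst z\<bar> ^ i * \<bar>snd z\<bar> ^ j * cmod (mderiv a b \<phi> z))))"

definition fsupport :: "(real \<times> real \<Rightarrow> complex) \<Rightarrow> (real \<times> real) set" where
  "fsupport \<phi> = closure {z. \<phi> z \<noteq> 0}"

type_synonym distr = "(real \<times> real \<Rightarrow> complex) \<Rightarrow> complex"

text \<open>Functionals are total functions, but only their values on Schwartz functions matter.
  Continuity is stated by domination by finitely many Schwartz seminorms.\<close>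

definition tempered_distribution :: "distr \<Rightarrow> bool" where
  "tempered_distribution T \<longleftrightarrow>
     (\<forall>\<phi> \<psi>. schwartz \<phi> \<longrightarrow> schwartz \<psi> \<longrightarrow> T (\<lambda>z. \<phi> z + \<psi> z) = T \<phi> + T \<psi>) \<and>
     (\<forall>c \<phi>. schwartz \<phi> \<longrightarrow> T (\<lambda>z. c * \<phi> z) = c * T \<phi>) \<and>
     (\<exists>C N. \<forall>\<phi>. schwartz \<phi> \<longrightarrow>
        cmod (T \<phi>) \<le> C * (\<Sum>i\<le>N. \<Sum>j\<le>N. \<Sum>a\<le>N. \<Sum>b\<le>N. schwartz_seminorm i j a b \<phi>))"

definition order_at_most :: "nat \<Rightarrow> distr \<Rightarrow> bool" where
  "order_at_most m T \<longleftrightarrow>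
     (\<forall>K. compact K \<longrightarrow> (\<exists>M. \<forall>\<phi>. schwartz \<phi> \<longrightarrow> fsupport \<phi> \<subseteq> K \<longrightarrow>
        cmod (T \<phi>) \<le> M * (SUP (a, b)\<in>{(a, b). a + b \<le> m}. SUP z\<in>K. cmod (mderiv a b \<phi> z))))"

text \<open>Complement of the largest open set on which \<open>T\<close> vanishes; compactly supported Schwartz
  functions are exactly the test functions.\<close>

definition distr_support :: "distr \<Rightarrow> (real \<times> real) set" where
  "distr_support T =
     - \<Union>{U. open U \<and> (\<forall>\<phi>. schwartz \<phi> \<longrightarrow> compact (fsupport \<phi>) \<longrightarrow> fsupport \<phi> \<subseteq> U \<longrightarrow> T \<phi> = 0)}"

definition distr_of :: "(real \<times> real \<Rightarrow> complex) \<Rightarrow> distr" where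
  "distr_of p \<phi> = (LINT z|lborel. p z * \<phi> z)"

text \<open>The Bochner integral of a non-integrable function is \<open>0\<close>, so integrability against every
  Schwartz function is demanded explicitly.\<close>

definition tempered_function :: "(real \<times> real \<Rightarrow> complex) \<Rightarrow> bool" where
  "tempered_function p \<longleftrightarrow>
     (\<forall>\<phi>. schwartz \<phi> \<longrightarrow> integrable lborel (\<lambda>z. p z * \<phi> z)) \<and> tempered_distribution (distr_of p)"

definition fourier :: "(real \<times> real \<Rightarrow> complex) \<Rightarrow> real \<times> real \<Rightarrow> complex" where
  "fourier \<phi> = (\<lambda>(\<xi>1, \<xi>2). complex_of_real (1 / (4 * pi\<^sup>2)) *
     (LINT (x, y)|lborel. \<phi> (x, y) * exp (- \<i> * complex_of_real (\<xi>1 * x + \<xi>2 * y))))"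

definition fourier_distr :: "distr \<Rightarrow> distr" where
  "fourier_distr T \<phi> = T (fourier \<phi>)"

text \<open>Restrictions to \<open>\<real>\<^sup>2\<close> of entire functions on \<open>\<complex>\<^sup>2\<close>, i.e. of functions with a complex-linear
  total derivative at every point.\<close>

definition entire_function :: "(real \<times> real \<Rightarrow> complex) \<Rightarrow> bool" where
  "entire_function p \<longleftrightarrow>
     (\<exists>P :: complex \<times> complex \<Rightarrow> complex.
        (\<forall>w. \<exists>a b. (P has_derivative (\<lambda>(h, k). a * h + b * k)) (at w)) \<and>
        (\<forall>x y. p (x, y) = P (complex_of_real x, complex_of_real y)))"

section \<open>Bandlimited approximation\<close>

definition has_bandlimit :: "(real \<times> real \<Rightarrow> complex) \<Rightarrow> real \<Rightarrow> bool" where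
  "has_bandlimit f c \<longleftrightarrow> fsupport (fourier f) \<subseteq> box_sq c"

definition bandlimited_approx ::
  "(real \<times> real) set \<Rightarrow> real \<Rightarrow> (real \<times> real \<Rightarrow> complex) \<Rightarrow> (real \<times> real \<Rightarrow> complex) \<Rightarrow> bool" where
  "bandlimited_approx \<Omega> \<epsilon> f f\<^sub>b \<longleftrightarrow>
     schwartz f\<^sub>b \<and> (\<exists>c. has_bandlimit f\<^sub>b c) \<and>
     Linf_norm \<Omega> (\<lambda>z. f\<^sub>b z - f z) \<le> ennreal \<epsilon> * Linf_norm \<Omega> f \<and>
     Linf_norm UNIV f\<^sub>b \<le> 3 * Linf_norm \<Omega> f \<and>
     (\<forall>a b. a + b \<le> 2 \<longrightarrow> Linf_norm UNIV (mderiv a b (fourier f\<^sub>b)) \<le> 10 * Linf_norm \<Omega> f)"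

definition approx_bandlimit :: "(real \<times> real) set \<Rightarrow> (real \<times> real \<Rightarrow> complex) \<Rightarrow> real \<Rightarrow> real" where
  "approx_bandlimit \<Omega> f \<epsilon> =
     Inf {c. 0 < c \<and> (\<exists>f\<^sub>b. bandlimited_approx \<Omega> \<epsilon> f f\<^sub>b \<and> has_bandlimit f\<^sub>b c)}"

end

theory Submission
  imports Defs "HOL-Probability.Probability" "HOL-Complex_Analysis.Great_Picard"
begin

text \<open>Write \<open>J F (x, y) = \<integral>\<^sub>0\<^sup>x F (t, y) dt\<close>. The function \<open>p\<close> is a Picard iterate for the integral equation
  \<open>p = J (f - \<i> g\<^sub>x p)\<close>, with \<open>f\<close> and \<open>g\<^sub>x\<close> replaced by bandlimited approximations \<open>a\<close> and \<open>b\<close>: put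
  \<open>F\<^sub>0 = a\<close>, \<open>F\<^sub>k\<^sub>+\<^sub>1 = a - \<i> b J F\<^sub>k\<close> and \<open>p = J F\<^sub>n\<close>. On the square \<open>b J\<close> is a contraction with constant at
  most \<open>2 G\<^sub>1\<close>, and \<open>(2 G\<^sub>1)\<^sup>n\<^sup>+\<^sup>1 \<le> \<epsilon>\<close> by the choice of \<open>n\<close>.

  If the transform of \<open>F\<close> is a measure on a square, then so is that of \<open>b J F\<close>, on a square larger by the
  bandlimit of \<open>b\<close>: indeed \<open>b J F = (x b) \<integral>\<^sub>0\<^sup>1 F (s x, y) ds\<close>, and \<open>x b\<close> has an integrable transform. Only
  the last application of \<open>J\<close> costs a derivative, whence order one.

  The infimum defining the bandlimit of an approximation need not be attained. The bounds on the
  derivatives of the transforms give, by Arzela-Ascoli, limits \<open>a\<close> and \<open>b\<close> whose transforms are supported in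
  the limiting squares. Approximations exist at all because a continuous, compactly supported extension
  can be cut off smoothly in frequency; otherwise the infimum would be an unspecified number.\<close>

text \<open>\<open>J\<close> contains a factor x, which on the frequency side is a derivative;
  treated naively, the \<open>n + 1\<close> applications of \<open>J\<close> in \<open>p\<close>
  would give order \<open>n + 1\<close>. In each step the factor \<open>b\<close> takes up that x,
  because the transform of \<open>x b\<close> is, up to a factor \<i>, a derivative of the transform
  of \<open>b\<close>. The remaining average of \<open>F (s x, y)\<close> over
  \<open>0 < s \<le> 1\<close> contracts spectra towards an axis and never enlarges a square.
  Working at the infimum has a price: the limiting transforms are not known to be smooth, so
  \<open>a\<close> and \<open>b\<close> need not be Schwartz functions. Spectra are therefore
  handled by duality alone: pairing \<open>F\<close> with the transform of \<open>\<phi>\<close> is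
  bounded by the maximum of \<open>|\<phi>|\<close> on the square. The third condition on
  approximations keeps the transforms of \<open>x b\<close> bounded and equicontinuous. The bound
  \<open>|b| \<le> (1 + \<epsilon>) G\<^sub>1 \<le> 2 G\<^sub>1\<close> gives the contraction
  constant. With successive iterates \<open>F'\<close> and \<open>F\<close>, the residual splits
  into \<open>a - f\<close>, \<open>\<i> (g\<^sub>x - b) J F'\<close> and
  \<open>\<i> g\<^sub>x J (F - F')\<close>.\<close>

type_synonym plane = "real \<times> real"

section \<open>Integration on the plane\<close>

lemma measurable_fst_snd_plane [measurable]:
  "(fst :: plane \<Rightarrow> real) \<in> borel_measurable borel" "(snd :: plane \<Rightarrow> real) \<in> borel_measurable borel"
  by (auto intro!: borel_measurable_continuous_onI continuous_intros)

text \<open>A product of two one-variable weights, so that its inverse is integrable by Fubini;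
  multiplied out, a bound on \<open>weight z * norm (\<phi> z)\<close> is a bound on four monomial
  moments.\<close>

definition weight :: "plane \<Rightarrow> real" where
  "weight z = (1 + (fst z)\<^sup>2) * (1 + (snd z)\<^sup>2)"

lemma weight_ge_1: "1 \<le> weight z"
proof -
  have "1 * 1 \<le> (1 + (fst z)\<^sup>2) * (1 + (snd z)\<^sup>2)"
    by (intro mult_mono) auto
  then show ?thesis by (simp add: weight_def)
qed

lemma weight_pos: "0 < weight z"
  using weight_ge_1[of z] by linarith

text \<open>The Fubini criterion behind nearly every interchange of integrals below: the kernels are
  products of an integrable function of each variable and bounded factors.\<close>

lemma integrable_prod_bound:
  fixes a :: "'a::euclidean_space \<Rightarrow> 'c::{banach, second_countable_topology}"
    and b :: "'b::euclidean_space \<Rightarrow> 'd::{banach, second_countable_topology}"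
    and k :: "'a \<times> 'b \<Rightarrow> 'e::{banach, second_countable_topology}"
  assumes a: "integrable lborel a" and b: "integrable lborel b"
    and k: "k \<in> borel_measurable borel"
    and le: "\<And>x y. norm (k (x, y)) \<le> norm (a x) * norm (b y)"
  shows "integrable (lborel \<Otimes>\<^sub>M lborel) k"
proof (rule Bochner_Integration.integrable_bound)
  have [measurable]: "a \<in> borel_measurable borel" "b \<in> borel_measurable borel"
    using a b by (auto dest: borel_measurable_integrable)
  show "integrable (lborel \<Otimes>\<^sub>M lborel) (\<lambda>(x, y). norm (a x) * norm (b y))"
  proof (rule lborel_pair.Fubini_integrable)
    show "integrable lborel (\<lambda>x. LINT y|lborel. norm (case (x, y) of (x, y) \<Rightarrow> norm (a x) * norm (b y)))"
      using a by simp
  qed (use b in auto)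
  show "k \<in> borel_measurable (lborel \<Otimes>\<^sub>M lborel)"
    using k by (simp add: lborel_prod)
  show "AE z in lborel \<Otimes>\<^sub>M lborel. norm (k z) \<le> norm (case z of (x, y) \<Rightarrow> norm (a x) * norm (b y))"
    using le by (auto simp: split_beta)
qed

lemma integrable_inverse_weight: "integrable lborel (\<lambda>z. 1 / weight z)"
proof -
  have i: "integrable lborel (\<lambda>x::real. 1 / (1 + x\<^sup>2))"
    using integrable_inverse_1_plus_square by (simp add: set_integrable_def inverse_eq_divide)
  have "integrable (lborel \<Otimes>\<^sub>M lborel) (\<lambda>z. 1 / weight z)"
  proof (rule integrable_prod_bound[OF i i])
    show "(\<lambda>z. 1 / weight z) \<in> borel_measurable borel" unfolding weight_def by measurable
  qed (simp add: weight_def abs_mult)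
  then show ?thesis by (simp add: lborel_prod)
qed

lemma integrable_weight_bound:
  fixes \<phi> :: "plane \<Rightarrow> 'a::{banach, second_countable_topology}"
  assumes "\<phi> \<in> borel_measurable borel" and le: "\<And>z. weight z * norm (\<phi> z) \<le> C"
  shows "integrable lborel \<phi>"
proof (rule Bochner_Integration.integrable_bound)
  show "integrable lborel (\<lambda>z. C * (1 / weight z))"
    by (intro integrable_mult_right integrable_inverse_weight)
  have "norm (\<phi> z) \<le> norm (C * (1 / weight z))" for z
    using le[of z] weight_pos[of z] by (simp add: field_simps abs_if)
  then show "AE z in lborel. norm (\<phi> z) \<le> norm (C * (1 / weight z))" by simp
qed (use assms in auto)

text \<open>The two coordinates get separate factors because the averages in
  \<open>antideriv\<close> involve dilations of the first coordinate alone.\<close>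

lemma lborel_plane_affine:
  fixes a b t\<^sub>1 t\<^sub>2 :: real
  assumes "a \<noteq> 0" "b \<noteq> 0"
  shows "(lborel :: plane measure) =
    density (distr lborel borel (\<lambda>z. (t\<^sub>1 + a * fst z, t\<^sub>2 + b * snd z))) (\<lambda>_. ennreal \<bar>a * b\<bar>)"
proof -
  \<comment> \<open>\<open>Basis\<close> consists of \<open>(1, 0)\<close> and
    \<open>(0, 1)\<close>; the vanishing first component singles out the latter.\<close>
  define c :: "plane \<Rightarrow> real" where "c j = (if fst j = 0 then b else a)" for j
  have "(lborel :: plane measure) = density (distr lborel borel (\<lambda>x. (t\<^sub>1, t\<^sub>2) + (\<Sum>j\<in>Basis. (c j * (x \<bullet> j)) *\<^sub>R j)))
       (\<lambda>_. (\<Prod>j\<in>Basis. \<bar>c j\<bar>))"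
    by (rule lborel_affine_euclidean) (use assms in \<open>auto simp: c_def\<close>)
  moreover have "(\<Prod>j\<in>Basis. \<bar>c j\<bar>) = \<bar>a * b\<bar>"
    by (simp add: Basis_prod_def c_def abs_mult)
  moreover have "(t\<^sub>1, t\<^sub>2) + (\<Sum>j\<in>Basis. (c j * (x \<bullet> j)) *\<^sub>R j) = (t\<^sub>1 + a * fst x, t\<^sub>2 + b * snd x)" for x :: plane
    by (simp add: Basis_prod_def c_def inner_prod_def)
  ultimately show ?thesis by simp
qed

lemma integral_plane_affine:
  fixes \<psi> :: "plane \<Rightarrow> 'a::{banach, second_countable_topology}"
  assumes ab: "a \<noteq> 0" "b \<noteq> 0" and [measurable]: "\<psi> \<in> borel_measurable borel"
  shows "(LINT z|lborel. \<psi> z) = \<bar>a * b\<bar> *\<^sub>R (LINT z|lborel. \<psi> (t\<^sub>1 + a * fst z, t\<^sub>2 + b * snd z))"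
proof -
  have [measurable]: "(\<lambda>z. (t\<^sub>1 + a * fst z, t\<^sub>2 + b * snd z)) \<in> borel_measurable (borel :: plane measure)"
    by (auto intro!: borel_measurable_continuous_onI continuous_intros)
  show ?thesis
    by (subst lborel_plane_affine[OF ab, of t\<^sub>1 t\<^sub>2], subst integral_density)
       (auto simp: integral_distr)
qed

lemma integrable_plane_affine:
  fixes \<psi> :: "plane \<Rightarrow> 'a::{banach, second_countable_topology}"
  assumes ab: "a \<noteq> 0" "b \<noteq> 0" and i: "integrable lborel \<psi>"
  shows "integrable lborel (\<lambda>z. \<psi> (t\<^sub>1 + a * fst z, t\<^sub>2 + b * snd z))"
proof -
  have [measurable]: "\<psi> \<in> borel_measurable borel" using i by (auto dest: borel_measurable_integrable)
  have [measurable]: "(\<lambda>z. (t\<^sub>1 + a * fst z, t\<^sub>2 + b * snd z)) \<in> borel_measurable (borel :: plane measure)"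
    by (auto intro!: borel_measurable_continuous_onI continuous_intros)
  have "integrable (density (distr lborel borel (\<lambda>z. (t\<^sub>1 + a * fst z, t\<^sub>2 + b * snd z))) (\<lambda>_. ennreal \<bar>a * b\<bar>)) \<psi>"
    using i by (subst lborel_plane_affine[OF ab, of t\<^sub>1 t\<^sub>2, symmetric])
  then have "integrable lborel (\<lambda>z. \<bar>a * b\<bar> *\<^sub>R \<psi> (t\<^sub>1 + a * fst z, t\<^sub>2 + b * snd z))"
    by (subst (asm) integrable_density) (auto simp: integrable_distr_eq)
  from integrable_scaleR_right[OF this, of "1 / \<bar>a * b\<bar>"] show ?thesis
    using ab by simp
qed

lemma integral_translate:
  fixes \<psi> :: "plane \<Rightarrow> 'a::{banach, second_countable_topology}"
  assumes "\<psi> \<in> borel_measurable borel"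
  shows "(LINT z|lborel. \<psi> (z + v)) = (LINT z|lborel. \<psi> z)"
  using integral_plane_affine[of 1 1 \<psi> "fst v" "snd v"] assms
  by (simp add: plus_prod_def add.commute)

lemma integrable_translate:
  fixes \<psi> :: "plane \<Rightarrow> 'a::{banach, second_countable_topology}"
  assumes "integrable lborel \<psi>"
  shows "integrable lborel (\<lambda>z. \<psi> (z + v))"
  using integrable_plane_affine[of 1 1 \<psi> "fst v" "snd v"] assms
  by (simp add: plus_prod_def add.commute)

text \<open>Integrate the identity \<open>\<Psi> (z + v) - \<Psi> z = \<integral>\<^sub>0\<^sup>1 D (z + s v) ds\<close> over the plane: both
  sides are translation invariant, and the left one vanishes.\<close>

lemma integral_directional_derivative_eq_0:
  fixes \<Psi> D :: "plane \<Rightarrow> complex"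
  assumes der: "\<And>z s. ((\<lambda>s. \<Psi> (z + s *\<^sub>R v)) has_vector_derivative D (z + s *\<^sub>R v)) (at s)"
    and cont: "continuous_on UNIV D"
    and \<Psi>: "integrable lborel \<Psi>" and D: "integrable lborel D"
  shows "(LINT z|lborel. D z) = 0"
proof -
  define k where "k = (\<lambda>(s::real, z). indicator {0..1} s *\<^sub>R D (z + s *\<^sub>R v))"
  have [measurable]: "D \<in> borel_measurable borel"
    using cont by (simp add: borel_measurable_continuous_onI)
  have int_k: "integrable (lborel \<Otimes>\<^sub>M lborel) k"
  proof (rule lborel_pair.Fubini_integrable)
    show "k \<in> borel_measurable (lborel \<Otimes>\<^sub>M lborel)"
    proof -
      have "(\<lambda>x::real \<times> plane. D (snd x + fst x *\<^sub>R v)) \<in> borel_measurable borel"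
        by (intro borel_measurable_continuous_onI continuous_intros continuous_on_compose2[OF cont]) auto
      moreover have "(\<lambda>x::real \<times> plane. indicator {0..1} (fst x) :: real) \<in> borel_measurable borel"
        by (rule measurable_compose[of fst _ borel])
           (auto intro!: borel_measurable_continuous_onI continuous_intros)
      ultimately show ?thesis
        unfolding k_def lborel_prod split_beta by simp
    qed
    have "(LINT z|lborel. norm (k (s, z))) = indicator {0..1} s *\<^sub>R (LINT z|lborel. norm (D z))" for s
      using integral_translate[of "\<lambda>z. norm (D z)" "s *\<^sub>R v"] by (simp add: k_def)
    then show "integrable lborel (\<lambda>s. LINT z|lborel. norm (k (s, z)))" by simp
    show "AE s in lborel. integrable lborel (\<lambda>z. k (s, z))"
      using integrable_translate[OF D] by (simp add: k_def)
  qed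
  have "(LINT s|lborel. k (s, z)) = \<Psi> (z + v) - \<Psi> z" for z
  proof -
    have "(LINT s|lborel. indicator {0..1} s *\<^sub>R D (z + s *\<^sub>R v)) = \<Psi> (z + 1 *\<^sub>R v) - \<Psi> (z + 0 *\<^sub>R v)"
      by (rule integral_FTC_Icc[OF _ has_vector_derivative_at_within[OF der]])
         (auto intro!: continuous_intros continuous_on_compose2[OF cont])
    then show ?thesis by (simp add: k_def)
  qed
  then have "(LINT z|lborel. LINT s|lborel. k (s, z)) = 0"
    using integral_translate[of \<Psi> v] integrable_translate[OF \<Psi>] \<Psi>
    by (simp add: borel_measurable_integrable)
  moreover have "(LINT z|lborel. LINT s|lborel. k (s, z)) = (LINT s|lborel. LINT z|lborel. k (s, z))"
    by (rule lborel_pair.Fubini_integral) (use int_k in simp)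
  moreover have "(LINT s|lborel. LINT z|lborel. k (s, z)) = (LINT z|lborel. D z)"
    using integral_translate[of D] by (simp add: k_def)
  ultimately show ?thesis by simp
qed

section \<open>Partial derivatives\<close>

abbreviation D\<^sub>x :: "(plane \<Rightarrow> 'a::real_normed_vector) \<Rightarrow> plane \<Rightarrow> 'a" where
  "D\<^sub>x \<equiv> partial_x UNIV"

abbreviation D\<^sub>y :: "(plane \<Rightarrow> 'a::real_normed_vector) \<Rightarrow> plane \<Rightarrow> 'a" where
  "D\<^sub>y \<equiv> partial_y UNIV"

lemma partial_x_eq:
  assumes "(f has_derivative L) (at z)"
  shows "D\<^sub>x f z = L (1, 0)"
proof -
  have "((\<lambda>t. f (t, snd z)) has_derivative (\<lambda>h. L (h, 0))) (at (fst z))"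
  proof -
    have "((\<lambda>t. (t, snd z)) has_derivative (\<lambda>h. (h, 0))) (at (fst z))"
      by (intro has_derivative_Pair has_derivative_ident has_derivative_const)
    from has_derivative_compose[OF this, of f L] show ?thesis using assms by simp
  qed
  moreover have "(\<lambda>h. L (h, 0)) = (\<lambda>h. h *\<^sub>R L (1, 0))"
    using linear_scale[OF has_derivative_linear[OF assms], of _ "(1, 0)"] by (intro ext) (metis mult.right_neutral mult_zero_right real_scaleR_def scaleR_Pair)
  ultimately have "((\<lambda>t. f (t, snd z)) has_vector_derivative L (1, 0)) (at (fst z))"
    by (simp only: has_vector_derivative_def)
  then have "vector_derivative (\<lambda>t. f (t, snd z)) (at (fst z)) = L (1, 0)" by (rule vector_derivative_at)
  then show ?thesis by (simp add: partial_x_def split_beta)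
qed

lemma partial_y_eq:
  assumes "(f has_derivative L) (at z)"
  shows "D\<^sub>y f z = L (0, 1)"
proof -
  have "((\<lambda>t. f (fst z, t)) has_derivative (\<lambda>h. L (0, h))) (at (snd z))"
  proof -
    have "((\<lambda>t. (fst z, t)) has_derivative (\<lambda>h. (0, h))) (at (snd z))"
      by (intro has_derivative_Pair has_derivative_ident has_derivative_const)
    from has_derivative_compose[OF this, of f L] show ?thesis using assms by simp
  qed
  moreover have "(\<lambda>h. L (0, h)) = (\<lambda>h. h *\<^sub>R L (0, 1))"
    using linear_scale[OF has_derivative_linear[OF assms], of _ "(0, 1)"] by (intro ext) (metis mult.right_neutral mult_zero_right real_scaleR_def scaleR_Pair)
  ultimately have "((\<lambda>t. f (fst z, t)) has_vector_derivative L (0, 1)) (at (snd z))"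
    by (simp only: has_vector_derivative_def)
  then have "vector_derivative (\<lambda>t. f (fst z, t)) (at (snd z)) = L (0, 1)" by (rule vector_derivative_at)
  then show ?thesis by (simp add: partial_y_def split_beta)
qed

lemma has_derivative_partials:
  assumes "f differentiable (at z)"
  shows "(f has_derivative (\<lambda>h. fst h *\<^sub>R D\<^sub>x f z + snd h *\<^sub>R D\<^sub>y f z)) (at z)"
proof -
  obtain L where L: "(f has_derivative L) (at z)"
    using assms by (auto simp: differentiable_def)
  interpret linear L by (rule has_derivative_linear[OF L])
  have "L h = fst h *\<^sub>R L (1, 0) + snd h *\<^sub>R L (0, 1)" for h
    using add[of "fst h *\<^sub>R (1, 0)" "snd h *\<^sub>R (0, 1)"] scale[of "fst h" "(1, 0)"] scale[of "snd h" "(0, 1)"]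
    by simp
  then have "L = (\<lambda>h. fst h *\<^sub>R L (1, 0) + snd h *\<^sub>R L (0, 1))" by (rule ext)
  then show ?thesis
    using L partial_x_eq[OF L] partial_y_eq[OF L] by simp
qed

text \<open>A finite second moment gives Fourier integrals a quadratic Taylor remainder, so this
  criterion differentiates them without a theorem on parameter integrals.\<close>

lemma has_derivative_quadratic:
  fixes F :: "'a::real_normed_vector \<Rightarrow> 'b::real_normed_vector"
  assumes L: "bounded_linear L" and le: "\<And>h. norm (F (x + h) - F x - L h) \<le> C * (norm h)\<^sup>2"
  shows "(F has_derivative L) (at x)"
  unfolding has_derivative_at
proof (intro conjI L)
  show "(\<lambda>h. norm (F (x + h) - F x - L h) / norm h) \<midarrow>0\<rightarrow> 0"
  proof (rule Lim_null_comparison)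
    have "norm (norm (F (x + h) - F x - L h) / norm h) \<le> C * norm h" for h
      using le[of h] by (cases "h = 0") (auto simp: field_simps power2_eq_square)
    then show "\<forall>\<^sub>F h in at 0. norm (norm (F (x + h) - F x - L h) / norm h) \<le> C * norm h" by simp
    show "(\<lambda>h. C * norm h) \<midarrow>0\<rightarrow> 0" by (auto intro!: tendsto_eq_intros)
  qed
qed

section \<open>The Fourier transform\<close>

text \<open>The normalising factor sits entirely in \<open>fourier\<close>, so this bare integral
  with the opposite sign in the exponent is its inverse.\<close>

definition ift :: "(plane \<Rightarrow> complex) \<Rightarrow> plane \<Rightarrow> complex" where
  "ift \<phi> z = (LINT w|lborel. \<phi> w * cis (w \<bullet> z))"

definition mulx :: "(plane \<Rightarrow> complex) \<Rightarrow> plane \<Rightarrow> complex" where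
  "mulx \<phi> z = complex_of_real (fst z) * \<phi> z"

definition muly :: "(plane \<Rightarrow> complex) \<Rightarrow> plane \<Rightarrow> complex" where
  "muly \<phi> z = complex_of_real (snd z) * \<phi> z"

lemma fourier_eq_ift: "fourier \<phi> \<xi> = complex_of_real (1 / (4 * pi\<^sup>2)) * ift \<phi> (- \<xi>)"
proof (cases \<xi>)
  case (Pair a b)
  have "\<phi> w * exp (- \<i> * complex_of_real (a * fst w + b * snd w)) = \<phi> w * cis (w \<bullet> - \<xi>)" for w
    by (simp add: cis_conv_exp Pair inner_prod_def algebra_simps)
  then have "(LINT w|lborel. \<phi> w * exp (- \<i> * complex_of_real (a * fst w + b * snd w))) = ift \<phi> (- \<xi>)"
    unfolding ift_def by (intro Bochner_Integration.integral_cong) auto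
  then show ?thesis
    by (simp add: fourier_def Pair case_prod_unfold)
qed

lemma cis_inner_measurable [measurable]: "(\<lambda>w::plane. cis (w \<bullet> z)) \<in> borel_measurable borel"
  by (intro borel_measurable_continuous_onI continuous_intros)

lemma integrable_mult_cis:
  fixes \<phi> :: "plane \<Rightarrow> complex"
  assumes "integrable lborel \<phi>"
  shows "integrable lborel (\<lambda>w. \<phi> w * cis (w \<bullet> z))"
proof (rule Bochner_Integration.integrable_bound[OF assms])
  show "(\<lambda>w. \<phi> w * cis (w \<bullet> z)) \<in> borel_measurable lborel"
    using borel_measurable_integrable[OF assms] cis_inner_measurable[of z]
    by (intro borel_measurable_times) auto
qed (simp add: norm_mult)

lemma norm_ift_le:
  assumes "integrable lborel \<phi>"
  shows "cmod (ift \<phi> z) \<le> (LINT w|lborel. cmod (\<phi> w))"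
proof -
  have "cmod (ift \<phi> z) \<le> (LINT w|lborel. cmod (\<phi> w * cis (w \<bullet> z)))"
    unfolding ift_def by (rule integral_norm_bound)
  then show ?thesis by (simp add: norm_mult)
qed

lemma norm_fourier_le:
  assumes "integrable lborel \<phi>"
  shows "cmod (fourier \<phi> z) \<le> (LINT w|lborel. cmod (\<phi> w)) / (4 * pi\<^sup>2)"
proof -
  have "cmod (fourier \<phi> z) = (1 / (4 * pi\<^sup>2)) * cmod (ift \<phi> (- z))"
    by (simp only: fourier_eq_ift norm_mult norm_of_real) simp
  also have "\<dots> \<le> (1 / (4 * pi\<^sup>2)) * (LINT w|lborel. cmod (\<phi> w))"
    by (intro mult_left_mono norm_ift_le assms) simp
  finally show ?thesis by simp
qed

text \<open>Second moments control first ones through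
  \<open>norm z \<le> 1 + (norm z)\<^sup>2\<close>.\<close>

lemma moments_integrable:
  assumes i: "integrable lborel \<phi>" and i2: "integrable lborel (\<lambda>z. (norm z)\<^sup>2 *\<^sub>R \<phi> z)"
  shows "integrable lborel (mulx \<phi>)" "integrable lborel (muly \<phi>)"
proof -
  have [measurable]: "\<phi> \<in> borel_measurable borel" using i by (auto dest: borel_measurable_integrable)
  have int: "integrable lborel (\<lambda>z. cmod (\<phi> z) + (norm z)\<^sup>2 * cmod (\<phi> z))"
    using integrable_norm[OF i] integrable_norm[OF i2] by simp
  have le: "t * cmod (\<phi> z) \<le> \<bar>cmod (\<phi> z) + (norm z)\<^sup>2 * cmod (\<phi> z)\<bar>" if "t \<le> norm z" for t z
  proof -
    have "0 \<le> (norm z - 1)\<^sup>2" by simp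
    then have "t \<le> 1 + (norm z)\<^sup>2"
      using that norm_ge_zero[of z] unfolding power2_diff power_one mult_1_right by linarith
    from mult_right_mono[OF this, of "cmod (\<phi> z)"] show ?thesis by (simp add: algebra_simps)
  qed
  have "cmod (mulx \<phi> z) \<le> \<bar>cmod (\<phi> z) + (norm z)\<^sup>2 * cmod (\<phi> z)\<bar>"
    and "cmod (muly \<phi> z) \<le> \<bar>cmod (\<phi> z) + (norm z)\<^sup>2 * cmod (\<phi> z)\<bar>" for z
    using le[of "\<bar>fst z\<bar>" z] le[of "\<bar>snd z\<bar>" z] norm_fst_le[of "fst z" "snd z"] norm_snd_le[of "snd z" "fst z"]
    by (simp_all add: mulx_def muly_def norm_mult)
  moreover have "mulx \<phi> \<in> borel_measurable lborel" "muly \<phi> \<in> borel_measurable lborel"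
    unfolding mulx_def[abs_def] muly_def[abs_def] by measurable
  ultimately show "integrable lborel (mulx \<phi>)" "integrable lborel (muly \<phi>)"
    by (auto intro!: Bochner_Integration.integrable_bound[OF int])
qed

lemma cis_remainder: "cmod (cis (a + t) - cis a - \<i> * of_real t * cis a) \<le> t\<^sup>2 / 2"
proof -
  have "cis (a + t) - cis a - \<i> * of_real t * cis a = cis a * (iexp t - (\<Sum>k\<le>1. (\<i> * of_real t) ^ k / fact k))"
    by (simp add: cis_mult[symmetric] cis_conv_exp[of t] algebra_simps)
  also have "cmod \<dots> \<le> \<bar>t\<bar> ^ Suc 1 / fact (Suc 1)"
    using iexp_approx1[of t 1] by (simp add: norm_mult)
  finally show ?thesis by (simp add: power2_eq_square)
qed

text \<open>Integrating \<open>cis_remainder\<close> and applying Cauchy-Schwarz to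
  \<open>w \<bullet> h\<close> bounds the remainder by the second moment times
  \<open>(norm h)\<^sup>2\<close>.\<close>

lemma ift_has_derivative:
  assumes i: "integrable lborel \<phi>" and i2: "integrable lborel (\<lambda>z. (norm z)\<^sup>2 *\<^sub>R \<phi> z)"
  shows "(ift \<phi> has_derivative
    (\<lambda>h. fst h *\<^sub>R (\<i> * ift (mulx \<phi>) z) + snd h *\<^sub>R (\<i> * ift (muly \<phi>) z))) (at z)"
proof (rule has_derivative_quadratic)
  show "bounded_linear (\<lambda>h::plane. fst h *\<^sub>R (\<i> * ift (mulx \<phi>) z) + snd h *\<^sub>R (\<i> * ift (muly \<phi>) z))"
    by (intro bounded_linear_intros)
  note mi = moments_integrable[OF i i2]
  fix h :: plane
  define R where "R = (\<lambda>w. \<phi> w * (cis (w \<bullet> z + w \<bullet> h) - cis (w \<bullet> z) - \<i> * of_real (w \<bullet> h) * cis (w \<bullet> z)))"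
  have R_eq: "R w = \<phi> w * cis (w \<bullet> (z + h)) - \<phi> w * cis (w \<bullet> z)
      - (fst h *\<^sub>R (\<i> * (mulx \<phi> w * cis (w \<bullet> z))) + snd h *\<^sub>R (\<i> * (muly \<phi> w * cis (w \<bullet> z))))" for w
    by (simp add: R_def mulx_def muly_def inner_prod_def inner_add_right algebra_simps scaleR_conv_of_real)
  have "ift \<phi> (z + h) - ift \<phi> z - (fst h *\<^sub>R (\<i> * ift (mulx \<phi>) z) + snd h *\<^sub>R (\<i> * ift (muly \<phi>) z))
      = (LINT w|lborel. R w)"
    unfolding R_eq using i mi by (simp add: ift_def integrable_mult_cis)
  also have "cmod \<dots> \<le> (LINT w|lborel. cmod (R w))"
    by (rule integral_norm_bound)
  also have "\<dots> \<le> (LINT w|lborel. (norm h)\<^sup>2 * norm ((norm w)\<^sup>2 *\<^sub>R \<phi> w))"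
  proof (rule integral_mono)
    show "integrable lborel (\<lambda>w. cmod (R w))"
      unfolding R_eq using i mi by (intro integrable_norm) (simp add: integrable_mult_cis)
    show "integrable lborel (\<lambda>w. (norm h)\<^sup>2 * norm ((norm w)\<^sup>2 *\<^sub>R \<phi> w))"
      by (intro integrable_mult_right integrable_norm i2)
    fix w
    have "cmod (R w) \<le> cmod (\<phi> w) * ((w \<bullet> h)\<^sup>2 / 2)"
      unfolding R_def norm_mult by (intro mult_left_mono cis_remainder) simp
    also have "\<dots> \<le> cmod (\<phi> w) * (norm w * norm h)\<^sup>2"
    proof (intro mult_left_mono)
      have "(w \<bullet> h)\<^sup>2 \<le> (norm w * norm h)\<^sup>2"
        using Cauchy_Schwarz_ineq2[of w h] by (simp add: abs_le_square_iff[symmetric])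
      then show "(w \<bullet> h)\<^sup>2 / 2 \<le> (norm w * norm h)\<^sup>2" by (smt (verit) zero_le_power2 field_sum_of_halves)
    qed simp
    finally show "cmod (R w) \<le> (norm h)\<^sup>2 * norm ((norm w)\<^sup>2 *\<^sub>R \<phi> w)"
      by (simp add: power_mult_distrib mult_ac)
  qed
  finally show "cmod (ift \<phi> (z + h) - ift \<phi> z - (fst h *\<^sub>R (\<i> * ift (mulx \<phi>) z) + snd h *\<^sub>R (\<i> * ift (muly \<phi>) z)))
      \<le> (LINT w|lborel. norm ((norm w)\<^sup>2 *\<^sub>R \<phi> w)) * (norm h)\<^sup>2"
    by (simp add: mult.commute)
qed

lemma ift_cmult: "ift (\<lambda>z. c * \<phi> z) w = c * ift \<phi> w"
  by (simp add: ift_def mult.assoc)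

lemma fourier_cmult: "fourier (\<lambda>z. c * \<phi> z) w = c * fourier \<phi> w"
  by (simp add: fourier_eq_ift ift_cmult)

lemma fourier_has_derivative:
  assumes i: "integrable lborel \<phi>" and i2: "integrable lborel (\<lambda>z. (norm z)\<^sup>2 *\<^sub>R \<phi> z)"
  shows "(fourier \<phi> has_derivative
    (\<lambda>h. fst h *\<^sub>R (- \<i> * fourier (mulx \<phi>) z) + snd h *\<^sub>R (- \<i> * fourier (muly \<phi>) z))) (at z)"
proof -
  have "((\<lambda>z. complex_of_real (1 / (4 * pi\<^sup>2)) * ift \<phi> (- z)) has_derivative
    (\<lambda>h. complex_of_real (1 / (4 * pi\<^sup>2)) * (fst (- h) *\<^sub>R (\<i> * ift (mulx \<phi>) (- z)) + snd (- h) *\<^sub>R (\<i> * ift (muly \<phi>) (- z))))) (at z)"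
    by (rule has_derivative_mult_right has_derivative_compose[OF _ ift_has_derivative[OF i i2]] derivative_intros)+
  moreover have "(\<lambda>h. complex_of_real (1 / (4 * pi\<^sup>2)) * (fst (- h) *\<^sub>R (\<i> * ift (mulx \<phi>) (- z)) + snd (- h) *\<^sub>R (\<i> * ift (muly \<phi>) (- z))))
      = (\<lambda>h. fst h *\<^sub>R (- \<i> * fourier (mulx \<phi>) z) + snd h *\<^sub>R (- \<i> * fourier (muly \<phi>) z))"
    by (simp add: fourier_eq_ift fun_eq_iff scaleR_conv_of_real field_simps)
  ultimately show ?thesis
    by (simp only: fourier_eq_ift[abs_def])
qed

lemma fourier_partials:
  assumes i: "integrable lborel \<phi>" and i2: "integrable lborel (\<lambda>z. (norm z)\<^sup>2 *\<^sub>R \<phi> z)"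
  shows "fourier \<phi> differentiable (at z)"
    "D\<^sub>x (fourier \<phi>) = fourier (\<lambda>z. - \<i> * mulx \<phi> z)"
    "D\<^sub>y (fourier \<phi>) = fourier (\<lambda>z. - \<i> * muly \<phi> z)"
  using partial_x_eq[OF fourier_has_derivative[OF i i2]] partial_y_eq[OF fourier_has_derivative[OF i i2]]
    fourier_has_derivative[OF i i2, of z]
  by (auto simp: differentiable_def fourier_cmult[of "- \<i>", simplified])

text \<open>Integration by parts: \<open>\<phi>\<close> times the exponential has directional
  derivative \<open>E\<close>, whose integral is zero. Integrability of both functions stands in for
  decay at infinity, so no boundary term has to be estimated.\<close>

lemma fourier_of_directional_derivative:
  fixes \<phi> D :: "plane \<Rightarrow> complex"
  assumes der: "\<And>z. (\<phi> has_derivative (\<lambda>h. fst h *\<^sub>R Dx z + snd h *\<^sub>R Dy z)) (at z)"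
    and D: "D = (\<lambda>z. fst v *\<^sub>R Dx z + snd v *\<^sub>R Dy z)"
    and cont: "continuous_on UNIV D"
    and i: "integrable lborel \<phi>" and iD: "integrable lborel D"
  shows "fourier D \<xi> = \<i> * of_real (v \<bullet> \<xi>) * fourier \<phi> \<xi>"
proof -
  define \<Psi> where "\<Psi> = (\<lambda>z. \<phi> z * cis (z \<bullet> - \<xi>))"
  define E where "E = (\<lambda>z. D z * cis (z \<bullet> - \<xi>) - \<i> * of_real (v \<bullet> \<xi>) * (\<phi> z * cis (z \<bullet> - \<xi>)))"
  have c\<phi>: "continuous_on UNIV \<phi>"
    using der by (meson continuous_at_imp_continuous_on has_derivative_continuous)
  have "(LINT z|lborel. E z) = 0"
  proof (rule integral_directional_derivative_eq_0)
    fix z s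
    let ?p = "\<lambda>s. z + s *\<^sub>R v"
    have d1: "((\<lambda>s. \<phi> (?p s)) has_vector_derivative D (?p s)) (at s)"
    proof -
      have "((\<lambda>s. \<phi> (?p s)) has_derivative (\<lambda>h. fst (h *\<^sub>R v) *\<^sub>R Dx (?p s) + snd (h *\<^sub>R v) *\<^sub>R Dy (?p s))) (at s)"
        by (rule has_derivative_compose[OF _ der]) (auto intro!: derivative_eq_intros)
      then show ?thesis
        by (simp add: has_vector_derivative_def D scaleR_right_distrib)
    qed
    have d2: "((\<lambda>s. cis (?p s \<bullet> - \<xi>)) has_vector_derivative (- \<i> * of_real (v \<bullet> \<xi>) * cis (?p s \<bullet> - \<xi>))) (at s)"
    proof -
      have "((\<lambda>s. ?p s \<bullet> - \<xi>) has_derivative (\<lambda>h. h * (v \<bullet> - \<xi>))) (at s)"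
        by (auto intro!: derivative_eq_intros simp: inner_add_left)
      from has_derivative_compose[OF has_derivative_mult_right[OF has_derivative_of_real[OF this], of \<i>]
          DERIV_exp[unfolded has_field_derivative_def]]
      show ?thesis
        by (simp add: cis_conv_exp has_vector_derivative_def scaleR_conv_of_real mult_ac)
    qed
    have "((\<lambda>s. \<phi> (?p s) * cis (?p s \<bullet> - \<xi>)) has_vector_derivative
       \<phi> (?p s) * (- \<i> * of_real (v \<bullet> \<xi>) * cis (?p s \<bullet> - \<xi>)) + D (?p s) * cis (?p s \<bullet> - \<xi>)) (at s)"
      by (rule has_vector_derivative_mult[OF d1 d2])
    then show "((\<lambda>s. \<Psi> (?p s)) has_vector_derivative E (?p s)) (at s)"
      by (simp add: \<Psi>_def E_def algebra_simps)
  next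
    show "continuous_on UNIV E" unfolding E_def by (intro continuous_intros cont c\<phi>)
    show "integrable lborel \<Psi>" unfolding \<Psi>_def by (rule integrable_mult_cis[OF i])
    show "integrable lborel E" unfolding E_def
      by (intro Bochner_Integration.integrable_diff integrable_mult_right integrable_mult_cis i iD)
  qed
  then have "ift D (- \<xi>) = \<i> * of_real (v \<bullet> \<xi>) * ift \<phi> (- \<xi>)"
    unfolding E_def ift_def
    using integrable_mult_cis[OF i, of "- \<xi>"] integrable_mult_cis[OF iD, of "- \<xi>"] by simp
  then show ?thesis by (simp add: fourier_eq_ift)
qed

lemma fourier_of_partials:
  fixes \<phi> :: "plane \<Rightarrow> complex"
  assumes d: "\<And>z. \<phi> differentiable (at z)" and i: "integrable lborel \<phi>"
  shows "continuous_on UNIV (D\<^sub>x \<phi>) \<Longrightarrow> integrable lborel (D\<^sub>x \<phi>) \<Longrightarrow>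
      fourier (D\<^sub>x \<phi>) \<xi> = \<i> * mulx (fourier \<phi>) \<xi>"
    and "continuous_on UNIV (D\<^sub>y \<phi>) \<Longrightarrow> integrable lborel (D\<^sub>y \<phi>) \<Longrightarrow>
      fourier (D\<^sub>y \<phi>) \<xi> = \<i> * muly (fourier \<phi>) \<xi>"
  using fourier_of_directional_derivative[OF has_derivative_partials[OF d], of "D\<^sub>x \<phi>" "(1, 0)"]
    fourier_of_directional_derivative[OF has_derivative_partials[OF d], of "D\<^sub>y \<phi>" "(0, 1)"] i
  by (auto simp: mulx_def muly_def inner_prod_def)

section \<open>Fourier inversion\<close>

definition gauss :: "plane \<Rightarrow> complex" where
  "gauss w = complex_of_real (exp (- ((fst w)\<^sup>2 + (snd w)\<^sup>2) / 2))"

lemma continuous_gauss [continuous_intros]: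
  "continuous_on A f \<Longrightarrow> continuous_on A (\<lambda>x. gauss (f x))"
  unfolding gauss_def by (intro continuous_intros) auto

lemma measurable_gauss [measurable]: "gauss \<in> borel_measurable borel"
  by (intro borel_measurable_continuous_onI continuous_intros)

lemma norm_gauss_le: "cmod (gauss w) \<le> 1"
  by (simp add: gauss_def)

text \<open>This is the characteristic function of the standard normal distribution, freed of its
  normalising factor.\<close>

lemma std_normal_transform:
  "integrable lborel (\<lambda>x::real. complex_of_real (exp (- x\<^sup>2 / 2)) * cis (x * t))" (is ?I)
  "(LINT x|lborel. complex_of_real (exp (- x\<^sup>2 / 2)) * cis (x * t)) = complex_of_real (sqrt (2 * pi) * exp (- t\<^sup>2 / 2))" (is ?E)
proof -
  have s: "sqrt (2 * pi) > 0" by simp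
  have e: "exp (- x\<^sup>2 / 2) = sqrt (2 * pi) * std_normal_density x" for x
    by (simp add: std_normal_density_def)
  have ii: "integrable lborel (\<lambda>x::real. exp (- x\<^sup>2 / 2))"
    unfolding e by (intro integrable_mult_right integrable_normal_density) simp
  show ?I
  proof (rule Bochner_Integration.integrable_bound[OF ii])
    show "(\<lambda>x. complex_of_real (exp (- x\<^sup>2 / 2)) * cis (x * t)) \<in> borel_measurable lborel"
      by (simp, intro borel_measurable_continuous_onI continuous_intros) auto
  qed (simp add: norm_mult)
  have "(LINT x|lborel. complex_of_real (exp (- x\<^sup>2 / 2)) * cis (x * t))
      = (LINT x|lborel. complex_of_real (sqrt (2 * pi)) * (std_normal_density x *\<^sub>R iexp (t * x)))"
    by (simp only: e cis_conv_exp scaleR_conv_of_real of_real_mult mult_ac)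
  also have "\<dots> = complex_of_real (sqrt (2 * pi)) * (LINT x|lborel. std_normal_density x *\<^sub>R iexp (t * x))"
    by (rule integral_mult_right_zero)
  also have "(LINT x|lborel. std_normal_density x *\<^sub>R iexp (t * x)) = char std_normal_distribution t"
    by (subst char_def, subst integral_density) auto
  finally show ?E
    by (simp add: char_std_normal_distribution)
qed

lemma integrable_gauss: "integrable lborel gauss"
proof -
  have i: "integrable lborel (\<lambda>x::real. complex_of_real (exp (- x\<^sup>2 / 2)))"
    using std_normal_transform(1)[of 0] by simp
  have "integrable (lborel \<Otimes>\<^sub>M lborel) gauss"
    by (rule integrable_prod_bound[OF i i]) (auto simp: gauss_def exp_add[symmetric] add_divide_distrib field_simps)
  then show ?thesis by (simp add: lborel_prod)
qed

text \<open>The plane Gaussian is a product, so its transform splits into two one-dimensional ones,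
  each contributing \<open>sqrt (2 * pi)\<close>.\<close>

lemma ift_gauss: "ift gauss z = 2 * of_real pi * gauss z"
proof -
  define E where "E = (\<lambda>x t. complex_of_real (exp (- x\<^sup>2 / 2)) * cis (x * t))"
  have eq: "gauss (x, y) * cis ((x, y) \<bullet> z) = E x (fst z) * E y (snd z)" for x y
    by (simp add: gauss_def E_def inner_prod_def cis_mult[symmetric] add_divide_distrib exp_add[symmetric] diff_divide_distrib
        of_real_mult[symmetric] mult_ac)
  have "integrable (lborel \<Otimes>\<^sub>M lborel) (\<lambda>(x, y). gauss (x, y) * cis ((x, y) \<bullet> z))"
    using integrable_mult_cis[OF integrable_gauss, of z] by (simp add: lborel_prod case_prod_beta')
  then have "ift gauss z = (LINT x|lborel. LINT y|lborel. gauss (x, y) * cis ((x, y) \<bullet> z))"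
    by (subst lborel_pair.integral_fst) (simp_all add: ift_def lborel_prod case_prod_beta')
  also have "\<dots> = (LINT x|lborel. E x (fst z)) * (LINT y|lborel. E y (snd z))"
    unfolding eq by simp
  also have "\<dots> = complex_of_real (sqrt (2 * pi) * exp (- (fst z)\<^sup>2 / 2)) * complex_of_real (sqrt (2 * pi) * exp (- (snd z)\<^sup>2 / 2))"
    unfolding E_def std_normal_transform(2) ..
  also have "\<dots> = complex_of_real ((sqrt (2 * pi) * sqrt (2 * pi)) * (exp (- (fst z)\<^sup>2 / 2) * exp (- (snd z)\<^sup>2 / 2)))"
    by (simp only: of_real_mult mult_ac)
  also have "\<dots> = 2 * of_real pi * gauss z"
    by (simp add: gauss_def exp_add[symmetric] add_divide_distrib diff_divide_distrib)
  finally show ?thesis .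
qed

lemma ift_gauss_scaled:
  assumes "\<delta> > 0"
  shows "(LINT w|lborel. gauss (\<delta> *\<^sub>R w) * cis (w \<bullet> z)) = of_real (2 * pi / \<delta>\<^sup>2) * gauss ((1 / \<delta>) *\<^sub>R z)"
proof -
  define \<psi> where "\<psi> = (\<lambda>w. gauss w * cis (w \<bullet> ((1 / \<delta>) *\<^sub>R z)))"
  have "ift gauss ((1 / \<delta>) *\<^sub>R z) = (LINT w|lborel. \<psi> w)"
    by (simp add: ift_def \<psi>_def)
  also have "\<dots> = \<bar>\<delta> * \<delta>\<bar> *\<^sub>R (LINT w|lborel. \<psi> (0 + \<delta> * fst w, 0 + \<delta> * snd w))"
  proof (rule integral_plane_affine)
    show "\<psi> \<in> borel_measurable borel"
      unfolding \<psi>_def by (intro borel_measurable_continuous_onI continuous_intros)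
  qed (use assms in auto)
  also have "(\<lambda>w. \<psi> (0 + \<delta> * fst w, 0 + \<delta> * snd w)) = (\<lambda>w. gauss (\<delta> *\<^sub>R w) * cis (w \<bullet> z))"
    using assms by (auto simp: \<psi>_def fun_eq_iff inner_prod_def gauss_def)
  finally show ?thesis
    using assms by (simp add: ift_gauss scaleR_conv_of_real field_simps power2_eq_square)
qed

text \<open>A Gaussian factor \<open>gauss (\<delta> *\<^sub>R \<xi>)\<close> makes the double
  integral absolutely convergent. After Fubini the integral is a Gaussian average of
  \<open>\<phi>\<close> around \<open>z\<close> of width \<delta>. Letting \<delta> tend to 0 in
  both forms identifies the limits.\<close>

theorem fourier_inversion:
  assumes cont: "continuous_on UNIV \<phi>" and bdd: "\<And>z. cmod (\<phi> z) \<le> B"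
    and i: "integrable lborel \<phi>" and iF: "integrable lborel (fourier \<phi>)"
  shows "\<phi> z = ift (fourier \<phi>) z"
proof -
  define \<delta> :: "nat \<Rightarrow> real" where "\<delta> n = 1 / Suc n" for n
  have \<delta>: "\<delta> n > 0" "\<delta> \<longlonglongrightarrow> 0" for n
    by (simp add: \<delta>_def) (use LIMSEQ_inverse_real_of_nat in \<open>simp add: \<delta>_def[abs_def] inverse_eq_divide\<close>)
  define A where "A n = (LINT \<xi>|lborel. (fourier \<phi> \<xi> * cis (\<xi> \<bullet> z)) * gauss (\<delta> n *\<^sub>R \<xi>))" for n
  have [measurable]: "\<phi> \<in> borel_measurable borel" "fourier \<phi> \<in> borel_measurable borel"
    using i iF by (auto dest: borel_measurable_integrable)
  have gm: "(\<lambda>\<xi>::plane. gauss (d *\<^sub>R \<xi>)) \<in> borel_measurable borel" for d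
    by (intro borel_measurable_continuous_onI continuous_intros)
  have "A \<longlonglongrightarrow> (LINT \<xi>|lborel. (fourier \<phi> \<xi> * cis (\<xi> \<bullet> z)) * gauss 0)"
    unfolding A_def
  proof (rule integral_dominated_convergence)
    show "integrable lborel (\<lambda>\<xi>. cmod (fourier \<phi> \<xi>))" using iF by simp
    show "AE \<xi> in lborel. (\<lambda>n. fourier \<phi> \<xi> * cis (\<xi> \<bullet> z) * gauss (\<delta> n *\<^sub>R \<xi>)) \<longlonglongrightarrow> fourier \<phi> \<xi> * cis (\<xi> \<bullet> z) * gauss 0"
    proof (intro AE_I2 tendsto_mult tendsto_const)
      fix \<xi> :: plane
      have "(\<lambda>n. \<delta> n *\<^sub>R \<xi>) \<longlonglongrightarrow> 0 *\<^sub>R \<xi>" by (intro tendsto_intros \<delta>)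
      then show "(\<lambda>n. gauss (\<delta> n *\<^sub>R \<xi>)) \<longlonglongrightarrow> gauss 0"
        using continuous_on_tendsto_compose[OF continuous_gauss[OF continuous_on_id[of UNIV]]] by simp
    qed
    show "AE \<xi> in lborel. cmod (fourier \<phi> \<xi> * cis (\<xi> \<bullet> z) * gauss (\<delta> n *\<^sub>R \<xi>)) \<le> cmod (fourier \<phi> \<xi>)" for n
      using norm_gauss_le by (auto simp: norm_mult mult_left_le)
  qed (auto intro!: borel_measurable_times gm cis_inner_measurable)
  then have lim1: "A \<longlonglongrightarrow> ift (fourier \<phi>) z"
    by (simp add: ift_def gauss_def)
  \<comment> \<open>Fubini and then \<open>u = z + \<delta> v\<close>: the factors
    \<open>1 / (4 pi\<^sup>2)\<close>, \<open>2 pi / \<delta>\<^sup>2\<close> and the Jacobian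
    \<open>\<delta>\<^sup>2\<close> leave \<open>1 / (2 pi)\<close>.\<close>
  have A_eq: "A n = of_real (1 / (2 * pi)) * (LINT v|lborel. \<phi> (z + \<delta> n *\<^sub>R v) * gauss v)" for n
  proof -
    define k where "k = (\<lambda>(\<xi>, u). \<phi> u * cis (u \<bullet> - \<xi>) * cis (\<xi> \<bullet> z) * gauss (\<delta> n *\<^sub>R \<xi>))"
    have ig: "integrable lborel (\<lambda>\<xi>. gauss (\<delta> n *\<^sub>R \<xi>))"
      using integrable_plane_affine[of "\<delta> n" "\<delta> n" gauss 0 0] integrable_gauss \<delta>(1)[of n]
      by (simp add: scaleR_prod_def)
    have int_k: "integrable (lborel \<Otimes>\<^sub>M lborel) k"
    proof (rule integrable_prod_bound[OF ig i])
      show "k \<in> borel_measurable borel" unfolding k_def case_prod_beta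
        by (intro borel_measurable_continuous_onI continuous_intros continuous_on_compose2[OF cont]) auto
    qed (simp add: k_def norm_mult)
    have "ift \<phi> (- \<xi>) * (cis (\<xi> \<bullet> z) * gauss (\<delta> n *\<^sub>R \<xi>)) = (LINT u|lborel. k (\<xi>, u))" for \<xi>
      unfolding ift_def integral_mult_left_zero[symmetric] k_def by (simp add: mult.assoc)
    then have "A n = of_real (1 / (4 * pi\<^sup>2)) * (LINT \<xi>|lborel. LINT u|lborel. k (\<xi>, u))"
      by (simp add: A_def fourier_eq_ift mult.assoc)
    also have "(LINT \<xi>|lborel. LINT u|lborel. k (\<xi>, u)) = (LINT u|lborel. LINT \<xi>|lborel. k (\<xi>, u))"
      by (rule lborel_pair.Fubini_integral[symmetric]) (use int_k in simp)
    finally have A1: "A n = of_real (1 / (4 * pi\<^sup>2)) * (LINT u|lborel. LINT \<xi>|lborel. k (\<xi>, u))" .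
    define S where "S = (\<lambda>u. \<phi> u * (of_real (2 * pi / (\<delta> n)\<^sup>2) * gauss ((1 / \<delta> n) *\<^sub>R (z - u))))"
    have kS: "(LINT \<xi>|lborel. k (\<xi>, u)) = S u" for u
    proof -
      have "k (\<xi>, u) = \<phi> u * (gauss (\<delta> n *\<^sub>R \<xi>) * cis (\<xi> \<bullet> (z - u)))" for \<xi>
      proof -
        have "cis (\<xi> \<bullet> (z - u)) = cis (u \<bullet> - \<xi>) * cis (\<xi> \<bullet> z)"
          by (simp add: cis_mult inner_diff_right inner_commute)
        then show ?thesis by (simp add: k_def)
      qed
      then show ?thesis using ift_gauss_scaled[of "\<delta> n" "z - u"] \<delta>(1)[of n] by (simp add: S_def)
    qed
    have "(LINT u|lborel. S u) = \<bar>\<delta> n * \<delta> n\<bar> *\<^sub>R (LINT v|lborel. S (fst z + \<delta> n * fst v, snd z + \<delta> n * snd v))"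
    proof (rule integral_plane_affine)
      show "S \<in> borel_measurable borel" unfolding S_def
        by (intro borel_measurable_continuous_onI continuous_intros continuous_on_compose2[OF cont]) auto
    qed (use \<delta>(1)[of n] in auto)
    also have "(\<lambda>v. S (fst z + \<delta> n * fst v, snd z + \<delta> n * snd v))
       = (\<lambda>v. of_real (2 * pi / (\<delta> n)\<^sup>2) * (\<phi> (z + \<delta> n *\<^sub>R v) * gauss v))"
      using \<delta>(1)[of n] by (auto simp: S_def fun_eq_iff gauss_def scaleR_prod_def plus_prod_def)
    finally have "(LINT u|lborel. S u) = of_real (2 * pi) * (LINT v|lborel. \<phi> (z + \<delta> n *\<^sub>R v) * gauss v)"
      using \<delta>(1)[of n] by (simp add: scaleR_conv_of_real power2_eq_square)
    then show ?thesis
      by (simp add: A1 kS power2_eq_square)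
  qed
  \<comment> \<open>Continuity of \<open>\<phi>\<close> at \<open>z\<close> gives pointwise
    convergence, and its bound \<open>B\<close> the dominating function.\<close>
  have "(\<lambda>n. LINT v|lborel. \<phi> (z + \<delta> n *\<^sub>R v) * gauss v) \<longlonglongrightarrow> (LINT v|lborel. \<phi> z * gauss v)"
  proof (rule integral_dominated_convergence)
    show "integrable lborel (\<lambda>v. B * cmod (gauss v))" using integrable_gauss by simp
    show "AE v in lborel. (\<lambda>n. \<phi> (z + \<delta> n *\<^sub>R v) * gauss v) \<longlonglongrightarrow> \<phi> z * gauss v"
    proof (intro AE_I2 tendsto_mult tendsto_const)
      fix v :: plane
      have "(\<lambda>n. z + \<delta> n *\<^sub>R v) \<longlonglongrightarrow> z + 0 *\<^sub>R v" by (intro tendsto_intros \<delta>)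
      then show "(\<lambda>n. \<phi> (z + \<delta> n *\<^sub>R v)) \<longlonglongrightarrow> \<phi> z"
        using continuous_on_tendsto_compose[OF cont] by simp
    qed
    show "AE v in lborel. cmod (\<phi> (z + \<delta> n *\<^sub>R v) * gauss v) \<le> B * cmod (gauss v)" for n
      unfolding norm_mult by (intro AE_I2 mult_right_mono bdd) simp
    show "(\<lambda>v. \<phi> (z + \<delta> n *\<^sub>R v) * gauss v) \<in> borel_measurable lborel" for n
      by simp
  qed auto
  then have "A \<longlonglongrightarrow> of_real (1 / (2 * pi)) * (LINT v|lborel. \<phi> z * gauss v)"
    unfolding A_eq by (intro tendsto_mult tendsto_const)
  moreover have "(LINT v|lborel. gauss v) = 2 * of_real pi"
    using ift_gauss[of 0] by (simp add: ift_def gauss_def)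
  ultimately have "A \<longlonglongrightarrow> \<phi> z" by simp
  from LIMSEQ_unique[OF this lim1] show ?thesis .
qed

section \<open>Rapidly decreasing functions\<close>

lemma partials_add:
  assumes "\<And>z. f differentiable (at z)" "\<And>z. g differentiable (at z)"
  shows "D\<^sub>x (\<lambda>z. f z + g z) = (\<lambda>z. D\<^sub>x f z + D\<^sub>x g z)"
    "D\<^sub>y (\<lambda>z. f z + g z) = (\<lambda>z. D\<^sub>y f z + D\<^sub>y g z)"
  using partial_x_eq[OF has_derivative_add[OF has_derivative_partials[OF assms(1)] has_derivative_partials[OF assms(2)]]]
    partial_y_eq[OF has_derivative_add[OF has_derivative_partials[OF assms(1)] has_derivative_partials[OF assms(2)]]]
  by (simp_all add: fun_eq_iff)

lemma partials_mult:
  fixes f g :: "plane \<Rightarrow> complex"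
  assumes "\<And>z. f differentiable (at z)" "\<And>z. g differentiable (at z)"
  shows "D\<^sub>x (\<lambda>z. f z * g z) = (\<lambda>z. D\<^sub>x f z * g z + f z * D\<^sub>x g z)"
    "D\<^sub>y (\<lambda>z. f z * g z) = (\<lambda>z. D\<^sub>y f z * g z + f z * D\<^sub>y g z)"
  using partial_x_eq[OF has_derivative_mult[OF has_derivative_partials[OF assms(1)] has_derivative_partials[OF assms(2)]]]
    partial_y_eq[OF has_derivative_mult[OF has_derivative_partials[OF assms(1)] has_derivative_partials[OF assms(2)]]]
  by (simp_all add: fun_eq_iff)

lemma partials_cmult:
  fixes f :: "plane \<Rightarrow> complex"
  assumes "\<And>z. f differentiable (at z)"
  shows "D\<^sub>x (\<lambda>z. c * f z) = (\<lambda>z. c * D\<^sub>x f z)"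
    "D\<^sub>y (\<lambda>z. c * f z) = (\<lambda>z. c * D\<^sub>y f z)"
  using partial_x_eq[OF has_derivative_mult_right[OF has_derivative_partials[OF assms]]]
    partial_y_eq[OF has_derivative_mult_right[OF has_derivative_partials[OF assms]]]
  by (simp_all add: fun_eq_iff)

text \<open>Recursion over all words in the four operations: each closure property becomes an
  induction on \<open>k\<close>, and derivatives never have to be commuted past powers of the
  coordinates. Differentiability at depth 0 makes the partial derivatives of sums and products
  computable.\<close>

fun rapid :: "nat \<Rightarrow> (plane \<Rightarrow> complex) \<Rightarrow> bool" where
  "rapid 0 \<phi> \<longleftrightarrow> (\<forall>z. \<phi> differentiable (at z)) \<and> (\<exists>B. \<forall>z. cmod (\<phi> z) \<le> B)"
| "rapid (Suc k) \<phi> \<longleftrightarrow> rapid 0 \<phi> \<and> rapid k (D\<^sub>x \<phi>) \<and> rapid k (D\<^sub>y \<phi>) \<and>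
     rapid k (mulx \<phi>) \<and> rapid k (muly \<phi>)"

text \<open>The multipliers for \<open>rapid\<close>. The transform of a continuous function of
  bounded support has bounded derivatives of every order but may decay too slowly for
  \<open>rapid\<close>.\<close>

fun tame :: "nat \<Rightarrow> (plane \<Rightarrow> complex) \<Rightarrow> bool" where
  "tame 0 \<phi> \<longleftrightarrow> rapid 0 \<phi>"
| "tame (Suc k) \<phi> \<longleftrightarrow> rapid 0 \<phi> \<and> tame k (D\<^sub>x \<phi>) \<and> tame k (D\<^sub>y \<phi>)"

lemma rapid_0: "rapid k \<phi> \<Longrightarrow> rapid 0 \<phi>"
  by (cases k) auto

lemma tame_0: "tame k \<phi> \<Longrightarrow> rapid 0 \<phi>"
  by (cases k) auto

lemma rapid_pred: "rapid (Suc k) \<phi> \<Longrightarrow> rapid k \<phi>"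
proof (induction k arbitrary: \<phi>)
  case (Suc k)
  then show ?case by (metis rapid.simps(2))
qed auto

lemma tame_pred: "tame (Suc k) \<phi> \<Longrightarrow> tame k \<phi>"
proof (induction k arbitrary: \<phi>)
  case (Suc k)
  then show ?case by (metis tame.simps(2))
qed auto

lemma rapid_0D: "rapid 0 \<phi> \<Longrightarrow> \<phi> differentiable (at z)"
  "rapid 0 \<phi> \<Longrightarrow> continuous_on UNIV \<phi>"
  by (metis rapid.simps(1) continuous_at_imp_continuous_on differentiable_imp_continuous_within)+

lemma rapid_0_add: "rapid 0 \<phi> \<Longrightarrow> rapid 0 \<psi> \<Longrightarrow> rapid 0 (\<lambda>z. \<phi> z + \<psi> z)"
  by (auto intro!: differentiable_add) (meson add_mono norm_triangle_le)

lemma rapid_add: "rapid k \<phi> \<Longrightarrow> rapid k \<psi> \<Longrightarrow> rapid k (\<lambda>z. \<phi> z + \<psi> z)"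
proof (induction k arbitrary: \<phi> \<psi>)
  case (Suc k)
  have m: "mulx (\<lambda>z. \<phi> z + \<psi> z) = (\<lambda>z. mulx \<phi> z + mulx \<psi> z)"
    "muly (\<lambda>z. \<phi> z + \<psi> z) = (\<lambda>z. muly \<phi> z + muly \<psi> z)"
    by (auto simp: mulx_def muly_def algebra_simps)
  from Suc.prems have 0: "rapid 0 \<phi>" "rapid 0 \<psi>" by (auto dest: rapid_0)
  show ?case
    using Suc.prems rapid_0_add[OF 0] partials_add[OF rapid_0D(1)[OF 0(1)] rapid_0D(1)[OF 0(2)]]
    by (simp only: rapid.simps(2) m Suc.IH)
qed (rule rapid_0_add)

lemma rapid_0_mult:
  assumes "rapid 0 u" "rapid 0 \<phi>"
  shows "rapid 0 (\<lambda>z. u z * \<phi> z)"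
proof -
  obtain A B where "\<And>z. cmod (u z) \<le> A" "\<And>z. cmod (\<phi> z) \<le> B" using assms by auto
  then have "cmod (u z * \<phi> z) \<le> A * B" for z
    unfolding norm_mult by (intro mult_mono) (auto intro: order_trans[OF norm_ge_zero])
  then show ?thesis using assms by (auto intro: differentiable_mult)
qed

text \<open>Coordinate factors are all charged to \<open>\<phi>\<close>; only derivatives are shared
  between the factors, by the product rule. Hence bounded derivatives are enough for
  \<open>u\<close>.\<close>

lemma rapid_mult: "tame k u \<Longrightarrow> rapid k \<phi> \<Longrightarrow> rapid k (\<lambda>z. u z * \<phi> z)"
proof (induction k arbitrary: u \<phi>)
  case (Suc k)
  have m: "mulx (\<lambda>z. u z * \<phi> z) = (\<lambda>z. u z * mulx \<phi> z)"
    "muly (\<lambda>z. u z * \<phi> z) = (\<lambda>z. u z * muly \<phi> z)"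
    by (auto simp: mulx_def muly_def algebra_simps)
  from Suc.prems have 0: "rapid 0 u" "rapid 0 \<phi>" by (auto dest: rapid_0 tame_0)
  have k: "tame k u" "rapid k \<phi>" using Suc.prems by (simp_all only: rapid_pred tame_pred)
  show ?case
    using Suc.prems k rapid_0_mult[OF 0] partials_mult[OF rapid_0D(1)[OF 0(1)] rapid_0D(1)[OF 0(2)]]
    by (simp only: rapid.simps(2) tame.simps(2) m Suc.IH rapid_add)
qed (simp del: rapid.simps add: rapid_0_mult)

lemma partials_const: "D\<^sub>x (\<lambda>z. c) = (\<lambda>z. 0)" "D\<^sub>y (\<lambda>z. c) = (\<lambda>z. 0)"
  using partial_x_eq[OF has_derivative_const] partial_y_eq[OF has_derivative_const] by (auto simp: fun_eq_iff)

lemma tame_const: "tame k (\<lambda>z. c)"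
  by (induction k arbitrary: c) (auto simp: partials_const)

lemma rapid_cmult: "rapid k \<phi> \<Longrightarrow> rapid k (\<lambda>z. c * \<phi> z)"
  by (rule rapid_mult[OF tame_const])

definition rapidly :: "(plane \<Rightarrow> complex) \<Rightarrow> bool" where
  "rapidly \<phi> \<longleftrightarrow> (\<forall>k. rapid k \<phi>)"

lemma rapidly_ops:
  assumes "rapidly \<phi>"
  shows "rapidly (D\<^sub>x \<phi>)" "rapidly (D\<^sub>y \<phi>)" "rapidly (mulx \<phi>)" "rapidly (muly \<phi>)"
    "rapidly (\<lambda>z. c * \<phi> z)"
  using assms rapid_cmult unfolding rapidly_def by (metis rapid.simps(2))+

lemma rapidlyD:
  assumes "rapidly \<phi>"
  shows "\<phi> differentiable (at z)" "continuous_on UNIV \<phi>" "\<exists>B. \<forall>z. cmod (\<phi> z) \<le> B"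
  using assms rapid_0D[of \<phi>] unfolding rapidly_def by (metis rapid.simps(1))+

lemma rapidly_integrable:
  assumes "rapidly \<phi>"
  shows "integrable lborel \<phi>"
proof -
  let ?a = "mulx (mulx \<phi>)" and ?b = "muly (muly \<phi>)" and ?c = "mulx (mulx (muly (muly \<phi>)))"
  have "rapidly ?a" "rapidly ?b" "rapidly ?c" using assms by (auto intro: rapidly_ops)
  then obtain A B C D where b: "\<And>z. cmod (\<phi> z) \<le> A" "\<And>z. cmod (?a z) \<le> B" "\<And>z. cmod (?b z) \<le> C" "\<And>z. cmod (?c z) \<le> D"
    using assms by (metis rapidlyD(3))
  show ?thesis
  proof (rule integrable_weight_bound)
    show "\<phi> \<in> borel_measurable borel"
      using rapidlyD(2)[OF assms] by (rule borel_measurable_continuous_onI)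
    fix z
    have "weight z * cmod (\<phi> z) = cmod (\<phi> z) + cmod (?a z) + cmod (?b z) + cmod (?c z)"
      by (simp add: weight_def mulx_def muly_def norm_mult algebra_simps power2_eq_square)
    then show "weight z * norm (\<phi> z) \<le> A + B + C + D" using b[of z] by linarith
  qed
qed

lemma rapidly_integrable_norm2:
  assumes "rapidly \<phi>"
  shows "integrable lborel (\<lambda>z. (norm z)\<^sup>2 *\<^sub>R \<phi> z)"
proof -
  have "(norm z)\<^sup>2 *\<^sub>R \<phi> z = mulx (mulx \<phi>) z + muly (muly \<phi>) z" for z
    by (cases z) (simp add: norm_prod_def mulx_def muly_def scaleR_conv_of_real algebra_simps power2_eq_square)
  moreover have "rapidly (mulx (mulx \<phi>))" "rapidly (muly (muly \<phi>))"
    using assms by (auto intro: rapidly_ops)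
  ultimately show ?thesis by (simp add: rapidly_integrable)
qed

text \<open>The transform exchanges derivatives with coordinate factors up to \<open>- \<i>\<close>,
  so each of the four functions at the next level is again a transform. The premise is
  \<open>rapidly\<close> and not \<open>rapid k\<close> because integrability uses up further
  moments at each level.\<close>

lemma rapid_fourier: "rapidly \<phi> \<Longrightarrow> rapid k (fourier \<phi>)"
proof (induction k arbitrary: \<phi>)
  case 0
  then show ?case
    using fourier_partials(1)[OF rapidly_integrable rapidly_integrable_norm2] norm_fourier_le[OF rapidly_integrable]
    by (metis rapid.simps(1))
next
  case (Suc k)
  note i = rapidly_integrable[OF Suc.prems] rapidly_integrable_norm2[OF Suc.prems]
  note ro = rapidly_ops[OF Suc.prems]
  have 0: "rapid 0 (fourier \<phi>)"
    using fourier_partials(1)[OF i] norm_fourier_le[OF i(1)] by (metis rapid.simps(1))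
  have x: "mulx (fourier \<phi>) = fourier (\<lambda>z. - \<i> * D\<^sub>x \<phi> z)"
    and y: "muly (fourier \<phi>) = fourier (\<lambda>z. - \<i> * D\<^sub>y \<phi> z)"
    using fourier_of_partials[OF rapidlyD(1)[OF Suc.prems] i(1)] rapidly_integrable[OF ro(1)] rapidly_integrable[OF ro(2)]
      rapidlyD(2)[OF ro(1)] rapidlyD(2)[OF ro(2)]
    by (auto intro!: ext simp: fourier_cmult[of "- \<i>", simplified])
  show ?case
    unfolding rapid.simps(2) fourier_partials(2,3)[OF i] x y
    by (intro conjI 0 Suc.IH rapidly_ops(5) ro)
qed

lemma rapidly_fourier: "rapidly \<phi> \<Longrightarrow> rapidly (fourier \<phi>)"
  by (simp add: rapidly_def[of "fourier \<phi>"] rapid_fourier)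

lemma partials_scale:
  fixes \<phi> :: "plane \<Rightarrow> complex"
  assumes d: "\<And>z. \<phi> differentiable (at z)"
  shows "(\<lambda>z. \<phi> (c *\<^sub>R z)) differentiable (at z)"
    "D\<^sub>x (\<lambda>z. \<phi> (c *\<^sub>R z)) = (\<lambda>z. of_real c * D\<^sub>x \<phi> (c *\<^sub>R z))"
    "D\<^sub>y (\<lambda>z. \<phi> (c *\<^sub>R z)) = (\<lambda>z. of_real c * D\<^sub>y \<phi> (c *\<^sub>R z))"
proof -
  have d: "((\<lambda>z. \<phi> (c *\<^sub>R z)) has_derivative
      (\<lambda>h. fst (c *\<^sub>R h) *\<^sub>R D\<^sub>x \<phi> (c *\<^sub>R z) + snd (c *\<^sub>R h) *\<^sub>R D\<^sub>y \<phi> (c *\<^sub>R z))) (at z)" for z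
    by (rule has_derivative_compose[OF _ has_derivative_partials[OF d]]) (intro derivative_intros)
  show "(\<lambda>z. \<phi> (c *\<^sub>R z)) differentiable (at z)"
    using d[of z] by (rule differentiableI)
  show "D\<^sub>x (\<lambda>z. \<phi> (c *\<^sub>R z)) = (\<lambda>z. of_real c * D\<^sub>x \<phi> (c *\<^sub>R z))"
    "D\<^sub>y (\<lambda>z. \<phi> (c *\<^sub>R z)) = (\<lambda>z. of_real c * D\<^sub>y \<phi> (c *\<^sub>R z))"
    using partial_x_eq[OF d] partial_y_eq[OF d] by (auto simp: fun_eq_iff scaleR_conv_of_real)
qed

lemma rapidly_scale:
  assumes "rapidly \<phi>" and c: "c \<noteq> 0"
  shows "rapidly (\<lambda>z. \<phi> (c *\<^sub>R z))"
proof -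
  have "rapid k (\<lambda>z. \<phi> (c *\<^sub>R z))" if "rapidly \<phi>" for k \<phi>
    using that
  proof (induction k arbitrary: \<phi>)
    have base: "rapid 0 (\<lambda>z. \<phi> (c *\<^sub>R z))" if \<phi>: "rapidly \<phi>" for \<phi>
    proof -
      obtain B where "\<And>z. cmod (\<phi> z) \<le> B" using rapidlyD(3)[OF \<phi>] by blast
      then show ?thesis using partials_scale(1)[OF rapidlyD(1)[OF \<phi>]] by (metis rapid.simps(1))
    qed
    {
      case 0 from 0 show ?case by (rule base)
    next
      case (Suc k)
      have m: "mulx (\<lambda>z. \<phi> (c *\<^sub>R z)) = (\<lambda>z. of_real (1 / c) * mulx \<phi> (c *\<^sub>R z))"
        "muly (\<lambda>z. \<phi> (c *\<^sub>R z)) = (\<lambda>z. of_real (1 / c) * muly \<phi> (c *\<^sub>R z))"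
        using c by (auto simp: mulx_def muly_def fun_eq_iff)
      show ?case
        unfolding rapid.simps(2) m partials_scale(2,3)[OF rapidlyD(1)[OF Suc.prems]]
        using base[OF Suc.prems] Suc.IH[OF rapidly_ops(1)[OF Suc.prems]] Suc.IH[OF rapidly_ops(2)[OF Suc.prems]]
          Suc.IH[OF rapidly_ops(3)[OF Suc.prems]] Suc.IH[OF rapidly_ops(4)[OF Suc.prems]]
        by (intro conjI rapid_cmult)
    }
  qed
  then show ?thesis using assms by (simp add: rapidly_def)
qed

lemma rapidly_ift: 
  assumes "rapidly \<phi>"
  shows "rapidly (ift \<phi>)"
proof -
  have "ift \<phi> = (\<lambda>z. complex_of_real (4 * pi\<^sup>2) * fourier \<phi> (- z))"
    by (simp add: fourier_eq_ift fun_eq_iff)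
  then show ?thesis
    using rapidly_ops(5)[OF rapidly_scale[OF rapidly_fourier[OF assms], of "- 1"], of "complex_of_real (4 * pi\<^sup>2)"] by simp
qed

lemma rapidly_schwartz:
  assumes "rapidly \<phi>"
  shows "schwartz \<phi>"
  unfolding schwartz_def smooth_on_def
proof (intro conjI allI)
  show "Ck_on k UNIV \<phi>" for k
    using assms
    by (induction k arbitrary: \<phi>) (auto dest: rapidlyD rapidly_ops)
  fix i j a b
  have "rapidly ((D\<^sub>x ^^ a) ((D\<^sub>y ^^ b) \<phi>))"
  proof (induction a)
    case 0
    show ?case by (induction b) (auto intro: assms rapidly_ops)
  qed (auto intro: rapidly_ops)
  then have m: "rapidly (mderiv a b \<phi>)" by (simp add: mderiv_def)
  \<comment> \<open>Each seminorm is the supremum of \<open>|\<psi>|\<close> for another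
    \<open>rapidly\<close> function, obtained by \<open>j\<close> applications of
    \<open>muly\<close> and \<open>i\<close> of \<open>mulx\<close>.\<close>
  have "\<exists>\<psi>. rapidly \<psi> \<and> (\<forall>z. cmod (\<psi> z) = \<bar>fst z\<bar> ^ i * \<bar>snd z\<bar> ^ j * cmod (mderiv a b \<phi> z))"
  proof (induction i)
    case 0
    show ?case
    proof (induction j)
      case 0
      show ?case using m by auto
    next
      case (Suc j)
      then obtain \<psi> where "rapidly \<psi>" "\<forall>z. cmod (\<psi> z) = \<bar>fst z\<bar> ^ 0 * \<bar>snd z\<bar> ^ j * cmod (mderiv a b \<phi> z)" by blast
      then show ?case
        by (intro exI[of _ "muly \<psi>"] conjI rapidly_ops allI) (simp_all add: muly_def norm_mult split_paired_all)
    qed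
  next
    case (Suc i)
    then obtain \<psi> where "rapidly \<psi>" "\<forall>z. cmod (\<psi> z) = \<bar>fst z\<bar> ^ i * \<bar>snd z\<bar> ^ j * cmod (mderiv a b \<phi> z)" by blast
    then show ?case
      by (intro exI[of _ "mulx \<psi>"] conjI rapidly_ops allI) (simp_all add: mulx_def norm_mult split_paired_all)
  qed
  then obtain \<psi> B where "\<forall>z. cmod (\<psi> z) = \<bar>fst z\<bar> ^ i * \<bar>snd z\<bar> ^ j * cmod (mderiv a b \<phi> z)" "\<forall>z. cmod (\<psi> z) \<le> B"
    using rapidlyD(3) by blast
  then show "bdd_above (range (\<lambda>z. \<bar>fst z\<bar> ^ i * \<bar>snd z\<bar> ^ j * cmod (mderiv a b \<phi> z)))"
    by (intro bdd_aboveI2[of _ _ B]) metis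
qed

section \<open>Bounded functions of bounded support and their transforms\<close>

definition bounded_supp :: "(plane \<Rightarrow> complex) \<Rightarrow> bool" where
  "bounded_supp h \<longleftrightarrow> h \<in> borel_measurable borel \<and> (\<exists>B. \<forall>z. cmod (h z) \<le> B) \<and> (\<exists>r. \<forall>z. r < norm z \<longrightarrow> h z = 0)"

lemma bounded_supp_mult:
  assumes h: "bounded_supp h" and u: "continuous_on UNIV u"
  shows "bounded_supp (\<lambda>z. u z * h z)"
proof -
  obtain B r where B: "\<And>z. cmod (h z) \<le> B" and r: "\<And>z. r < norm z \<Longrightarrow> h z = 0"
    using h unfolding bounded_supp_def by blast
  have "compact (u ` cball 0 r)"
    by (intro compact_continuous_image compact_cball continuous_on_subset[OF u]) auto
  then obtain A where A: "\<And>z. norm z \<le> r \<Longrightarrow> cmod (u z) \<le> A"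
    by (fastforce dest!: compact_imp_bounded simp: bounded_iff)
  have "cmod (u z * h z) \<le> \<bar>A\<bar> * B" for z
  proof (cases "norm z \<le> r")
    case True
    have "cmod (u z) \<le> \<bar>A\<bar>" using A[OF True] by linarith
    then show ?thesis unfolding norm_mult by (intro mult_mono B) auto
  next
    case False
    then show ?thesis using r[of z] B[of z] by (simp add: order_trans[OF norm_ge_zero])
  qed
  then show ?thesis
    using h r borel_measurable_continuous_onI[OF u] unfolding bounded_supp_def
    by (intro conjI exI[of _ "\<bar>A\<bar> * B"] exI[of _ r]) auto
qed

lemma bounded_supp_integrable:
  assumes "bounded_supp h"
  shows "integrable lborel h"
proof -
  have "continuous_on UNIV (\<lambda>z. complex_of_real (weight z))"
    unfolding weight_def by (intro continuous_intros)
  from bounded_supp_mult[OF assms this] obtain B where "\<And>z. cmod (of_real (weight z) * h z) \<le> B"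
    unfolding bounded_supp_def by blast
  then show ?thesis
    using assms weight_pos by (intro integrable_weight_bound[of _ B]) (auto simp: bounded_supp_def norm_mult less_imp_le)
qed

lemma bounded_supp_integrable_norm2:
  assumes "bounded_supp h"
  shows "integrable lborel (\<lambda>z. (norm z)\<^sup>2 *\<^sub>R h z)"
  using bounded_supp_integrable[OF bounded_supp_mult[OF assms, of "\<lambda>z. complex_of_real ((norm z)\<^sup>2)"]]
  by (simp add: scaleR_conv_of_real continuous_intros)

text \<open>Differentiating the transform multiplies \<open>h\<close> by a coordinate, which is
  harmless on a bounded support. Roughness of \<open>h\<close> only affects the decay of the
  transform, hence \<open>tame\<close> instead of \<open>rapid\<close>.\<close>

lemma tame_fourier: "bounded_supp h \<Longrightarrow> tame k (fourier h)"
proof (induction k arbitrary: h)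
  have base: "rapid 0 (fourier h)" if "bounded_supp h" for h
    using fourier_partials(1)[OF bounded_supp_integrable[OF that] bounded_supp_integrable_norm2[OF that]] norm_fourier_le[OF bounded_supp_integrable[OF that]]
    by (metis rapid.simps(1))
  {
    case 0 then show ?case using base by (simp only: tame.simps(1))
  next
    case (Suc k)
    note i = bounded_supp_integrable[OF Suc.prems] bounded_supp_integrable_norm2[OF Suc.prems]
    have "bounded_supp (\<lambda>z. - \<i> * mulx h z)" "bounded_supp (\<lambda>z. - \<i> * muly h z)"
      using bounded_supp_mult[OF Suc.prems, of "\<lambda>z. - \<i> * complex_of_real (fst z)"]
        bounded_supp_mult[OF Suc.prems, of "\<lambda>z. - \<i> * complex_of_real (snd z)"]
      by (auto simp: mulx_def muly_def mult.assoc continuous_intros)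
    then show ?case
      unfolding tame.simps(2) fourier_partials(2,3)[OF i]
      using base[OF Suc.prems] Suc.IH by (simp only: simp_thms)
  }
qed

section \<open>A smooth bump function\<close>

text \<open>The classical flat function \<open>exp (- 1 / t)\<close> with a polynomial in
  \<open>1 / t\<close> in front: a class closed under differentiation, so one derivative formula
  yields all orders.\<close>

definition flat :: "real poly \<Rightarrow> real \<Rightarrow> real" where
  "flat p t = (if t \<le> 0 then 0 else poly p (1 / t) * exp (- (1 / t)))"

text \<open>With \<open>s = 1 / t\<close> the chain rule contributes \<open>- s\<^sup>2\<close>,
  which turns the factor \<open>p' - p\<close> of the s-derivative into
  \<open>s\<^sup>2 (p - p')\<close>.\<close>

definition flat_deriv :: "real poly \<Rightarrow> real poly" where
  "flat_deriv p = [:0, 0, 1:] * (p - pderiv p)"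

lemma poly_times_exp_tendsto_0: "((\<lambda>s. poly p s * exp (- s)) \<longlongrightarrow> 0) at_top" for p :: "real poly"
proof -
  have "((\<lambda>s. \<Sum>i\<le>degree p. coeff p i * (s ^ i / exp s)) \<longlongrightarrow> (\<Sum>i\<le>degree p. coeff p i * 0)) at_top"
    by (intro tendsto_intros tendsto_power_div_exp_0)
  then show ?thesis
    by (simp add: poly_altdef sum_distrib_right exp_minus divide_inverse mult.assoc)
qed

lemma flat_has_derivative: "(flat p has_real_derivative flat (flat_deriv p) t) (at t)"
proof -
  consider "t < 0" | "t = 0" | "t > 0" by linarith
  then show ?thesis
  proof cases
    case 1
    have "((\<lambda>_. 0) has_real_derivative 0) (at t)" by simp
    then have "(flat p has_real_derivative 0) (at t)"
      by (rule has_field_derivative_transform_within_open[of _ _ _ "{..<0}"]) (use 1 in \<open>auto simp: flat_def\<close>)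
    then show ?thesis using 1 by (simp add: flat_def)
  next
    case 3
    have "((\<lambda>t. poly p (1 / t) * exp (- (1 / t))) has_real_derivative flat (flat_deriv p) t) (at t)"
      using 3 by (auto intro!: derivative_eq_intros DERIV_chain2[OF poly_DERIV] simp: flat_def flat_deriv_def field_simps power2_eq_square)
    then show ?thesis
      by (rule has_field_derivative_transform_within_open[of _ _ _ "{0<..}"]) (use 3 in \<open>auto simp: flat_def\<close>)
  next
    case 2
    \<comment> \<open>The right difference quotient at 0 is \<open>s p(s) exp (- s)\<close> with
      \<open>s = 1 / h\<close>, and the polynomial loses against the exponential.\<close>
    have "((\<lambda>h. flat p h / h) \<longlongrightarrow> 0) (at_right 0)"
    proof (rule Lim_transform_eventually)
      show "((\<lambda>h. poly ([:0, 1:] * p) (inverse h) * exp (- inverse h)) \<longlongrightarrow> 0) (at_right 0)"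
        by (rule filterlim_compose[OF poly_times_exp_tendsto_0 filterlim_inverse_at_top_right])
      show "\<forall>\<^sub>F h in at_right 0. poly ([:0, 1:] * p) (inverse h) * exp (- inverse h) = flat p h / h"
        by (auto simp: eventually_at_filter flat_def field_simps)
    qed
    moreover have "((\<lambda>h. flat p h / h) \<longlongrightarrow> 0) (at_left 0)"
      by (rule Lim_transform_eventually[of "\<lambda>_. 0"]) (auto simp: eventually_at_filter flat_def)
    ultimately have "((\<lambda>h. flat p h / h) \<longlongrightarrow> 0) (at 0)"
      by (rule filterlim_split_at[rotated])
    then show ?thesis
      using 2 by (simp add: has_field_derivative_iff flat_def)
  qed
qed

text \<open>The factor \<open>poly r\<close> absorbs the inner derivative \<open>- 2 x\<close> and
  multiplication by the coordinate, so derivatives are sums of functions of the same form;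
  \<open>1 - x\<^sup>2\<close> puts the support into \<open>{-1..1}\<close>.\<close>

definition bump1 :: "real poly \<Rightarrow> real poly \<Rightarrow> real \<Rightarrow> real" where
  "bump1 r p x = poly r x * flat p (1 - x\<^sup>2)"

definition bump_fun :: "real poly \<Rightarrow> real poly \<Rightarrow> real poly \<Rightarrow> real poly \<Rightarrow> plane \<Rightarrow> complex" where
  "bump_fun r p s q z = of_real (bump1 r p (fst z) * bump1 s q (snd z))"

lemma bump1_has_derivative:
  "(bump1 r p has_real_derivative (bump1 (pderiv r) p x + bump1 ([:0, -2:] * r) (flat_deriv p) x)) (at x)"
proof -
  have "((\<lambda>x. flat p (1 - x\<^sup>2)) has_real_derivative flat (flat_deriv p) (1 - x\<^sup>2) * (- 2 * x)) (at x)"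
    by (rule DERIV_chain2[OF flat_has_derivative]) (auto intro!: derivative_eq_intros)
  from DERIV_mult[OF poly_DERIV[of r] this] show ?thesis
    by (simp add: bump1_def[abs_def] algebra_simps)
qed

lemma bump1_bounded: "\<exists>B. \<forall>x. \<bar>bump1 r p x\<bar> \<le> B"
proof -
  have "continuous_on {-1..1} (bump1 r p)"
    using bump1_has_derivative by (meson DERIV_continuous continuous_at_imp_continuous_on)
  then have "bounded (bump1 r p ` {-1..1})"
    by (intro compact_imp_bounded compact_continuous_image) auto
  then obtain B where B: "\<And>x. x \<in> {-1..1} \<Longrightarrow> \<bar>bump1 r p x\<bar> \<le> B"
    unfolding bounded_iff by (metis imageI real_norm_def)
  have "\<bar>bump1 r p x\<bar> \<le> B" for x
  proof (cases "x \<in> {-1..1}")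
    case False
    then have "1 < \<bar>x\<bar>" by auto
    then have "1 - x\<^sup>2 \<le> 0" using abs_le_square_iff[of 1 x] by simp
    then show ?thesis using B[of 0] by (simp add: bump1_def flat_def)
  qed (rule B)
  then show ?thesis by blast
qed

lemma bump_fun_has_derivative:
  "(bump_fun r p s q has_derivative
     (\<lambda>h. fst h *\<^sub>R (bump_fun (pderiv r) p s q z + bump_fun ([:0, -2:] * r) (flat_deriv p) s q z)
        + snd h *\<^sub>R (bump_fun r p (pderiv s) q z + bump_fun r p ([:0, -2:] * s) (flat_deriv q) z))) (at z)"
proof -
  have "((\<lambda>z. bump1 r p (fst z)) has_derivative (\<lambda>h. (bump1 (pderiv r) p (fst z) + bump1 ([:0, -2:] * r) (flat_deriv p) (fst z)) * fst h)) (at z)"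
    by (rule has_derivative_compose[OF _ bump1_has_derivative[unfolded has_field_derivative_def]]) (auto intro!: derivative_intros)
  moreover have "((\<lambda>z. bump1 s q (snd z)) has_derivative (\<lambda>h. (bump1 (pderiv s) q (snd z) + bump1 ([:0, -2:] * s) (flat_deriv q) (snd z)) * snd h)) (at z)"
    by (rule has_derivative_compose[OF _ bump1_has_derivative[unfolded has_field_derivative_def]]) (auto intro!: derivative_intros)
  ultimately have "((\<lambda>z. complex_of_real (bump1 r p (fst z) * bump1 s q (snd z))) has_derivative
    (\<lambda>h. complex_of_real (bump1 r p (fst z) * ((bump1 (pderiv s) q (snd z) + bump1 ([:0, -2:] * s) (flat_deriv q) (snd z)) * snd h)
     + (bump1 (pderiv r) p (fst z) + bump1 ([:0, -2:] * r) (flat_deriv p) (fst z)) * fst h * bump1 s q (snd z)))) (at z)"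
    by (rule has_derivative_of_real[OF has_derivative_mult])
  then show ?thesis
    by (simp add: bump_fun_def[abs_def] scaleR_conv_of_real algebra_simps)
qed

lemma bump_fun_ops:
  "D\<^sub>x (bump_fun r p s q) = (\<lambda>z. bump_fun (pderiv r) p s q z + bump_fun ([:0, -2:] * r) (flat_deriv p) s q z)"
  "D\<^sub>y (bump_fun r p s q) = (\<lambda>z. bump_fun r p (pderiv s) q z + bump_fun r p ([:0, -2:] * s) (flat_deriv q) z)"
  "mulx (bump_fun r p s q) = bump_fun ([:0, 1:] * r) p s q" "muly (bump_fun r p s q) = bump_fun r p ([:0, 1:] * s) q"
proof -
  show "D\<^sub>x (bump_fun r p s q) = (\<lambda>z. bump_fun (pderiv r) p s q z + bump_fun ([:0, -2:] * r) (flat_deriv p) s q z)"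
    by (rule ext, subst partial_x_eq[OF bump_fun_has_derivative]) (simp only: fst_conv snd_conv scaleR_one scaleR_zero_left add_0_right)
  show "D\<^sub>y (bump_fun r p s q) = (\<lambda>z. bump_fun r p (pderiv s) q z + bump_fun r p ([:0, -2:] * s) (flat_deriv q) z)"
    by (rule ext, subst partial_y_eq[OF bump_fun_has_derivative]) (simp only: fst_conv snd_conv scaleR_one scaleR_zero_left add_0_left)
  show "mulx (bump_fun r p s q) = bump_fun ([:0, 1:] * r) p s q" "muly (bump_fun r p s q) = bump_fun r p ([:0, 1:] * s) q"
    by (rule ext, simp add: mulx_def muly_def bump_fun_def bump1_def)+
qed

lemma rapid_0_bump_fun: "rapid 0 (bump_fun r p s q)"
proof -
  obtain A where A: "\<And>x. \<bar>bump1 r p x\<bar> \<le> A" using bump1_bounded[of r p] by blast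
  obtain B where B: "\<And>x. \<bar>bump1 s q x\<bar> \<le> B" using bump1_bounded[of s q] by blast
  have "cmod (bump_fun r p s q z) \<le> A * B" for z
    unfolding bump_fun_def norm_of_real abs_mult
    by (intro mult_mono A B abs_ge_zero order_trans[OF abs_ge_zero A])
  moreover have "bump_fun r p s q differentiable (at z)" for z
    by (rule differentiableI[OF bump_fun_has_derivative])
  ultimately show ?thesis unfolding rapid.simps(1) by blast
qed

lemma rapid_bump_fun: "rapid k (bump_fun r p s q)"
proof (induction k arbitrary: r p s q)
  case 0 show ?case by (rule rapid_0_bump_fun)
next
  case (Suc k)
  show ?case
    unfolding rapid.simps(2) bump_fun_ops by (intro conjI rapid_0_bump_fun rapid_add Suc.IH)
qed

text \<open>In each variable \<open>exp 1\<close> compensates \<open>flat 1 1 = exp (- 1)\<close>.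
  The value at the origin becomes 1, which normalises the averaging kernel, and 1 is also the
  maximum.\<close>

definition bump :: "plane \<Rightarrow> complex" where
  "bump = bump_fun [:exp 1:] 1 [:exp 1:] 1"

lemma rapidly_bump: "rapidly bump"
  by (simp add: rapidly_def bump_def rapid_bump_fun del: rapid.simps)

lemma bump_0: "bump 0 = 1"
  by (simp add: bump_def bump_fun_def bump1_def flat_def exp_minus)

lemma norm_bump_le: "cmod (bump z) \<le> 1"
proof -
  have "\<bar>bump1 [:exp 1:] 1 x\<bar> \<le> 1" for x
  proof (cases "1 - x\<^sup>2 \<le> 0")
    case False
    then have "1 \<le> 1 / (1 - x\<^sup>2)" by simp
    then show ?thesis using False by (simp add: bump1_def flat_def exp_add[symmetric] abs_mult)
  qed (simp add: bump1_def flat_def)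
  from mult_mono[OF this this] show ?thesis
    by (simp add: bump_def bump_fun_def norm_mult)
qed

lemma bump_eq_0: "z \<notin> box_sq 1 \<Longrightarrow> bump z = 0"
proof -
  have "bump1 r p x = 0" if "x \<notin> {-1..1}" for r p x
  proof -
    have "1 < \<bar>x\<bar>" using that by auto
    then have "1 - x\<^sup>2 \<le> 0" using abs_le_square_iff[of 1 x] by simp
    then show ?thesis by (simp add: bump1_def flat_def)
  qed
  then show "z \<notin> box_sq 1 \<Longrightarrow> bump z = 0"
    by (cases z) (auto simp: bump_def bump_fun_def box_sq_def)
qed

declare split_paired_All [simp del] split_paired_Ex [simp del]

section \<open>Uniform norms\<close>

lemma Linf_norm_le:
  assumes "S \<in> sets lebesgue" "continuous_on S v" "\<And>z. z \<in> S \<Longrightarrow> ennreal (cmod (v z)) \<le> C"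
  shows "Linf_norm S v \<le> C"
  unfolding Linf_norm_def
proof (rule esssup_I)
  have "v \<in> borel_measurable (lebesgue_on S)"
    by (rule continuous_imp_measurable_on_sets_lebesgue[OF assms(2,1)])
  then show "(\<lambda>z. ennreal (cmod (v z))) \<in> borel_measurable (lebesgue_on S)" by measurable
  show "AE z in lebesgue_on S. ennreal (cmod (v z)) \<le> C"
    using assms(3) by (intro AE_I2) (simp add: space_restrict_space)
qed

text \<open>The essential supremum ignores null sets, but near every point of \<open>S\<close>,
  boundary points included, the interior of \<open>S\<close> contains a nonempty open set. On such a
  set continuity would keep a larger value above the norm.\<close>

lemma Linf_norm_ge:
  assumes S: "S \<in> sets lebesgue" "S \<subseteq> closure (interior S)" and v: "continuous_on S v" and z: "z \<in> S"
  shows "ennreal (cmod (v z)) \<le> Linf_norm S v"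
proof (rule ccontr)
  assume "\<not> ?thesis"
  then have lt: "Linf_norm S v < ennreal (cmod (v z))" by simp
  then obtain C where C: "Linf_norm S v = ennreal C" "0 \<le> C" by (cases "Linf_norm S v") auto
  then have Cz: "C < cmod (v z)" using lt by (simp add: ennreal_less_iff)
  define e where "e = cmod (v z) - C"
  obtain d where d: "d > 0" "\<And>w. w \<in> S \<Longrightarrow> dist w z < d \<Longrightarrow> dist (v w) (v z) < e"
    using v z Cz unfolding continuous_on_iff e_def by (metis diff_gt_0_iff_gt)
  have big: "C < cmod (v w)" if "w \<in> S" "dist w z < d" for w
    using d(2)[OF that] norm_triangle_ineq2[of "v z" "v w"] by (simp add: e_def dist_norm norm_minus_commute)
  define U where "U = ball z d \<inter> interior S"
  have "open U" by (auto simp: U_def)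
  moreover have "U \<noteq> {}"
  proof -
    have "z \<in> closure (interior S)" using S z by blast
    then obtain y where "y \<in> interior S" "dist y z < d"
      using d(1) by (metis closure_approachable)
    then have "y \<in> U" by (auto simp: U_def dist_commute)
    then show ?thesis by blast
  qed
  ultimately have "\<not> negligible U" by (simp add: open_not_negligible)
  moreover have "negligible U"
  proof -
    have "AE w in lebesgue_on S. ennreal (cmod (v w)) \<le> ennreal C"
      using esssup_AE[of "\<lambda>w. ennreal (cmod (v w))" "lebesgue_on S"] C(1) by (simp add: Linf_norm_def)
    then have "AE w in lebesgue. w \<in> S \<longrightarrow> ennreal (cmod (v w)) \<le> ennreal C"
      using S(1) by (simp add: AE_restrict_space_iff)
    then obtain N where N: "negligible N" "{w. \<not> (w \<in> S \<longrightarrow> ennreal (cmod (v w)) \<le> ennreal C)} \<subseteq> N"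
      by (auto simp: eventually_ae_filter_negligible)
    have "U \<subseteq> N"
    proof
      fix w assume "w \<in> U"
      then have "w \<in> S" "dist w z < d" using interior_subset by (auto simp: U_def dist_commute)
      then show "w \<in> N" using big[of w] C(2) N(2) by (auto simp: ennreal_le_iff not_le)
    qed
    then show ?thesis using N(1) negligible_subset by blast
  qed
  ultimately show False by simp
qed

lemma Linf_norm_eq_ennreal:
  assumes S: "compact S" "S \<subseteq> closure (interior S)" and v: "continuous_on S v"
  obtains A where "0 \<le> A" "Linf_norm S v = ennreal A" "\<And>z. z \<in> S \<Longrightarrow> cmod (v z) \<le> A"
proof -
  have l: "S \<in> sets lebesgue" using S(1) by (simp add: borel_compact sets_completionI_sets)
  have "bounded (v ` S)" using S(1) v by (intro compact_imp_bounded compact_continuous_image)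
  then obtain B where B: "\<And>z. z \<in> S \<Longrightarrow> cmod (v z) \<le> B" unfolding bounded_iff by blast
  have "Linf_norm S v \<le> ennreal B"
    by (rule Linf_norm_le[OF l v]) (use B in \<open>simp add: ennreal_leI\<close>)
  then obtain A where A: "0 \<le> A" "Linf_norm S v = ennreal A" by (cases "Linf_norm S v") (auto simp: top_unique)
  have "cmod (v z) \<le> A" if "z \<in> S" for z
    using Linf_norm_ge[OF l S(2) v that] A by simp
  with A that show ?thesis by blast
qed

section \<open>Bounds on derivatives\<close>

text \<open>One constant for all derivatives up to order \<open>k\<close>, taken in any order: the
  quantitative counterpart of \<open>tame\<close>, made for the third condition on
  approximations.\<close>

fun derivs_le :: "nat \<Rightarrow> real \<Rightarrow> (plane \<Rightarrow> complex) \<Rightarrow> bool" where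
  "derivs_le 0 M u \<longleftrightarrow> (\<forall>z. u differentiable (at z)) \<and> (\<forall>z. cmod (u z) \<le> M)"
| "derivs_le (Suc k) M u \<longleftrightarrow> derivs_le 0 M u \<and> derivs_le k M (D\<^sub>x u) \<and> derivs_le k M (D\<^sub>y u)"

lemma derivs_le_0: "derivs_le k M u \<Longrightarrow> derivs_le 0 M u"
  by (cases k) simp_all

lemma derivs_le_0D: "derivs_le 0 M u \<Longrightarrow> u differentiable (at z)" "derivs_le 0 M u \<Longrightarrow> cmod (u z) \<le> M"
  by simp_all

lemma derivs_le_pred: "derivs_le (Suc k) M u \<Longrightarrow> derivs_le k M u"
proof (induction k arbitrary: u)
  case (Suc k)
  then show ?case by (metis derivs_le.simps(2))
qed simp

lemma derivs_le_mono: "derivs_le k M u \<Longrightarrow> M \<le> N \<Longrightarrow> derivs_le k N u"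
proof (induction k arbitrary: u)
  case 0
  then show ?case by (simp only: derivs_le.simps(1)) (meson order_trans)
next
  case (Suc k)
  have "derivs_le 0 N u" using Suc.prems by (simp only: derivs_le.simps) (meson order_trans)
  then show ?case using Suc by (simp only: derivs_le.simps(2))
qed

lemma derivs_le_add: "derivs_le k M u \<Longrightarrow> derivs_le k N v \<Longrightarrow> derivs_le k (M + N) (\<lambda>z. u z + v z)"
proof (induction k arbitrary: u v)
  have base: "derivs_le 0 (M + N) (\<lambda>z. u z + v z)" if "derivs_le 0 M u" "derivs_le 0 N v" for u v
    using that by (simp only: derivs_le.simps) (metis differentiable_add norm_add_rule_thm)
  {
    case 0 then show ?case by (rule base)
  next
    case (Suc k)
    note d = derivs_le_0[OF Suc.prems(1)] derivs_le_0[OF Suc.prems(2)]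
    show ?case
      using Suc.prems base[OF d] Suc.IH
      by (simp only: derivs_le.simps(2) partials_add[OF derivs_le_0D(1)[OF d(1)] derivs_le_0D(1)[OF d(2)]])
  }
qed

text \<open>Each differentiation turns one product into two, which doubles the constant.\<close>

lemma derivs_le_mult: "derivs_le k M u \<Longrightarrow> derivs_le k N v \<Longrightarrow> derivs_le k (2 ^ k * (M * N)) (\<lambda>z. u z * v z)"
proof (induction k arbitrary: u v)
  have base: "derivs_le 0 (M * N) (\<lambda>z. u z * v z)" if "derivs_le 0 M u" "derivs_le 0 N v" for u v
  proof -
    have "cmod (u z * v z) \<le> M * N" for z
      unfolding norm_mult using that[THEN derivs_le_0D(2)]
      by (intro mult_mono order_trans[OF norm_ge_zero]) auto
    then show ?thesis using that[THEN derivs_le_0D(1)] by (simp add: differentiable_mult)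
  qed
  {
    case 0 then show ?case using base by simp
  next
    case (Suc k)
    note d = derivs_le_0[OF Suc.prems(1)] derivs_le_0[OF Suc.prems(2)] and k = Suc.prems[THEN derivs_le_pred]
    have "(1::real) \<le> 2 ^ Suc k" by (rule one_le_power) simp
    moreover have "0 \<le> M * N" using order_trans[OF norm_ge_zero derivs_le_0D(2)[OF base[OF d]]] .
    ultimately have "1 * (M * N) \<le> 2 ^ Suc k * (M * N)" by (intro mult_right_mono)
    then have 0: "derivs_le 0 (2 ^ Suc k * (M * N)) (\<lambda>z. u z * v z)"
      using derivs_le_mono[OF base[OF d]] by simp
    have "derivs_le k (2 ^ k * (M * N) + 2 ^ k * (M * N)) (\<lambda>z. D\<^sub>x u z * v z + u z * D\<^sub>x v z)"
      "derivs_le k (2 ^ k * (M * N) + 2 ^ k * (M * N)) (\<lambda>z. D\<^sub>y u z * v z + u z * D\<^sub>y v z)"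
      using Suc.prems k by (auto intro!: derivs_le_add Suc.IH simp only: derivs_le.simps(2))
    then show ?case
      using 0 by (simp only: derivs_le.simps(2) partials_mult[OF derivs_le_0D(1)[OF d(1)] derivs_le_0D(1)[OF d(2)]] power_Suc mult_2 distrib_right mult.assoc)
  }
qed

lemma derivs_le_const: "derivs_le k (cmod c) (\<lambda>z. c)"
proof (induction k arbitrary: c)
  case (Suc k)
  have "derivs_le k (cmod c) (\<lambda>z. 0)" using Suc[of 0] by (rule derivs_le_mono) simp
  then show ?case by (simp add: partials_const)
qed simp

lemma derivs_le_cmult: "derivs_le k M u \<Longrightarrow> derivs_le k (cmod c * M) (\<lambda>z. c * u z)"
proof (induction k arbitrary: u)
  have base: "derivs_le 0 (cmod c * M) (\<lambda>z. c * u z)" if "derivs_le 0 M u" for u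
    using that by (auto simp: norm_mult differentiable_mult intro: mult_left_mono)
  {
    case 0 then show ?case by (rule base)
  next
    case (Suc k)
    note d = derivs_le_0[OF Suc.prems]
    show ?case using Suc.prems base[OF d] Suc.IH
      by (simp only: derivs_le.simps(2) partials_cmult[OF derivs_le_0D(1)[OF d]])
  }
qed

lemma derivs_le_scale: "derivs_le k M u \<Longrightarrow> \<bar>c\<bar> \<le> 1 \<Longrightarrow> derivs_le k M (\<lambda>z. u (c *\<^sub>R z))"
proof (induction k arbitrary: u)
  have base: "derivs_le 0 M (\<lambda>z. u (c *\<^sub>R z))" if "derivs_le 0 M u" for u
    using that partials_scale(1)[OF derivs_le_0D(1)[OF that]] by simp
  {
    case 0 from 0(1) show ?case by (rule base)
  next
    case (Suc k)
    note d = derivs_le_0[OF Suc.prems(1)]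
    have M: "0 \<le> M" using order_trans[OF norm_ge_zero derivs_le_0D(2)[OF d]] .
    have s: "derivs_le k M (\<lambda>z. of_real c * w (c *\<^sub>R z))" if "derivs_le k M w" for w
      by (rule derivs_le_mono[OF derivs_le_cmult[OF Suc.IH[OF that Suc.prems(2)]]])
        (use Suc.prems(2) mult_right_mono[OF Suc.prems(2) M] in simp)
    show ?case using Suc.prems base[OF d] s
      by (simp only: derivs_le.simps(2) partials_scale[OF derivs_le_0D(1)[OF d]])
  }
qed

lemma derivs_le_mderiv:
  assumes "derivs_le k M u" "a + b \<le> k"
  shows "mderiv a b u differentiable (at z)" "cmod (mderiv a b u z) \<le> M"
proof -
  have "derivs_le (m + b) M u \<Longrightarrow> derivs_le m M ((D\<^sub>y ^^ b) u)" for m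
  proof (induction b arbitrary: m)
    case (Suc b)
    from Suc.IH[of "Suc m"] Suc.prems show ?case by simp
  qed simp
  moreover have "derivs_le (m + a) M w \<Longrightarrow> derivs_le m M ((D\<^sub>x ^^ a) w)" for m w
  proof (induction a arbitrary: m)
    case (Suc a)
    from Suc.IH[of "Suc m"] Suc.prems show ?case by simp
  qed simp
  ultimately have "derivs_le (k - (a + b)) M (mderiv a b u)"
    using assms by (simp add: mderiv_def)
  from derivs_le_0[OF this] show "mderiv a b u differentiable (at z)" "cmod (mderiv a b u z) \<le> M"
    by simp_all
qed

lemma rapidly_derivs_le: "rapidly \<phi> \<Longrightarrow> \<exists>C. derivs_le k C \<phi>"
proof (induction k arbitrary: \<phi>)
  have base: "\<exists>C. derivs_le 0 C \<phi>" if "rapidly \<phi>" for \<phi>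
    using rapidlyD(1,3)[OF that] by simp
  {
    case 0 then show ?case by (rule base)
  next
    case (Suc k)
    obtain A where A: "derivs_le 0 A \<phi>" using base[OF Suc.prems] by blast
    obtain B C where "derivs_le k B (D\<^sub>x \<phi>)" "derivs_le k C (D\<^sub>y \<phi>)"
      using Suc.IH rapidly_ops[OF Suc.prems] by blast
    then have "derivs_le (Suc k) (max A (max B C)) \<phi>"
      using derivs_le_mono[OF A] unfolding derivs_le.simps(2) by (intro conjI) (auto elim!: derivs_le_mono simp del: derivs_le.simps)
    then show ?case by blast
  }
qed

text \<open>\<open>box_sq 2\<close> has area 16, so the integral of \<open>|h|\<close> is at most
  \<open>16 A\<close> and the transform at most \<open>16 A / (4 pi\<^sup>2)\<close>. Every
  derivative inserts a coordinate of size at most 2, whence the power of 2.\<close>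

lemma derivs_le_fourier:
  assumes "h \<in> borel_measurable borel" "\<And>z. cmod (h z) \<le> A" "\<And>z. z \<notin> box_sq 2 \<Longrightarrow> h z = 0"
  shows "derivs_le k (2 ^ k * (4 * A / pi\<^sup>2)) (fourier h)"
  using assms
proof (induction k arbitrary: h A)
  have bs: "bounded_supp h"
    if h: "h \<in> borel_measurable borel" "\<And>z. cmod (h z) \<le> A" "\<And>z. z \<notin> box_sq 2 \<Longrightarrow> h z = 0" for h A
  proof -
    have "z \<notin> box_sq 2" if "4 < norm z" for z
      using norm_le_l1[of z] that by (cases z) (auto simp: box_sq_def Basis_prod_def inner_prod_def)
    then show ?thesis unfolding bounded_supp_def using h by blast
  qed
  have base: "derivs_le 0 (4 * A / pi\<^sup>2) (fourier h)"
    if h: "h \<in> borel_measurable borel" "\<And>z. cmod (h z) \<le> A" "\<And>z. z \<notin> box_sq 2 \<Longrightarrow> h z = 0" for h A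
  proof -
    note i = bounded_supp_integrable[OF bs[OF h]] bounded_supp_integrable_norm2[OF bs[OF h]]
    have b2: "box_sq 2 = cbox (-2, -2) (2, 2)" by (simp add: box_sq_def cbox_Pair_eq)
    have "(LINT z|lborel. cmod (h z)) \<le> (LINT z|lborel. A * indicator (box_sq 2) z)"
    proof (rule integral_mono)
      show "integrable lborel (\<lambda>z. A * indicator (box_sq 2) z)"
        by (intro integrable_mult_right integrable_real_indicator) (auto simp: b2 emeasure_lborel_cbox_eq)
      show "cmod (h z) \<le> A * indicator (box_sq 2) z" for z
        using h(2)[of z] h(3)[of z] by (auto simp: indicator_def)
    qed (use i in simp)
    also have "\<dots> = 16 * A"
      by (simp add: b2 measure_def emeasure_lborel_cbox_eq Basis_prod_def inner_prod_def)
    finally have "(LINT z|lborel. cmod (h z)) / (4 * pi\<^sup>2) \<le> (16 * A) / (4 * pi\<^sup>2)"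
      by (rule divide_right_mono) simp
    then have "cmod (fourier h z) \<le> 4 * A / pi\<^sup>2" for z
      using norm_fourier_le[OF i(1), of z] by simp
    then show ?thesis using fourier_partials(1)[OF i] by simp
  qed
  {
    case 0 from base[OF 0] show ?case by simp
  next
    case (Suc k)
    note i = bounded_supp_integrable[OF bs[OF Suc.prems]] bounded_supp_integrable_norm2[OF bs[OF Suc.prems]]
    have A: "0 \<le> A" using order_trans[OF norm_ge_zero Suc.prems(2)] .
    have m: "derivs_le k (2 ^ k * (4 * (2 * A) / pi\<^sup>2)) (fourier (\<lambda>z. - \<i> * (complex_of_real (t z) * h z)))"
      if t: "t \<in> borel_measurable borel" "\<And>z. z \<in> box_sq 2 \<Longrightarrow> \<bar>t z\<bar> \<le> 2" for t :: "plane \<Rightarrow> real"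
    proof (rule Suc.IH)
      show "cmod (- \<i> * (complex_of_real (t z) * h z)) \<le> 2 * A" for z
      proof (cases "z \<in> box_sq 2")
        case True
        then show ?thesis using mult_mono[OF t(2) Suc.prems(2), of z z] by (simp add: norm_mult)
      qed (use A Suc.prems(3) in simp)
    qed (use t Suc.prems(1,3) in auto)
    have "(1::real) \<le> 2 ^ Suc k" by (rule one_le_power) simp
    then have "1 * (4 * A / pi\<^sup>2) \<le> 2 ^ Suc k * (4 * A / pi\<^sup>2)" using A by (intro mult_right_mono) auto
    then have "derivs_le 0 (2 ^ Suc k * (4 * A / pi\<^sup>2)) (fourier h)"
      using derivs_le_mono[OF base[OF Suc.prems]] by simp
    moreover have "D\<^sub>x (fourier h) = fourier (\<lambda>z. - \<i> * (complex_of_real (fst z) * h z))"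
      "D\<^sub>y (fourier h) = fourier (\<lambda>z. - \<i> * (complex_of_real (snd z) * h z))"
      using fourier_partials(2,3)[OF i] by (simp_all add: mulx_def muly_def)
    moreover have "2 ^ k * (4 * (2 * A) / pi\<^sup>2) = 2 ^ Suc k * (4 * A / pi\<^sup>2)" by simp
    moreover have "\<bar>fst z\<bar> \<le> 2" "\<bar>snd z\<bar> \<le> 2" if "z \<in> box_sq 2" for z
      using that by (auto simp: box_sq_def)
    ultimately show ?case
      using m[of fst] m[of snd] by (simp only: derivs_le.simps(2) measurable_fst_snd_plane simp_thms)
  }
qed

section \<open>Existence of bandlimited approximations\<close>

lemma box_sq_eq_cbox: "box_sq c = cbox (- c, - c) (c, c)"
  by (simp add: box_sq_def cbox_Pair_eq)

lemma compact_box_sq: "compact (box_sq c)"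
  by (simp add: box_sq_eq_cbox)

lemma box_sq_subset_closure_interior: "0 < c \<Longrightarrow> box_sq c \<subseteq> closure (interior (box_sq c))"
proof -
  assume "0 < c"
  then have "(0, 0) \<in> box (- c, - c) (c, c)" by (auto simp: mem_box Basis_prod_def inner_prod_def)
  then have "box (- c, - c) (c, c) \<noteq> {}" by blast
  then show ?thesis by (simp add: box_sq_eq_cbox interior_cbox closure_box)
qed

lemma fsupport_subset:
  assumes "closed S" "\<And>z. z \<notin> S \<Longrightarrow> f z = 0"
  shows "fsupport f \<subseteq> S"
  unfolding fsupport_def by (rule closure_minimal[OF _ assms(1)]) (use assms(2) in blast)

lemma fsupportD: "z \<notin> fsupport f \<Longrightarrow> f z = 0"
  unfolding fsupport_def using closure_subset[of "{z. f z \<noteq> 0}"] by blast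

text \<open>\<open>ift\<close> and \<open>fourier\<close> differ by a reflection and a constant, so
  inversion in this order follows from the other one by reflecting the variable of
  integration.\<close>

lemma fourier_ift:
  assumes "rapidly \<psi>"
  shows "fourier (ift \<psi>) = \<psi>"
proof
  fix \<xi>
  note rF = rapidly_fourier[OF assms]
  obtain B where B: "\<And>z. cmod (\<psi> z) \<le> B" using rapidlyD(3)[OF assms] by blast
  have "(LINT z|lborel. fourier \<psi> z * cis (z \<bullet> \<xi>)) = \<bar>(- 1) * (- 1)\<bar> *\<^sub>R (LINT z|lborel. (\<lambda>z. fourier \<psi> z * cis (z \<bullet> \<xi>)) (0 + (- 1) * fst z, 0 + (- 1) * snd z))"
  proof (rule integral_plane_affine)
    show "(\<lambda>z. fourier \<psi> z * cis (z \<bullet> \<xi>)) \<in> borel_measurable borel"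
      by (intro borel_measurable_continuous_onI continuous_intros rapidlyD(2)[OF rF])
  qed auto
  also have "\<dots> = (LINT z|lborel. fourier \<psi> (- z) * cis (z \<bullet> - \<xi>))"
    by (simp add: uminus_prod_def inner_prod_def)
  finally have e: "ift (fourier \<psi>) \<xi> = ift (\<lambda>z. fourier \<psi> (- z)) (- \<xi>)" by (simp add: ift_def)
  have "ift \<psi> = (\<lambda>z. complex_of_real (4 * pi\<^sup>2) * fourier \<psi> (- z))"
    by (simp add: fourier_eq_ift fun_eq_iff)
  then have "fourier (ift \<psi>) \<xi> = ift (\<lambda>z. fourier \<psi> (- z)) (- \<xi>)"
    by (simp only: fourier_cmult) (simp add: fourier_eq_ift[of "\<lambda>z. fourier \<psi> (- z)"])
  also have "\<dots> = \<psi> \<xi>"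
    unfolding e[symmetric]
    by (rule fourier_inversion[OF rapidlyD(2)[OF assms] B rapidly_integrable[OF assms] rapidly_integrable[OF rF], symmetric])
  finally show "fourier (ift \<psi>) \<xi> = \<psi> \<xi>" .
qed

text \<open>Cutting off frequencies at scale \<open>R\<close> averages \<open>h\<close> against the
  transform of \<kappa>, concentrated at scale \<open>1 / R\<close>. The interchange is that of the
  inversion formula, with \<kappa> in place of the Gaussian.\<close>

lemma frequency_cutoff_eq:
  assumes h: "continuous_on UNIV h" "integrable lborel h" and \<kappa>: "rapidly \<kappa>" and R: "0 < R"
  shows "ift (\<lambda>\<xi>. fourier h \<xi> * \<kappa> ((1 / R) *\<^sub>R \<xi>)) z = (LINT v|lborel. h (z + (1 / R) *\<^sub>R v) * fourier \<kappa> v)"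
proof -
  define k where "k = (\<lambda>(\<xi>, u). h u * cis (u \<bullet> - \<xi>) * \<kappa> ((1 / R) *\<^sub>R \<xi>) * cis (\<xi> \<bullet> z))"
  have r: "rapidly (\<lambda>\<xi>. \<kappa> ((1 / R) *\<^sub>R \<xi>))" using R by (intro rapidly_scale[OF \<kappa>]) simp
  have int_k: "integrable (lborel \<Otimes>\<^sub>M lborel) k"
  proof (rule integrable_prod_bound[OF rapidly_integrable[OF r] h(2)])
    show "k \<in> borel_measurable borel" unfolding k_def case_prod_beta
      by (intro borel_measurable_continuous_onI continuous_intros continuous_on_compose2[OF h(1)]
          continuous_on_compose2[OF rapidlyD(2)[OF \<kappa>]]) auto
  qed (simp add: k_def norm_mult)
  have "ift h (- \<xi>) * (\<kappa> ((1 / R) *\<^sub>R \<xi>) * cis (\<xi> \<bullet> z)) = (LINT u|lborel. k (\<xi>, u))" for \<xi>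
    unfolding ift_def integral_mult_left_zero[symmetric] k_def by (simp add: mult.assoc)
  then have "ift (\<lambda>\<xi>. fourier h \<xi> * \<kappa> ((1 / R) *\<^sub>R \<xi>)) z = of_real (1 / (4 * pi\<^sup>2)) * (LINT \<xi>|lborel. LINT u|lborel. k (\<xi>, u))"
    unfolding ift_def[of _ z] by (simp add: fourier_eq_ift mult.assoc)
  also have "(LINT \<xi>|lborel. LINT u|lborel. k (\<xi>, u)) = (LINT u|lborel. LINT \<xi>|lborel. k (\<xi>, u))"
    by (rule lborel_pair.Fubini_integral[symmetric]) (use int_k in simp)
  finally have 1: "ift (\<lambda>\<xi>. fourier h \<xi> * \<kappa> ((1 / R) *\<^sub>R \<xi>)) z = of_real (1 / (4 * pi\<^sup>2)) * (LINT u|lborel. LINT \<xi>|lborel. k (\<xi>, u))" .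
  define S where "S = (\<lambda>u. of_real (4 * pi\<^sup>2 * R\<^sup>2) * (h u * fourier \<kappa> (R *\<^sub>R (u - z))))"
  have kS: "(LINT \<xi>|lborel. k (\<xi>, u)) = S u" for u
  proof -
    have "k (\<xi>, u) = h u * (\<kappa> ((1 / R) *\<^sub>R \<xi>) * cis (\<xi> \<bullet> (z - u)))" for \<xi>
    proof -
      have "cis (\<xi> \<bullet> (z - u)) = cis (u \<bullet> - \<xi>) * cis (\<xi> \<bullet> z)"
        by (simp add: cis_mult inner_diff_right inner_commute)
      then show ?thesis by (simp add: k_def)
    qed
    then have "(LINT \<xi>|lborel. k (\<xi>, u)) = h u * (LINT \<xi>|lborel. \<kappa> ((1 / R) *\<^sub>R \<xi>) * cis (\<xi> \<bullet> (z - u)))"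
      by simp
    also have "(LINT \<xi>|lborel. \<kappa> ((1 / R) *\<^sub>R \<xi>) * cis (\<xi> \<bullet> (z - u))) =
       \<bar>R * R\<bar> *\<^sub>R (LINT w|lborel. (\<lambda>\<xi>. \<kappa> ((1 / R) *\<^sub>R \<xi>) * cis (\<xi> \<bullet> (z - u))) (0 + R * fst w, 0 + R * snd w))"
    proof (rule integral_plane_affine)
      show "(\<lambda>\<xi>. \<kappa> ((1 / R) *\<^sub>R \<xi>) * cis (\<xi> \<bullet> (z - u))) \<in> borel_measurable borel"
        by (intro borel_measurable_continuous_onI continuous_intros rapidlyD(2)[OF r])
    qed (use R in auto)
    also have "\<dots> = of_real (R\<^sup>2) * ift \<kappa> (- (R *\<^sub>R (u - z)))"
      using R by (simp add: ift_def scaleR_conv_of_real power2_eq_square inner_prod_def algebra_simps)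
    finally show ?thesis
      by (simp add: S_def fourier_eq_ift)
  qed
  have "(LINT u|lborel. S u) = \<bar>(1 / R) * (1 / R)\<bar> *\<^sub>R (LINT v|lborel. S (fst z + (1 / R) * fst v, snd z + (1 / R) * snd v))"
  proof (rule integral_plane_affine)
    show "S \<in> borel_measurable borel" unfolding S_def
      by (intro borel_measurable_continuous_onI continuous_intros continuous_on_compose2[OF h(1)]
          continuous_on_compose2[OF rapidlyD(2)[OF rapidly_fourier[OF \<kappa>]]]) auto
  qed (use R in auto)
  also have "(\<lambda>v. S (fst z + (1 / R) * fst v, snd z + (1 / R) * snd v))
      = (\<lambda>v. of_real (4 * pi\<^sup>2 * R\<^sup>2) * (h (z + (1 / R) *\<^sub>R v) * fourier \<kappa> v))"
    using R by (auto simp: S_def fun_eq_iff scaleR_prod_def plus_prod_def)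
  finally have "(LINT u|lborel. S u) = of_real (4 * pi\<^sup>2) * (LINT v|lborel. h (z + (1 / R) *\<^sub>R v) * fourier \<kappa> v)"
    using R by (simp add: scaleR_conv_of_real power2_eq_square)
  then show ?thesis by (simp add: 1 kS)
qed

text \<open>Clamping the point to the square and multiplying by a tent function keeps the bound
  \<open>A\<close> exactly. The cut-off of a smooth extension could exceed it and spoil the
  constants of the approximation.\<close>

lemma extend_continuous:
  fixes f :: "plane \<Rightarrow> complex"
  assumes f: "continuous_on (box_sq 1) f" and A: "\<And>z. z \<in> box_sq 1 \<Longrightarrow> cmod (f z) \<le> A"
  obtains h where "continuous_on UNIV h" "\<And>z. z \<in> box_sq 1 \<Longrightarrow> h z = f z" "\<And>z. cmod (h z) \<le> A"
    "\<And>z. z \<notin> box_sq 2 \<Longrightarrow> h z = 0"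
proof
  define t :: "real \<Rightarrow> real" where "t x = max 0 (min 1 (2 - \<bar>x\<bar>))" for x
  define cl :: "real \<Rightarrow> real" where "cl x = max (- 1) (min 1 x)" for x
  define h where "h z = complex_of_real (t (fst z) * t (snd z)) * f (cl (fst z), cl (snd z))" for z
  have cl: "(cl x, cl y) \<in> box_sq 1" for x y by (auto simp: cl_def box_sq_def)
  show "continuous_on UNIV h"
    unfolding h_def t_def
    by (intro continuous_intros continuous_on_compose2[OF f]) (use cl in \<open>auto simp: cl_def intro!: continuous_intros\<close>)
  show "h z = f z" if "z \<in> box_sq 1" for z
    using that by (cases z) (auto simp: h_def box_sq_def t_def cl_def)
  have t: "0 \<le> t x" "t x \<le> 1" for x by (auto simp: t_def)
  have A0: "0 \<le> A" using order_trans[OF norm_ge_zero A[OF cl[of 0 0]]] .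
  show "cmod (h z) \<le> A" for z
  proof -
    have "t (fst z) * t (snd z) \<le> 1" using mult_mono[OF t(2) t(2), of "fst z" "snd z"] t by (simp add: mult.commute)
    then have "(t (fst z) * t (snd z)) * cmod (f (cl (fst z), cl (snd z))) \<le> 1 * A"
      by (intro mult_mono A[OF cl]) auto
    then show ?thesis using t by (simp add: h_def norm_mult abs_mult)
  qed
  show "h z = 0" if "z \<notin> box_sq 2" for z
    using that by (cases z) (auto simp: h_def box_sq_def t_def)
qed

text \<open>For small \<open>w\<close> uniform continuity gives \<eta>; for all other
  \<open>w\<close> the trivial bound \<open>2 A\<close> is at most \<open>2 A / e * norm w\<close>.
  A bound linear in \<open>norm w\<close> can be integrated against a kernel with two
  moments.\<close>

lemma bounded_oscillation:
  fixes h :: "plane \<Rightarrow> complex"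
  assumes h: "continuous_on UNIV h" "\<And>z. cmod (h z) \<le> A" "\<And>z. z \<notin> box_sq 2 \<Longrightarrow> h z = 0" and \<eta>: "0 < \<eta>"
  obtains L where "0 \<le> L" "\<And>z w. cmod (h (z + w) - h z) \<le> \<eta> + L * norm w"
proof -
  have "uniformly_continuous_on (box_sq 4) h"
    by (intro compact_uniformly_continuous continuous_on_subset[OF h(1)] compact_box_sq) auto
  then obtain d where d: "d > 0" "\<And>x y. x \<in> box_sq 4 \<Longrightarrow> y \<in> box_sq 4 \<Longrightarrow> dist y x < d \<Longrightarrow> dist (h y) (h x) < \<eta>"
    unfolding uniformly_continuous_on_def using \<eta> by metis
  have A: "0 \<le> A" using order_trans[OF norm_ge_zero h(2)] .
  define e where "e = min d 1"
  have e: "0 < e" using d by (simp add: e_def)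
  have "cmod (h (z + w) - h z) \<le> \<eta> + (2 * A / e) * norm w" for z w
  proof (cases "norm w < e")
    case True
    then have w: "norm w < d" "norm w < 1" by (auto simp: e_def)
    have c: "\<bar>fst w\<bar> < 1" "\<bar>snd w\<bar> < 1"
      using norm_fst_le[of "fst w" "snd w"] norm_snd_le[of "snd w" "fst w"] w by auto
    \<comment> \<open>Since both components of \<open>w\<close> are below 1, either \<open>z\<close>
      and \<open>z + w\<close> lie in \<open>box_sq 4\<close>, where uniform continuity applies, or
      both lie outside \<open>box_sq 2\<close>, where \<open>h\<close> vanishes.\<close>
    have "cmod (h (z + w) - h z) \<le> \<eta>"
    proof (cases "z \<in> box_sq 3")
      case True
      then have "z \<in> box_sq 4" "z + w \<in> box_sq 4"
        using c by (cases z; cases w; auto simp: box_sq_def)+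
      then show ?thesis using d(2)[of z "z + w"] w by (simp add: dist_norm less_imp_le)
    next
      case False
      then have "z \<notin> box_sq 2" "z + w \<notin> box_sq 2"
        using c by (cases z; cases w; auto simp: box_sq_def)+
      then show ?thesis using h(3) \<eta> by simp
    qed
    moreover have "0 \<le> (2 * A / e) * norm w" using A e by simp
    ultimately show ?thesis by linarith
  next
    case False
    have "cmod (h (z + w) - h z) \<le> 2 * A"
      using norm_triangle_ineq4[of "h (z + w)" "h z"] h(2)[of z] h(2)[of "z + w"] by linarith
    also have "\<dots> = (2 * A / e) * e" using e by simp
    also have "\<dots> \<le> (2 * A / e) * norm w" using False A e by (intro mult_left_mono) auto
    finally show ?thesis using \<eta> by linarith
  qed
  then show ?thesis using that[of "2 * A / e"] A e by simp
qed

text \<open>\<open>K\<close> has integral 1 but may change sign, so its weighted absolute integral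
  enters the bound. The term \<open>norm v\<close> coming from the oscillation is majorised by
  \<open>1 + (norm v)\<^sup>2\<close>.\<close>

lemma mult_approx_identity:
  fixes h K :: "plane \<Rightarrow> complex"
  assumes h: "continuous_on UNIV h" "\<And>z w. cmod (h (z + w) - h z) \<le> \<eta> + L * norm w" "\<And>z. cmod (h z) \<le> A"
    and L: "0 \<le> L" and \<eta>: "0 \<le> \<eta>"
    and K: "integrable lborel K" "integrable lborel (\<lambda>z. (norm z)\<^sup>2 *\<^sub>R K z)" "(LINT v|lborel. K v) = 1"
    and R: "0 < R"
  shows "cmod ((LINT v|lborel. h (z + (1 / R) *\<^sub>R v) * K v) - h z) \<le> (\<eta> + L / R) * (LINT v|lborel. (1 + (norm v)\<^sup>2) * cmod (K v))"
proof -
  have int: "integrable lborel (\<lambda>v. (1 + (norm v)\<^sup>2) * cmod (K v))"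
    using integrable_norm[OF K(1)] integrable_norm[OF K(2)] by (simp add: distrib_right)
  have [measurable]: "K \<in> borel_measurable borel" using K(1) by (auto dest: borel_measurable_integrable)
  have hm: "(\<lambda>v::plane. h (z + (1 / R) *\<^sub>R v)) \<in> borel_measurable borel"
    by (intro borel_measurable_continuous_onI continuous_intros continuous_on_compose2[OF h(1)]) auto
  have int2: "integrable lborel (\<lambda>v. h (z + (1 / R) *\<^sub>R v) * K v)"
  proof (rule Bochner_Integration.integrable_bound)
    show "integrable lborel (\<lambda>v. A * cmod (K v))" using K(1) by simp
    have "0 \<le> A" using order_trans[OF norm_ge_zero h(3)] .
    then show "AE v in lborel. norm (h (z + (1 / R) *\<^sub>R v) * K v) \<le> norm (A * cmod (K v))"
      by (intro AE_I2) (simp add: norm_mult mult_right_mono h(3))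
  qed (use hm in simp)
  have "(LINT v|lborel. h (z + (1 / R) *\<^sub>R v) * K v) - h z = (LINT v|lborel. h (z + (1 / R) *\<^sub>R v) * K v) - (LINT v|lborel. h z * K v)"
    by (simp add: K(3))
  also have "\<dots> = (LINT v|lborel. (h (z + (1 / R) *\<^sub>R v) - h z) * K v)"
    using int2 K(1) by (simp add: left_diff_distrib)
  also have "cmod \<dots> \<le> (LINT v|lborel. cmod ((h (z + (1 / R) *\<^sub>R v) - h z) * K v))"
    by (rule integral_norm_bound)
  also have "\<dots> \<le> (LINT v|lborel. (\<eta> + L / R) * ((1 + (norm v)\<^sup>2) * cmod (K v)))"
  proof (rule integral_mono)
    show "integrable lborel (\<lambda>v. cmod ((h (z + (1 / R) *\<^sub>R v) - h z) * K v))"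
      using int2 K(1) by (intro integrable_norm) (simp add: left_diff_distrib)
    show "integrable lborel (\<lambda>v. (\<eta> + L / R) * ((1 + (norm v)\<^sup>2) * cmod (K v)))" using int by simp
    fix v :: plane
    have n: "norm v \<le> 1 + (norm v)\<^sup>2"
    proof -
      have "0 \<le> (norm v - 1)\<^sup>2" by simp
      then show ?thesis using norm_ge_zero[of v] unfolding power2_diff power_one mult_1_right by linarith
    qed
    have "cmod (h (z + (1 / R) *\<^sub>R v) - h z) \<le> \<eta> * 1 + (L / R) * norm v"
      using h(2)[of z "(1 / R) *\<^sub>R v"] R by simp
    also have "\<dots> \<le> \<eta> * (1 + (norm v)\<^sup>2) + (L / R) * (1 + (norm v)\<^sup>2)"
      using n L R \<eta> by (intro add_mono mult_left_mono) auto
    finally have "cmod (h (z + (1 / R) *\<^sub>R v) - h z) \<le> (\<eta> + L / R) * (1 + (norm v)\<^sup>2)" by (simp only: distrib_right)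
    from mult_right_mono[OF this, of "cmod (K v)"]
    show "cmod ((h (z + (1 / R) *\<^sub>R v) - h z) * K v) \<le> (\<eta> + L / R) * ((1 + (norm v)\<^sup>2) * cmod (K v))"
      by (simp add: norm_mult mult.assoc)
  qed
  finally show ?thesis by simp
qed


text \<open>The approximation is the extension \<open>h\<close> with its transform multiplied by a
  bump of width \<open>R\<close>. A large \<open>R\<close> makes the error small and also flattens
  the cut-off, so that its derivatives do not spoil the third condition.\<close>

theorem bandlimited_approx_exists:
  assumes f: "continuous_on (box_sq 1) f" and \<epsilon>: "0 < \<epsilon>" "\<epsilon> < 1"
  shows "\<exists>c f\<^sub>b. 0 < c \<and> bandlimited_approx (box_sq 1) \<epsilon> f f\<^sub>b \<and> has_bandlimit f\<^sub>b c"
proof -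
  have l: "box_sq 1 \<in> sets lebesgue" by (simp add: box_sq_eq_cbox)
  obtain A where A: "0 \<le> A" "Linf_norm (box_sq 1) f = ennreal A" "\<And>z. z \<in> box_sq 1 \<Longrightarrow> cmod (f z) \<le> A"
    by (rule Linf_norm_eq_ennreal[OF compact_box_sq box_sq_subset_closure_interior f]) auto
  show ?thesis
  proof (cases "A = 0")
    \<comment> \<open>For \<open>A = 0\<close> the tolerance \<eta> chosen in the other case would
      be zero; here \<open>f\<close> vanishes on the square and the zero function is an
      approximation.\<close>
    case True
    define z\<^sub>0 :: "plane \<Rightarrow> complex" where "z\<^sub>0 = (\<lambda>z. 0)"
    have F: "fourier z\<^sub>0 = z\<^sub>0" by (simp add: z\<^sub>0_def fourier_eq_ift ift_def fun_eq_iff)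
    have d: "derivs_le 2 0 z\<^sub>0" unfolding z\<^sub>0_def using derivs_le_const[of 2 0] by simp
    have f0: "f z = 0" if "z \<in> box_sq 1" for z using A(3)[OF that] True by simp
    have "rapidly z\<^sub>0" unfolding rapidly_def z\<^sub>0_def using rapid_cmult[OF rapid_bump_fun, of _ 0 0 0 0 0] by simp
    moreover have "has_bandlimit z\<^sub>0 1"
      unfolding has_bandlimit_def F by (rule fsupport_subset) (auto simp: z\<^sub>0_def compact_box_sq compact_imp_closed)
    moreover have "Linf_norm (box_sq 1) (\<lambda>z. z\<^sub>0 z - f z) \<le> ennreal \<epsilon> * Linf_norm (box_sq 1) f"
      by (rule Linf_norm_le[OF l]) (auto simp: z\<^sub>0_def f0 intro!: continuous_intros f)
    moreover have "Linf_norm UNIV z\<^sub>0 \<le> 3 * Linf_norm (box_sq 1) f"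
      by (rule Linf_norm_le) (auto simp: z\<^sub>0_def)
    moreover have "Linf_norm UNIV (mderiv a b (fourier z\<^sub>0)) \<le> 10 * Linf_norm (box_sq 1) f" if "a + b \<le> 2" for a b
      unfolding F using derivs_le_mderiv[OF d that]
      by (intro Linf_norm_le) (auto intro!: continuous_at_imp_continuous_on differentiable_imp_continuous_within)
    ultimately show ?thesis
      unfolding bandlimited_approx_def using rapidly_schwartz by (intro exI[of _ 1] exI[of _ z\<^sub>0]) auto
  next
    case False
    then have Apos: "0 < A" using A(1) by simp
    obtain h where h: "continuous_on UNIV h" "\<And>z. z \<in> box_sq 1 \<Longrightarrow> h z = f z" "\<And>z. cmod (h z) \<le> A"
      "\<And>z. z \<notin> box_sq 2 \<Longrightarrow> h z = 0"
      using extend_continuous[OF f A(3)] by blast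
    have hm: "h \<in> borel_measurable borel" using h(1) by (rule borel_measurable_continuous_onI)
    have "z \<notin> box_sq 2" if "4 < norm z" for z
      using norm_le_l1[of z] that by (cases z) (auto simp: box_sq_def Basis_prod_def inner_prod_def)
    then have bs: "bounded_supp h" unfolding bounded_supp_def using h(3,4) hm by blast
    define K where "K = fourier bump"
    have rK: "rapidly K" unfolding K_def by (rule rapidly_fourier[OF rapidly_bump])
    have K: "integrable lborel K" "integrable lborel (\<lambda>z. (norm z)\<^sup>2 *\<^sub>R K z)"
      using rK by (auto intro: rapidly_integrable rapidly_integrable_norm2)
    have "(LINT v|lborel. K v) = ift K 0" by (simp add: ift_def)
    also have "\<dots> = bump 0" unfolding K_def
      by (rule fourier_inversion[OF rapidlyD(2)[OF rapidly_bump] norm_bump_le rapidly_integrable[OF rapidly_bump] K(1)[unfolded K_def], symmetric])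
    finally have K1: "(LINT v|lborel. K v) = 1" by (simp add: bump_0)
    define N where "N = (LINT v|lborel. (1 + (norm v)\<^sup>2) * cmod (K v))"
    have N: "0 \<le> N" unfolding N_def by (intro integral_nonneg_AE AE_I2) auto
    \<comment> \<open>Chosen so that \<open>2 \<eta> (N + 1)\<close> is exactly
      \<open>\<epsilon> * A\<close>; \<open>N + 1\<close> avoids a division by zero.\<close>
    define \<eta> where "\<eta> = \<epsilon> * A / (2 * (N + 1))"
    have \<eta>: "0 < \<eta>" using \<epsilon> Apos N by (simp add: \<eta>_def)
    obtain L where L: "0 \<le> L" "\<And>z w. cmod (h (z + w) - h z) \<le> \<eta> + L * norm w"
      using bounded_oscillation[OF h(1,3,4) \<eta>] by blast
    obtain C where C: "derivs_le 2 C bump" using rapidly_derivs_le[OF rapidly_bump] by blast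
    \<comment> \<open>\<open>R \<ge> L / \<eta>\<close> makes \<open>L / R \<le> \<eta>\<close>, and
      \<open>R \<ge> C\<close> brings the derivatives of the cut-off below 1.\<close>
    define R where "R = 1 + \<bar>C\<bar> + L / \<eta>"
    have R: "1 \<le> R" "C \<le> R" "L / \<eta> \<le> R" using L(1) \<eta> divide_nonneg_pos[of L \<eta>] unfolding R_def by linarith+
    define \<kappa> where "\<kappa> \<xi> = bump ((1 / R) *\<^sub>R \<xi>)" for \<xi>
    have r\<kappa>: "rapidly \<kappa>" unfolding \<kappa>_def using R by (intro rapidly_scale rapidly_bump) auto
    define \<psi> where "\<psi> \<xi> = fourier h \<xi> * \<kappa> \<xi>" for \<xi>
    have r\<psi>: "rapidly \<psi>"
      unfolding rapidly_def \<psi>_def using tame_fourier[OF bs] r\<kappa> by (auto intro!: rapid_mult simp: rapidly_def)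
    define f\<^sub>b where "f\<^sub>b = ift \<psi>"
    have rf: "rapidly f\<^sub>b" unfolding f\<^sub>b_def by (rule rapidly_ift[OF r\<psi>])
    have F: "fourier f\<^sub>b = \<psi>" unfolding f\<^sub>b_def by (rule fourier_ift[OF r\<psi>])
    have close: "cmod (f\<^sub>b z - h z) \<le> \<epsilon> * A" for z
    proof -
      have "f\<^sub>b z = (LINT v|lborel. h (z + (1 / R) *\<^sub>R v) * K v)"
        unfolding f\<^sub>b_def \<psi>_def \<kappa>_def K_def
        by (rule frequency_cutoff_eq[OF h(1) bounded_supp_integrable[OF bs] rapidly_bump]) (use R in simp)
      then have "cmod (f\<^sub>b z - h z) \<le> (\<eta> + L / R) * N"
        unfolding N_def using mult_approx_identity[OF h(1) L(2) h(3) L(1) _ K K1, of R z] \<eta> R by simp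
      also have "\<dots> \<le> (\<eta> + \<eta>) * (N + 1)"
      proof (intro mult_mono add_left_mono)
        have "L \<le> \<eta> * R" using R(3) \<eta> by (simp add: field_simps)
        then show "L / R \<le> \<eta>" using R by (simp add: divide_le_eq)
      qed (use N \<eta> in auto)
      also have "\<dots> = \<eta> * (2 * (N + 1))" by (simp add: algebra_simps)
      also have "\<dots> = \<epsilon> * A" using N by (simp add: \<eta>_def)
      finally show ?thesis .
    qed
    have bl: "has_bandlimit f\<^sub>b R"
      unfolding has_bandlimit_def F
    proof (rule fsupport_subset)
      fix \<xi> assume "\<xi> \<notin> box_sq R"
      then have "(1 / R) *\<^sub>R \<xi> \<notin> box_sq 1" using R by (cases \<xi>) (auto simp: box_sq_def field_simps)
      then show "\<psi> \<xi> = 0" by (simp add: \<psi>_def \<kappa>_def bump_eq_0)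
    qed (simp add: compact_box_sq compact_imp_closed)
    have c1: "Linf_norm (box_sq 1) (\<lambda>z. f\<^sub>b z - f z) \<le> ennreal \<epsilon> * Linf_norm (box_sq 1) f"
    proof (rule Linf_norm_le[OF l])
      show "continuous_on (box_sq 1) (\<lambda>z. f\<^sub>b z - f z)"
        by (intro continuous_intros f continuous_on_subset[OF rapidlyD(2)[OF rf]]) auto
      show "ennreal (cmod (f\<^sub>b z - f z)) \<le> ennreal \<epsilon> * Linf_norm (box_sq 1) f" if "z \<in> box_sq 1" for z
        using close[of z] h(2)[OF that] \<epsilon> A by (simp add: ennreal_mult[symmetric] ennreal_leI)
    qed
    have c2: "Linf_norm UNIV f\<^sub>b \<le> 3 * Linf_norm (box_sq 1) f"
    proof (rule Linf_norm_le)
      have "cmod (f\<^sub>b z) \<le> 3 * A" for z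
      proof -
        have "\<epsilon> * A \<le> 1 * A" using \<epsilon> A(1) by (intro mult_right_mono) auto
        then show ?thesis using norm_triangle_sub[of "f\<^sub>b z" "h z"] close[of z] h(3)[of z] A(1) by linarith
      qed
      then have "ennreal (cmod (f\<^sub>b z)) \<le> ennreal (3 * A)" for z by (rule ennreal_leI)
      then show "ennreal (cmod (f\<^sub>b z)) \<le> 3 * Linf_norm (box_sq 1) f" for z
        using A by (simp add: ennreal_mult)
    qed (use rapidlyD(2)[OF rf] in auto)
    \<comment> \<open>With \<open>2 A\<close> for the transform of \<open>h\<close>, as
      \<open>pi\<^sup>2 \<ge> 8\<close>, and 1 for the cut-off, the product rule gives
      \<open>8 A\<close>, within the allowed \<open>10 A\<close>.\<close>
    have "derivs_le 2 (2\<^sup>2 * ((2 * A) * 1)) \<psi>"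
      unfolding \<psi>_def
    proof (rule derivs_le_mult)
      have "2\<^sup>2 * (4 * A / pi\<^sup>2) \<le> 2 * A"
      proof -
        have "3 * 3 \<le> pi * pi" using pi_gt3 by (intro mult_mono) auto
        then have "8 * A \<le> pi\<^sup>2 * A" using A(1) by (intro mult_right_mono) (auto simp: power2_eq_square)
        then show ?thesis by (simp add: field_simps)
      qed
      then show "derivs_le 2 (2 * A) (fourier h)"
        using derivs_le_mono[OF derivs_le_fourier[OF hm h(3,4), of 2]] by simp
      have d1: "derivs_le 1 1 (\<lambda>\<xi>. of_real (1 / R) * w ((1 / R) *\<^sub>R \<xi>))" if "derivs_le 1 C w" for w
      proof (rule derivs_le_mono[OF derivs_le_cmult[OF derivs_le_scale[OF that]]])
        show "\<bar>1 / R\<bar> \<le> 1" using R by simp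
        show "cmod (of_real (1 / R)) * C \<le> 1" using R by (simp add: norm_divide)
      qed
      have dC: "derivs_le 1 C (D\<^sub>x bump)" "derivs_le 1 C (D\<^sub>y bump)"
        using C by (simp_all only: numeral_2_eq_2 One_nat_def derivs_le.simps(2))
      have "derivs_le 0 1 \<kappa>"
        using rapidlyD(1)[OF r\<kappa>] norm_bump_le by (simp add: \<kappa>_def)
      moreover have "derivs_le 1 1 (D\<^sub>x \<kappa>)" "derivs_le 1 1 (D\<^sub>y \<kappa>)"
        unfolding \<kappa>_def partials_scale(2,3)[OF rapidlyD(1)[OF rapidly_bump]] using d1 dC by blast+
      ultimately show "derivs_le 2 1 \<kappa>" by (simp only: numeral_2_eq_2 One_nat_def derivs_le.simps(2))
    qed
    then have d: "derivs_le 2 (10 * A) (fourier f\<^sub>b)" unfolding F by (rule derivs_le_mono) (use A(1) in simp)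
    have c3: "Linf_norm UNIV (mderiv a b (fourier f\<^sub>b)) \<le> 10 * Linf_norm (box_sq 1) f" if "a + b \<le> 2" for a b
    proof (rule Linf_norm_le)
      show "continuous_on UNIV (mderiv a b (fourier f\<^sub>b))"
        using derivs_le_mderiv(1)[OF d that] by (auto intro!: continuous_at_imp_continuous_on differentiable_imp_continuous_within)
      show "ennreal (cmod (mderiv a b (fourier f\<^sub>b) z)) \<le> 10 * Linf_norm (box_sq 1) f" for z
        using ennreal_leI[OF derivs_le_mderiv(2)[OF d that, of z]] A by (simp add: ennreal_mult)
    qed simp
    show ?thesis
      unfolding bandlimited_approx_def using c1 c2 c3 rapidly_schwartz[OF rf] bl R
      by (intro exI[of _ R] exI[of _ f\<^sub>b]) auto
  qed
qed

section \<open>Schwartz functions\<close>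

text \<open>Integrable moments are enough to differentiate transforms repeatedly. For Schwartz
  functions they are easier to get than \<open>rapidly\<close>: the seminorms fix one order of
  coordinates and derivatives, whereas \<open>rapidly\<close> allows all interleavings.\<close>

definition all_moments :: "(plane \<Rightarrow> complex) \<Rightarrow> bool" where
  "all_moments \<phi> \<longleftrightarrow> (\<forall>i j. integrable lborel ((mulx ^^ i) ((muly ^^ j) \<phi>)))"

lemma mulx_muly: "mulx (muly \<phi>) = muly (mulx \<phi>)"
  by (simp add: mulx_def muly_def fun_eq_iff)

lemma mul_cmult: "mulx (\<lambda>z. c * \<phi> z) = (\<lambda>z. c * mulx \<phi> z)" "muly (\<lambda>z. c * \<phi> z) = (\<lambda>z. c * muly \<phi> z)"
  by (auto simp: mulx_def muly_def fun_eq_iff)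

lemma all_moments_mul:
  assumes "all_moments \<phi>"
  shows "all_moments (mulx \<phi>)" "all_moments (muly \<phi>)" "all_moments (\<lambda>z. c * \<phi> z)"
proof -
  have y: "(muly ^^ j) (mulx \<phi>) = mulx ((muly ^^ j) \<phi>)" for j
    by (induction j) (simp_all add: mulx_muly)
  show "all_moments (mulx \<phi>)"
    using assms unfolding all_moments_def y by (metis funpow_Suc_right comp_apply)
  show "all_moments (muly \<phi>)"
    using assms unfolding all_moments_def by (metis funpow_Suc_right comp_apply)
  have "(muly ^^ j) (\<lambda>z. c * \<phi> z) = (\<lambda>z. c * (muly ^^ j) \<phi> z)" for j
    by (induction j) (simp_all add: mul_cmult)
  moreover have "(mulx ^^ i) (\<lambda>z. c * \<psi> z) = (\<lambda>z. c * (mulx ^^ i) \<psi> z)" for i \<psi>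
    by (induction i) (simp_all add: mul_cmult)
  ultimately show "all_moments (\<lambda>z. c * \<phi> z)"
    using assms unfolding all_moments_def by simp
qed

lemma all_moments_integrable:
  assumes "all_moments \<phi>"
  shows "integrable lborel \<phi>" "integrable lborel (\<lambda>z. (norm z)\<^sup>2 *\<^sub>R \<phi> z)"
proof -
  have "integrable lborel ((mulx ^^ i) ((muly ^^ j) \<phi>))" for i j
    using assms by (simp add: all_moments_def)
  from this[of 0 0] this[of 2 0] this[of 0 2]
  have i: "integrable lborel \<phi>" "integrable lborel (mulx (mulx \<phi>))" "integrable lborel (muly (muly \<phi>))"
    by (simp_all add: numeral_2_eq_2)
  have "(norm z)\<^sup>2 *\<^sub>R \<phi> z = mulx (mulx \<phi>) z + muly (muly \<phi>) z" for z
    by (cases z) (simp add: norm_prod_def mulx_def muly_def scaleR_conv_of_real algebra_simps power2_eq_square)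
  then show "integrable lborel \<phi>" "integrable lborel (\<lambda>z. (norm z)\<^sup>2 *\<^sub>R \<phi> z)" using i by simp_all
qed

lemma all_moments_fourier:
  assumes "all_moments \<phi>"
  shows "fourier \<phi> differentiable (at z)" "continuous_on UNIV (fourier \<phi>)"
    "D\<^sub>x (fourier \<phi>) = fourier (\<lambda>z. - \<i> * mulx \<phi> z)"
    "D\<^sub>y (fourier \<phi>) = fourier (\<lambda>z. - \<i> * muly \<phi> z)"
  using fourier_partials[OF all_moments_integrable[OF assms]]
  by (auto intro!: continuous_at_imp_continuous_on differentiable_imp_continuous_within)

lemma smooth_mderiv:
  assumes "smooth_on UNIV \<phi>"
  shows "smooth_on UNIV (mderiv a b \<phi>)"
proof -
  have "smooth_on UNIV (D\<^sub>x \<psi>)" "smooth_on UNIV (D\<^sub>y \<psi>)" if "smooth_on UNIV \<psi>" for \<psi> :: "plane \<Rightarrow> 'a"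
    using that unfolding smooth_on_def by (metis Ck_on.simps(2))+
  moreover from this(2) have "smooth_on UNIV ((D\<^sub>y ^^ b) \<phi>)"
    using assms by (induction b) auto
  ultimately show ?thesis
    unfolding mderiv_def by (induction a) auto
qed

lemma schwartz_mderiv:
  assumes "schwartz \<phi>"
  shows "mderiv a b \<phi> differentiable (at z)" "continuous_on UNIV (mderiv a b \<phi>)"
proof -
  have s: "smooth_on UNIV (mderiv a b \<phi>)" using assms by (simp add: schwartz_def smooth_mderiv)
  then have "Ck_on 1 UNIV (mderiv a b \<phi>)" "Ck_on 0 UNIV (mderiv a b \<phi>)" unfolding smooth_on_def by blast+
  then show "mderiv a b \<phi> differentiable (at z)" "continuous_on UNIV (mderiv a b \<phi>)" by simp_all
qed

lemma mderiv_0_0: "mderiv 0 0 \<phi> = \<phi>"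
  by (simp add: mderiv_def)

lemma schwartz_basic:
  assumes "schwartz \<phi>"
  shows "\<phi> differentiable (at z)" "continuous_on UNIV \<phi>"
  using schwartz_mderiv[OF assms, of 0 0] by (simp_all add: mderiv_0_0)

lemma seminorm_bound:
  assumes "schwartz \<phi>"
  shows "\<bar>fst z\<bar> ^ i * \<bar>snd z\<bar> ^ j * cmod (mderiv a b \<phi> z) \<le> schwartz_seminorm i j a b \<phi>"
  unfolding schwartz_seminorm_def
  by (rule cSUP_upper) (use assms in \<open>auto simp: schwartz_def\<close>)

lemma weight_expand: "weight z * t = t + \<bar>fst z\<bar>\<^sup>2 * t + \<bar>snd z\<bar>\<^sup>2 * t + \<bar>fst z\<bar>\<^sup>2 * \<bar>snd z\<bar>\<^sup>2 * t"
  by (simp add: weight_def algebra_simps)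

lemma schwartz_decay:
  assumes "schwartz \<phi>"
  shows "weight z * (\<bar>fst z\<bar> ^ i * \<bar>snd z\<bar> ^ j * cmod (mderiv a b \<phi> z)) \<le>
    schwartz_seminorm i j a b \<phi> + schwartz_seminorm (i + 2) j a b \<phi> + schwartz_seminorm i (j + 2) a b \<phi>
     + schwartz_seminorm (i + 2) (j + 2) a b \<phi>"
  using seminorm_bound[OF assms, of z i j a b] seminorm_bound[OF assms, of z "i + 2" j a b]
    seminorm_bound[OF assms, of z i "j + 2" a b] seminorm_bound[OF assms, of z "i + 2" "j + 2" a b]
  unfolding weight_expand power_add by (simp only: mult_ac)

lemma schwartz_all_moments:
  assumes "schwartz \<phi>"
  shows "all_moments (mderiv a b \<phi>)"
  unfolding all_moments_def
proof (intro allI)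
  fix i j
  have "(muly ^^ j) \<psi> z = of_real (snd z) ^ j * \<psi> z" for \<psi> z
    by (induction j) (simp_all add: muly_def)
  moreover have "(mulx ^^ i) \<psi> z = of_real (fst z) ^ i * \<psi> z" for \<psi> z
    by (induction i) (simp_all add: mulx_def)
  ultimately have e: "(mulx ^^ i) ((muly ^^ j) (mderiv a b \<phi>)) = (\<lambda>z. of_real (fst z) ^ i * (of_real (snd z) ^ j * mderiv a b \<phi> z))"
    by (simp add: fun_eq_iff)
  show "integrable lborel ((mulx ^^ i) ((muly ^^ j) (mderiv a b \<phi>)))"
  proof (rule integrable_weight_bound)
    show "(mulx ^^ i) ((muly ^^ j) (mderiv a b \<phi>)) \<in> borel_measurable borel" unfolding e
      by (intro borel_measurable_continuous_onI continuous_intros schwartz_mderiv[OF assms])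
  qed (use schwartz_decay[OF assms, of _ i j a b] in \<open>simp add: e norm_mult norm_power mult.assoc\<close>)
qed

lemma partial_mderiv: "D\<^sub>x (mderiv a b \<phi>) = mderiv (Suc a) b \<phi>" "D\<^sub>y (mderiv 0 b \<phi>) = mderiv 0 (Suc b) \<phi>"
  by (simp_all add: mderiv_def)

lemma fourier_mderiv:
  assumes "schwartz \<phi>"
  shows "fourier (mderiv a b \<phi>) \<xi> = (\<i> * of_real (fst \<xi>)) ^ a * (\<i> * of_real (snd \<xi>)) ^ b * fourier \<phi> \<xi>"
proof -
  note i = all_moments_integrable(1)[OF schwartz_all_moments[OF assms]] and c = schwartz_mderiv[OF assms]
  have y: "fourier (mderiv 0 b \<phi>) \<xi> = (\<i> * of_real (snd \<xi>)) ^ b * fourier \<phi> \<xi>"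
  proof (induction b)
    case (Suc b)
    show ?case
      using fourier_of_partials(2)[OF c(1) i, of 0 b \<xi>] c(2)[of 0 "Suc b"] i[of 0 "Suc b"] Suc
      by (simp add: partial_mderiv muly_def)
  qed (simp add: mderiv_0_0)
  show ?thesis
  proof (induction a)
    case (Suc a)
    then show ?case
      using fourier_of_partials(1)[OF c(1) i, of a b \<xi>] c(2)[of "Suc a" b] i[of "Suc a" b]
      by (simp add: partial_mderiv mulx_def)
  qed (simp add: y)
qed

text \<open>The derivatives of \<open>\<phi>\<close> up to order 2 in each variable bound
  \<open>weight\<close> times the transform. The extra factor x costs one more x-derivative, whence
  the orders 1 and 3.\<close>

lemma fourier_schwartz_integrable:
  assumes "schwartz \<phi>"
  shows "integrable lborel (fourier \<phi>)" "integrable lborel (mulx (fourier \<phi>))"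
proof -
  note i = all_moments_integrable(1)[OF schwartz_all_moments[OF assms]]
  define D where "D a b = (LINT w|lborel. cmod (mderiv a b \<phi> w)) / (4 * pi\<^sup>2)" for a b
  have D: "\<bar>fst \<xi>\<bar> ^ a * \<bar>snd \<xi>\<bar> ^ b * cmod (fourier \<phi> \<xi>) \<le> D a b" for a b \<xi>
    using norm_fourier_le[OF i, of a b \<xi>] by (simp add: D_def fourier_mderiv[OF assms] norm_mult norm_power)
  have c: "continuous_on UNIV (fourier \<phi>)"
    using all_moments_fourier(2)[OF schwartz_all_moments[OF assms, of 0 0]] by (simp add: mderiv_0_0)
  show "integrable lborel (fourier \<phi>)"
  proof (rule integrable_weight_bound)
    show "weight \<xi> * norm (fourier \<phi> \<xi>) \<le> D 0 0 + D 2 0 + D 0 2 + D 2 2" for \<xi>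
      using D[of \<xi> 0 0] D[of \<xi> 2 0] D[of \<xi> 0 2] D[of \<xi> 2 2] unfolding weight_expand by simp
  qed (use c in \<open>simp add: borel_measurable_continuous_onI\<close>)
  show "integrable lborel (mulx (fourier \<phi>))"
  proof (rule integrable_weight_bound)
    show "mulx (fourier \<phi>) \<in> borel_measurable borel"
      unfolding mulx_def[abs_def] by (intro borel_measurable_continuous_onI continuous_intros c)
    show "weight \<xi> * norm (mulx (fourier \<phi>) \<xi>) \<le> D 1 0 + D 3 0 + D 1 2 + D 3 2" for \<xi>
      using D[of \<xi> 1 0] D[of \<xi> 3 0] D[of \<xi> 1 2] D[of \<xi> 3 2] unfolding weight_expand
      by (simp add: mulx_def norm_mult power3_eq_cube power2_eq_square mult_ac)
  qed
qed

text \<open>The functions against which distributions are tested: they satisfy Fourier inversion and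
  are stable under translation and dilation.\<close>

definition test_fun :: "(plane \<Rightarrow> complex) \<Rightarrow> bool" where
  "test_fun \<phi> \<longleftrightarrow> continuous_on UNIV \<phi> \<and> (\<exists>B. \<forall>z. cmod (\<phi> z) \<le> B) \<and> integrable lborel \<phi> \<and> integrable lborel (fourier \<phi>)"

lemma test_fun_inversion: "test_fun \<phi> \<Longrightarrow> \<phi> z = ift (fourier \<phi>) z"
  unfolding test_fun_def using fourier_inversion by blast

text \<open>The x-derivative is included because the outermost antiderivative is tested against
  it.\<close>

lemma schwartz_test_fun:
  assumes "schwartz \<phi>"
  shows "test_fun \<phi>" "test_fun (D\<^sub>x \<phi>)" "fourier (D\<^sub>x \<phi>) = (\<lambda>\<xi>. \<i> * mulx (fourier \<phi>) \<xi>)"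
proof -
  note i = all_moments_integrable(1)[OF schwartz_all_moments[OF assms]] and c = schwartz_mderiv[OF assms]
  have b: "\<exists>B. \<forall>z. cmod (mderiv a b \<phi> z) \<le> B" for a b
    using seminorm_bound[OF assms, of _ 0 0 a b] by (intro exI[of _ "schwartz_seminorm 0 0 a b \<phi>"]) simp
  show "test_fun \<phi>"
    using i[of 0 0] c(2)[of 0 0] b[of 0 0] fourier_schwartz_integrable(1)[OF assms]
    by (simp add: test_fun_def mderiv_0_0)
  have p: "D\<^sub>x \<phi> = mderiv 1 0 \<phi>" by (simp add: mderiv_def)
  show F: "fourier (D\<^sub>x \<phi>) = (\<lambda>\<xi>. \<i> * mulx (fourier \<phi>) \<xi>)"
    unfolding p by (simp add: fun_eq_iff fourier_mderiv[OF assms] mulx_def)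
  show "test_fun (D\<^sub>x \<phi>)"
    using i[of 1 0] c(2)[of 1 0] b[of 1 0] fourier_schwartz_integrable(2)[OF assms]
    unfolding test_fun_def F by (simp add: p)
qed

text \<open>Modulating a function by a frequency shifts its spectrum; here the shift is moved over
  to the test function.\<close>

lemma fourier_shift:
  assumes "test_fun \<phi>"
  shows "fourier (\<lambda>z. \<phi> (z + v)) \<xi> = cis (v \<bullet> \<xi>) * fourier \<phi> \<xi>" "test_fun (\<lambda>z. \<phi> (z + v))"
proof -
  have c: "continuous_on UNIV \<phi>" and i: "integrable lborel \<phi>" "integrable lborel (fourier \<phi>)"
    using assms by (auto simp: test_fun_def)
  have F: "fourier (\<lambda>z. \<phi> (z + v)) \<xi> = cis (v \<bullet> \<xi>) * fourier \<phi> \<xi>" for \<xi>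
  proof -
    have "(LINT z|lborel. (\<lambda>z. \<phi> z * cis ((z - v) \<bullet> - \<xi>)) (z + v)) = (LINT z|lborel. \<phi> z * cis ((z - v) \<bullet> - \<xi>))"
      by (rule integral_translate) (intro borel_measurable_continuous_onI continuous_intros c)
    also have "\<dots> = (LINT z|lborel. cis (v \<bullet> \<xi>) * (\<phi> z * cis (z \<bullet> - \<xi>)))"
      by (simp add: inner_diff_left cis_mult[symmetric] mult_ac add.commute flip: cis_mult)
        (simp add: cis_mult algebra_simps)
    finally show ?thesis by (simp add: fourier_eq_ift ift_def)
  qed
  then show "fourier (\<lambda>z. \<phi> (z + v)) \<xi> = cis (v \<bullet> \<xi>) * fourier \<phi> \<xi>" .
  have "(\<lambda>\<xi>. cis (v \<bullet> \<xi>) * fourier \<phi> \<xi>) = (\<lambda>\<xi>. fourier \<phi> \<xi> * cis (\<xi> \<bullet> v))"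
    by (simp add: fun_eq_iff inner_commute mult.commute)
  then have "integrable lborel (fourier (\<lambda>z. \<phi> (z + v)))"
    using integrable_mult_cis[OF i(2), of v] unfolding F[abs_def] by simp
  then show "test_fun (\<lambda>z. \<phi> (z + v))"
    using assms integrable_translate[OF i(1), of v] unfolding test_fun_def
    by (auto intro!: continuous_on_compose2[OF c] continuous_intros)
qed

text \<open>The counterpart for dilations: it moves the dilation in \<open>F (s x, y)\<close> over
  to the test function.\<close>

lemma fourier_scale_x:
  assumes "test_fun \<phi>" and s: "0 < s"
  shows "fourier (\<lambda>z. \<phi> (s * fst z, snd z)) \<xi> = of_real (1 / s) * fourier \<phi> (fst \<xi> / s, snd \<xi>)"
    "test_fun (\<lambda>z. \<phi> (s * fst z, snd z))"
proof -
  have c: "continuous_on UNIV \<phi>" and i: "integrable lborel \<phi>" "integrable lborel (fourier \<phi>)"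
    using assms by (auto simp: test_fun_def)
  have F: "fourier (\<lambda>z. \<phi> (s * fst z, snd z)) \<xi> = of_real (1 / s) * fourier \<phi> (fst \<xi> / s, snd \<xi>)" for \<xi>
  proof -
    let ?\<eta> = "- (fst \<xi> / s, snd \<xi>)"
    have "ift \<phi> ?\<eta> = \<bar>s * 1\<bar> *\<^sub>R (LINT z|lborel. (\<lambda>z. \<phi> z * cis (z \<bullet> ?\<eta>)) (0 + s * fst z, 0 + 1 * snd z))"
      unfolding ift_def
      by (rule integral_plane_affine) (use s in \<open>auto intro!: borel_measurable_continuous_onI continuous_intros c\<close>)
    also have "(\<lambda>z. (\<lambda>z. \<phi> z * cis (z \<bullet> ?\<eta>)) (0 + s * fst z, 0 + 1 * snd z)) = (\<lambda>z. \<phi> (s * fst z, snd z) * cis (z \<bullet> - \<xi>))"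
      using s by (simp add: inner_prod_def fun_eq_iff)
    finally show ?thesis using s
      by (simp add: fourier_eq_ift ift_def scaleR_conv_of_real)
  qed
  then show "fourier (\<lambda>z. \<phi> (s * fst z, snd z)) \<xi> = of_real (1 / s) * fourier \<phi> (fst \<xi> / s, snd \<xi>)" .
  have "integrable lborel (fourier (\<lambda>z. \<phi> (s * fst z, snd z)))"
    using integrable_plane_affine[of "1 / s" 1 "fourier \<phi>" 0 0] s i(2) unfolding F[abs_def]
    by (intro integrable_mult_right) simp
  moreover have "integrable lborel (\<lambda>z. \<phi> (s * fst z, snd z))"
    using integrable_plane_affine[of s 1 \<phi> 0 0] s i(1) by simp
  ultimately show "test_fun (\<lambda>z. \<phi> (s * fst z, snd z))"
    using assms unfolding test_fun_def
    by (auto intro!: continuous_on_compose2[OF c] continuous_intros)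
qed

section \<open>Passing to the limiting bandlimit\<close>

lemma lipschitz_of_partials:
  fixes G :: "plane \<Rightarrow> complex"
  assumes d: "\<And>z. G differentiable (at z)" and M: "\<And>z. cmod (D\<^sub>x G z) \<le> M" "\<And>z. cmod (D\<^sub>y G z) \<le> M"
  shows "cmod (G z - G w) \<le> 2 * M * norm (z - w)"
proof (rule differentiable_bound[of UNIV])
  show "(G has_derivative (\<lambda>h. fst h *\<^sub>R D\<^sub>x G z + snd h *\<^sub>R D\<^sub>y G z)) (at z within UNIV)" for z
    using has_derivative_partials[OF d] by simp
  have M0: "0 \<le> M" using order_trans[OF norm_ge_zero M(1)] .
  show "onorm (\<lambda>h. fst h *\<^sub>R D\<^sub>x G z + snd h *\<^sub>R D\<^sub>y G z) \<le> 2 * M" for z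
  proof (rule onorm_bound)
    fix h :: plane
    have "norm (fst h *\<^sub>R D\<^sub>x G z + snd h *\<^sub>R D\<^sub>y G z) \<le> \<bar>fst h\<bar> * cmod (D\<^sub>x G z) + \<bar>snd h\<bar> * cmod (D\<^sub>y G z)"
      by (rule order_trans[OF norm_triangle_ineq]) simp
    also have "\<dots> \<le> norm h * M + norm h * M"
      using norm_fst_le[of "fst h" "snd h"] norm_snd_le[of "snd h" "fst h"]
      by (intro add_mono mult_mono M) auto
    finally show "norm (fst h *\<^sub>R D\<^sub>x G z + snd h *\<^sub>R D\<^sub>y G z) \<le> 2 * M * norm h" by simp
  qed (use M0 in simp)
qed auto

text \<open>\<open>H\<close> is (up to the factor \<open>\<i>\<close>) the derivative of \<open>G\<close> in the first variable; the bound (3) on the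
  second derivatives makes both families equicontinuous.\<close>

lemma approx_frequency_side:
  assumes a: "bandlimited_approx (box_sq 1) \<epsilon> u f\<^sub>b" and b: "has_bandlimit f\<^sub>b b" and u: "continuous_on (box_sq 1) u"
    and A: "Linf_norm (box_sq 1) u = ennreal A" "0 \<le> A" and \<epsilon>: "0 \<le> \<epsilon>"
  defines "G \<equiv> fourier f\<^sub>b" and "H \<equiv> fourier (mulx f\<^sub>b)"
  shows "cmod (G \<xi>) \<le> 10 * A" "cmod (H \<xi>) \<le> 10 * A"
    "cmod (G \<xi> - G \<eta>) \<le> 20 * A * norm (\<xi> - \<eta>)" "cmod (H \<xi> - H \<eta>) \<le> 20 * A * norm (\<xi> - \<eta>)"
    "\<xi> \<notin> box_sq b \<Longrightarrow> G \<xi> = 0 \<and> H \<xi> = 0" "ift G z = f\<^sub>b z" "ift H z = mulx f\<^sub>b z"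
    "z \<in> box_sq 1 \<Longrightarrow> cmod (f\<^sub>b z - u z) \<le> \<epsilon> * A" "continuous_on UNIV G" "continuous_on UNIV H"
proof -
  have s: "schwartz f\<^sub>b" using a by (simp add: bandlimited_approx_def)
  have m: "all_moments f\<^sub>b" using schwartz_all_moments[OF s, of 0 0] by (simp add: mderiv_0_0)
  note mx = all_moments_mul(1)[OF m] and my = all_moments_mul(2)[OF m]
  note F = all_moments_fourier
  have P: "D\<^sub>x G = fourier (\<lambda>z. - \<i> * mulx f\<^sub>b z)" "D\<^sub>y G = fourier (\<lambda>z. - \<i> * muly f\<^sub>b z)"
    unfolding G_def by (rule F(3,4)[OF m])+
  have PH: "D\<^sub>x H = fourier (\<lambda>z. - \<i> * mulx (mulx f\<^sub>b) z)" "D\<^sub>y H = fourier (\<lambda>z. - \<i> * muly (mulx f\<^sub>b) z)"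
    unfolding H_def by (rule F(3,4)[OF mx])+
  \<comment> \<open>An essential bound is a pointwise one only for continuous functions, hence the
    continuity premise, which is discharged for each derivative separately.\<close>
  have bnd: "cmod (mderiv i j G \<xi>) \<le> 10 * A" if "i + j \<le> 2" "continuous_on UNIV (mderiv i j G)" for i j \<xi>
  proof -
    have "ennreal (cmod (mderiv i j G \<xi>)) \<le> Linf_norm UNIV (mderiv i j G)"
      by (rule Linf_norm_ge) (use that in auto)
    also have "\<dots> \<le> 10 * ennreal A"
      using a that(1) unfolding bandlimited_approx_def G_def A(1) by blast
    also have "10 * ennreal A = ennreal (10 * A)" using A(2) by (simp add: ennreal_mult)
    finally show ?thesis using A(2) by simp
  qed
  have cx: "continuous_on UNIV (fourier (\<lambda>z. c * \<psi> z))" if "all_moments \<psi>" for c \<psi>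
    by (rule F(2)[OF all_moments_mul(3)[OF that]])
  have e00: "mderiv 0 0 G = G" and e10: "mderiv 1 0 G = (\<lambda>\<xi>. - \<i> * H \<xi>)" and e01: "mderiv 0 1 G = D\<^sub>y G"
    by (simp_all add: mderiv_def P H_def fun_eq_iff fourier_cmult[of "- \<i>", simplified])
  have e20: "mderiv 2 0 G = (\<lambda>\<xi>. - \<i> * D\<^sub>x H \<xi>)"
  proof -
    have "mderiv 2 0 G = D\<^sub>x (mderiv 1 0 G)" by (simp add: mderiv_def numeral_2_eq_2)
    then show ?thesis unfolding e10 using partials_cmult(1)[of H "- \<i>"] F(1)[OF mx] by (simp add: H_def)
  qed
  \<comment> \<open>\<open>mderiv 1 1\<close> takes the y-derivative first, while \<open>H\<close>
    already contains the x-derivative; the two orders agree because multiplications by coordinates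
    commute.\<close>
  have e11: "mderiv 1 1 G = (\<lambda>\<xi>. - \<i> * D\<^sub>y H \<xi>)"
  proof -
    have "mderiv 1 1 G = D\<^sub>x (fourier (\<lambda>z. - \<i> * muly f\<^sub>b z))" by (simp add: mderiv_def P)
    also have "\<dots> = fourier (\<lambda>z. - \<i> * mulx (\<lambda>z. - \<i> * muly f\<^sub>b z) z)"
      by (rule F(3)[OF all_moments_mul(3)[OF my]])
    also have "\<dots> = (\<lambda>\<xi>. - \<i> * D\<^sub>y H \<xi>)"
      unfolding PH mul_cmult mulx_muly by (rule ext) (rule fourier_cmult)
    finally show ?thesis .
  qed
  have cG: "continuous_on UNIV G" and cH: "continuous_on UNIV H"
    using F(2)[OF m] F(2)[OF mx] by (simp_all add: G_def H_def)
  show "continuous_on UNIV G" "continuous_on UNIV H" by fact+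
  have Gb: "cmod (G \<xi>) \<le> 10 * A" for \<xi> using bnd[of 0 0 \<xi>] cG by (simp add: e00)
  then show "cmod (G \<xi>) \<le> 10 * A" .
  have c10: "continuous_on UNIV (mderiv 1 0 G)" unfolding e10 by (intro continuous_intros cH)
  have Hb: "cmod (H \<xi>) \<le> 10 * A" for \<xi> using bnd[OF _ c10, of \<xi>] unfolding e10 by (simp add: norm_mult)
  then show "cmod (H \<xi>) \<le> 10 * A" .
  have c01: "continuous_on UNIV (mderiv 0 1 G)" unfolding e01 P by (rule cx[OF my])
  show "cmod (G \<xi> - G \<eta>) \<le> 20 * A * norm (\<xi> - \<eta>)"
  proof -
    have "D\<^sub>x G = mderiv 1 0 G" "D\<^sub>y G = mderiv 0 1 G" by (simp_all add: mderiv_def)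
    then show ?thesis
      using lipschitz_of_partials[of G "10 * A" \<xi> \<eta>] F(1)[OF m] bnd[OF _ c10] bnd[OF _ c01] by (simp add: G_def)
  qed
  have c20: "continuous_on UNIV (mderiv 2 0 G)"
    unfolding e20 PH by (intro continuous_intros cx all_moments_mul mx)
  have c11: "continuous_on UNIV (mderiv 1 1 G)"
    unfolding e11 PH by (intro continuous_intros cx all_moments_mul mx)
  show "cmod (H \<xi> - H \<eta>) \<le> 20 * A * norm (\<xi> - \<eta>)"
    using lipschitz_of_partials[of H "10 * A" \<xi> \<eta>] F(1)[OF mx] bnd[OF _ c20] bnd[OF _ c11]
    unfolding e20 e11 by (simp add: norm_mult H_def)
  have G0: "G \<xi> = 0" if "\<xi> \<notin> box_sq b" for \<xi>
    using b that fsupportD unfolding has_bandlimit_def G_def by blast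
  \<comment> \<open>\<open>G\<close> vanishes on the open complement of the square, so its
    derivative, which is \<open>H\<close> up to a factor, vanishes there too.\<close>
  have H0: "H \<xi> = 0" if "\<xi> \<notin> box_sq b" for \<xi>
  proof -
    have "(G has_derivative (\<lambda>_. 0)) (at \<xi>)"
      by (rule has_derivative_transform_within_open[OF has_derivative_const, of "- box_sq b"])
         (use that G0 in \<open>auto simp: compact_box_sq compact_imp_closed open_Compl\<close>)
    then have "D\<^sub>x G \<xi> = 0" using partial_x_eq by blast
    then show ?thesis using e10 by (simp add: mderiv_def fun_eq_iff)
  qed
  show "G \<xi> = 0 \<and> H \<xi> = 0" if "\<xi> \<notin> box_sq b" using G0 H0 that by blast
  have int: "integrable lborel W" if W: "continuous_on UNIV W" "\<And>\<xi>. \<xi> \<notin> box_sq b \<Longrightarrow> W \<xi> = 0" "\<And>\<xi>. cmod (W \<xi>) \<le> 10 * A" for W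
  proof (rule Bochner_Integration.integrable_bound)
    show "integrable lborel (\<lambda>\<xi>. (10 * A) * indicator (box_sq b) \<xi> :: real)"
      by (intro integrable_mult_right integrable_real_indicator)
         (auto simp: box_sq_eq_cbox emeasure_lborel_cbox_eq)
    show "AE \<xi> in lborel. norm (W \<xi>) \<le> norm ((10 * A) * indicator (box_sq b) \<xi> :: real)"
      using W(2,3) A(2) by (intro AE_I2) (auto simp: indicator_def)
  qed (use W(1) in \<open>simp add: borel_measurable_continuous_onI\<close>)
  have iG: "integrable lborel G" by (rule int[OF cG G0 Gb])
  have iH: "integrable lborel H" by (rule int[OF cH H0 Hb])
  note cf = schwartz_basic(2)[OF s]
  show "ift G z = f\<^sub>b z"
    using fourier_inversion[OF cf _ all_moments_integrable(1)[OF m] iG[unfolded G_def], of "schwartz_seminorm 0 0 0 0 f\<^sub>b" z]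
      seminorm_bound[OF s, of _ 0 0 0 0] by (simp add: G_def mderiv_0_0)
  have "continuous_on UNIV (mulx f\<^sub>b)" unfolding mulx_def[abs_def] by (intro continuous_intros cf)
  then show "ift H z = mulx f\<^sub>b z"
    using fourier_inversion[OF _ _ all_moments_integrable(1)[OF mx] iH[unfolded H_def], of "schwartz_seminorm 1 0 0 0 f\<^sub>b" z]
      seminorm_bound[OF s, of _ 1 0 0 0] by (simp add: H_def mderiv_0_0 mulx_def norm_mult)
  show "cmod (f\<^sub>b z - u z) \<le> \<epsilon> * A" if "z \<in> box_sq 1"
  proof -
    have "ennreal (cmod (f\<^sub>b z - u z)) \<le> Linf_norm (box_sq 1) (\<lambda>z. f\<^sub>b z - u z)"
      using Linf_norm_ge[OF _ box_sq_subset_closure_interior, of 1 "\<lambda>z. f\<^sub>b z - u z" z] that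
      by (simp add: box_sq_eq_cbox[of 1] continuous_on_diff continuous_on_subset[OF cf] u[unfolded box_sq_eq_cbox])
    also have "\<dots> \<le> ennreal \<epsilon> * ennreal A"
      using a unfolding bandlimited_approx_def A(1) by blast
    finally show ?thesis using A(2) \<epsilon> by (simp add: ennreal_mult[symmetric])
  qed
qed

text \<open>Approximations with bandlimit below \<open>c + 1 / (n + 1)\<close> have transforms
  supported in the fixed compact set \<open>box_sq (c + 1)\<close>, where Arzela-Ascoli applies. At
  each point off \<open>box_sq c\<close> the sequence is eventually 0, so the limit lives on
  \<open>box_sq c\<close> itself. Closeness to \<open>u\<close> and boundedness of \<open>G\<close>
  and \<open>H\<close> are what the limit inherits.\<close>

theorem bandlimited_limit:
  assumes u: "continuous_on (box_sq 1) u" and A: "Linf_norm (box_sq 1) u = ennreal A" "0 \<le> A"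
    and \<epsilon>: "0 < \<epsilon>" "\<epsilon> < 1" and c: "c = approx_bandlimit (box_sq 1) u \<epsilon>"
  obtains G H where "bounded_supp G" "bounded_supp H" "continuous_on (box_sq (c + 1)) G"
    "\<And>\<xi>. \<xi> \<notin> box_sq c \<Longrightarrow> G \<xi> = 0" "\<And>\<xi>. \<xi> \<notin> box_sq c \<Longrightarrow> H \<xi> = 0"
    "mulx (ift G) = ift H" "\<And>z. z \<in> box_sq 1 \<Longrightarrow> cmod (ift G z - u z) \<le> \<epsilon> * A" "0 \<le> c"
proof -
  define S where "S = {c. 0 < c \<and> (\<exists>f\<^sub>b. bandlimited_approx (box_sq 1) \<epsilon> u f\<^sub>b \<and> has_bandlimit f\<^sub>b c)}"
  have S: "S \<noteq> {}" using bandlimited_approx_exists[OF u \<epsilon>] by (auto simp: S_def)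
  have cI: "c = Inf S" by (simp add: c approx_bandlimit_def S_def)
  have c0: "0 \<le> c" unfolding cI by (rule cInf_greatest[OF S]) (auto simp: S_def)
  have "\<exists>b f\<^sub>b. b < c + 1 / Suc n \<and> bandlimited_approx (box_sq 1) \<epsilon> u f\<^sub>b \<and> has_bandlimit f\<^sub>b b" for n
    using cInf_lessD[OF S, of "c + 1 / Suc n"] by (auto simp: cI S_def)
  then obtain b f\<^sub>b where b: "\<And>n. b n < c + 1 / Suc n"
    and fb: "\<And>n. bandlimited_approx (box_sq 1) \<epsilon> u (f\<^sub>b n)" "\<And>n. has_bandlimit (f\<^sub>b n) (b n)" by metis
  \<comment> \<open>The transforms of \<open>f\<^sub>b\<close> and of \<open>x f\<^sub>b\<close> are
    paired so that one subsequence serves both.\<close>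
  define GH where "GH n \<xi> = (fourier (f\<^sub>b n) \<xi>, fourier (mulx (f\<^sub>b n)) \<xi>)" for n \<xi>
  note fs = approx_frequency_side[OF fb u A less_imp_le[OF \<epsilon>(1)]]
  have b1: "b n < c + 1" for n using b[of n] by (rule order_less_le_trans) simp
  have GH0: "GH n \<xi> = 0" if "\<xi> \<notin> box_sq (b n)" for n \<xi>
    using fs(5)[OF that] by (simp add: GH_def zero_prod_def)
  have "\<exists>g (k :: nat \<Rightarrow> nat). continuous_on (box_sq (c + 1)) g \<and> strict_mono k \<and>
      (\<forall>e>0. \<exists>N. \<forall>n \<xi>. n \<ge> N \<and> \<xi> \<in> box_sq (c + 1) \<longrightarrow> norm (GH (k n) \<xi> - g \<xi>) < e)"
  proof (rule Arzela_Ascoli[of "box_sq (c + 1)" GH "20 * A"])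
    show "norm (GH n \<xi>) \<le> 20 * A" for n \<xi>
      using norm_Pair_le[of "fourier (f\<^sub>b n) \<xi>" "fourier (mulx (f\<^sub>b n)) \<xi>"] fs(1)[of n \<xi>] fs(2)[of n \<xi>]
      by (simp add: GH_def)
    \<comment> \<open>Each component is Lipschitz with constant \<open>20 A\<close>, hence the pair
      with \<open>40 A\<close>; the added 1 covers \<open>A = 0\<close>.\<close>
    show "\<exists>d>0. \<forall>n \<eta>. \<eta> \<in> box_sq (c + 1) \<and> norm (\<xi> - \<eta>) < d \<longrightarrow> norm (GH n \<xi> - GH n \<eta>) < e" if "0 < e" for \<xi> e
    proof (intro exI[of _ "e / (40 * A + 1)"] conjI allI impI)
      show "0 < e / (40 * A + 1)" using that A(2) by simp
      fix n \<eta> assume "\<eta> \<in> box_sq (c + 1) \<and> norm (\<xi> - \<eta>) < e / (40 * A + 1)"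
      then have "(40 * A + 1) * norm (\<xi> - \<eta>) < e" using A(2) by (simp add: field_simps)
      moreover have "norm (GH n \<xi> - GH n \<eta>) \<le> 40 * A * norm (\<xi> - \<eta>)"
        using norm_Pair_le[of "fourier (f\<^sub>b n) \<xi> - fourier (f\<^sub>b n) \<eta>" "fourier (mulx (f\<^sub>b n)) \<xi> - fourier (mulx (f\<^sub>b n)) \<eta>"]
          fs(3)[of n \<xi> \<eta>] fs(4)[of n \<xi> \<eta>] by (simp add: GH_def)
      ultimately show "norm (GH n \<xi> - GH n \<eta>) < e"
        using norm_ge_zero[of "\<xi> - \<eta>"] unfolding distrib_right by linarith
    qed
  next
    fix g and k :: "nat \<Rightarrow> nat" assume "continuous_on (box_sq (c + 1)) g" "strict_mono k"
      and "\<And>e. 0 < e \<Longrightarrow> \<exists>N. \<forall>n \<xi>. n \<ge> N \<and> \<xi> \<in> box_sq (c + 1) \<longrightarrow> norm (GH (k n) \<xi> - g \<xi>) < e"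
    then show "\<exists>g (k :: nat \<Rightarrow> nat). continuous_on (box_sq (c + 1)) g \<and> strict_mono k \<and>
      (\<forall>e>0. \<exists>N. \<forall>n \<xi>. n \<ge> N \<and> \<xi> \<in> box_sq (c + 1) \<longrightarrow> norm (GH (k n) \<xi> - g \<xi>) < e)"
      by (intro exI[of _ g] exI[of _ k] conjI allI impI) assumption+
  qed (rule compact_box_sq)
  then obtain g and k :: "nat \<Rightarrow> nat" where g: "continuous_on (box_sq (c + 1)) g" and k: "strict_mono k"
    and lim: "\<And>e. 0 < e \<Longrightarrow> \<exists>N. \<forall>n \<xi>. n \<ge> N \<and> \<xi> \<in> box_sq (c + 1) \<longrightarrow> norm (GH (k n) \<xi> - g \<xi>) < e"
    by blast
  define G where "G \<xi> = (if \<xi> \<in> box_sq (c + 1) then fst (g \<xi>) else 0)" for \<xi>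
  define H where "H \<xi> = (if \<xi> \<in> box_sq (c + 1) then snd (g \<xi>) else 0)" for \<xi>
  have conv: "(\<lambda>n. GH (k n) \<xi>) \<longlonglongrightarrow> (G \<xi>, H \<xi>)" for \<xi>
  proof (cases "\<xi> \<in> box_sq (c + 1)")
    case True
    have "(\<lambda>n. GH (k n) \<xi>) \<longlonglongrightarrow> g \<xi>"
      unfolding LIMSEQ_iff using lim True by blast
    then show ?thesis using True by (simp add: G_def H_def)
  next
    case False
    have "\<xi> \<notin> box_sq (b n)" for n
      using False b1[of n] by (cases \<xi>) (auto simp: box_sq_def)
    then show ?thesis using False GH0 by (simp add: G_def H_def zero_prod_def)
  qed
  have off: "G \<xi> = 0 \<and> H \<xi> = 0" if "\<xi> \<notin> box_sq c" for \<xi>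
  proof -
    \<comment> \<open>A point off \<open>box_sq c\<close> lies outside the supporting squares as
      soon as \<open>1 / (k n + 1)\<close> is below \<open>m - c\<close>.\<close>
    define m where "m = max \<bar>fst \<xi>\<bar> \<bar>snd \<xi>\<bar>"
    have m: "c < m" using that by (cases \<xi>) (auto simp: box_sq_def m_def)
    have "(\<lambda>n. c + 1 / real (Suc (k n))) \<longlonglongrightarrow> c + 0"
      by (intro tendsto_add tendsto_const) (use LIMSEQ_subseq_LIMSEQ[OF LIMSEQ_inverse_real_of_nat k] in \<open>simp add: o_def inverse_eq_divide\<close>)
    then have "\<forall>\<^sub>F n in sequentially. c + 1 / real (Suc (k n)) < m"
      using m by (intro order_tendstoD(2)) auto
    then have "\<forall>\<^sub>F n in sequentially. GH (k n) \<xi> = 0"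
    proof eventually_elim
      case (elim n)
      then have "b (k n) < m" using b[of "k n"] by linarith
      then have "\<xi> \<notin> box_sq (b (k n))" by (cases \<xi>) (auto simp: box_sq_def m_def)
      then show ?case by (rule GH0)
    qed
    then have "(\<lambda>n. GH (k n) \<xi>) \<longlonglongrightarrow> 0" by (rule tendsto_eventually)
    from LIMSEQ_unique[OF this conv] show ?thesis by (simp add: zero_prod_def)
  qed
  have convG: "(\<lambda>n. fourier (f\<^sub>b (k n)) \<xi>) \<longlonglongrightarrow> G \<xi>" and convH: "(\<lambda>n. fourier (mulx (f\<^sub>b (k n))) \<xi>) \<longlonglongrightarrow> H \<xi>" for \<xi>
    using tendsto_fst[OF conv[of \<xi>]] tendsto_snd[OF conv[of \<xi>]] by (simp_all add: GH_def)
  \<comment> \<open>Used for \<open>G\<close> and for \<open>H\<close>: a pointwise limit is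
    measurable, and domination by a constant on the square makes the inverse transforms
    converge.\<close>
  have bs: "bounded_supp W \<and> (\<forall>z. (\<lambda>n. ift (Wn n) z) \<longlonglongrightarrow> ift W z)"
    if W: "\<And>\<xi>. (\<lambda>n. Wn n \<xi>) \<longlonglongrightarrow> W \<xi>" "\<And>n \<xi>. cmod (Wn n \<xi>) \<le> 10 * A" "\<And>n. continuous_on UNIV (Wn n)"
      "\<And>\<xi>. \<xi> \<notin> box_sq (c + 1) \<Longrightarrow> W \<xi> = 0" "\<And>n \<xi>. \<xi> \<notin> box_sq (c + 1) \<Longrightarrow> Wn n \<xi> = 0" for W Wn
  proof -
    have m: "Wn n \<in> borel_measurable borel" for n using W(3) by (rule borel_measurable_continuous_onI)
    then have mW: "W \<in> borel_measurable borel" by (rule borel_measurable_LIMSEQ_metric) (rule W(1))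
    have b: "cmod (W \<xi>) \<le> 10 * A" for \<xi>
      by (rule LIMSEQ_le_const2[OF tendsto_norm[OF W(1)]]) (use W(2) in blast)
    have "\<xi> \<notin> box_sq (c + 1)" if "2 * (c + 1) < norm \<xi>" for \<xi>
      using norm_le_l1[of \<xi>] that by (cases \<xi>) (auto simp: box_sq_def Basis_prod_def inner_prod_def)
    then have s: "bounded_supp W" unfolding bounded_supp_def using mW b W(4) by blast
    have "(\<lambda>n. ift (Wn n) z) \<longlonglongrightarrow> ift W z" for z
      unfolding ift_def
    proof (rule integral_dominated_convergence)
      show "integrable lborel (\<lambda>\<xi>. (10 * A) * indicator (box_sq (c + 1)) \<xi> :: real)"
        by (intro integrable_mult_right integrable_real_indicator)
           (auto simp: box_sq_eq_cbox emeasure_lborel_cbox_eq)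
      show "AE \<xi> in lborel. (\<lambda>n. Wn n \<xi> * cis (\<xi> \<bullet> z)) \<longlonglongrightarrow> W \<xi> * cis (\<xi> \<bullet> z)"
        by (intro AE_I2 tendsto_intros W(1))
      show "AE \<xi> in lborel. norm (Wn n \<xi> * cis (\<xi> \<bullet> z)) \<le> (10 * A) * indicator (box_sq (c + 1)) \<xi>" for n
        using W(2,5) by (intro AE_I2) (auto simp: norm_mult indicator_def)
    qed (use m mW in simp_all)
    with s show ?thesis by blast
  qed
  have out: "\<xi> \<notin> box_sq (b n)" if "\<xi> \<notin> box_sq (c + 1)" for \<xi> n
    using that b1[of n] by (cases \<xi>) (auto simp: box_sq_def)
  have BG: "bounded_supp G \<and> (\<forall>z. (\<lambda>n. ift (fourier (f\<^sub>b (k n))) z) \<longlonglongrightarrow> ift G z)"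
    by (rule bs[OF convG fs(1) fs(9)]) (use fs(5)[OF out] in \<open>auto simp: G_def\<close>)
  have BH: "bounded_supp H \<and> (\<forall>z. (\<lambda>n. ift (fourier (mulx (f\<^sub>b (k n)))) z) \<longlonglongrightarrow> ift H z)"
    by (rule bs[OF convH fs(2) fs(10)]) (use fs(5)[OF out] in \<open>auto simp: H_def\<close>)
  have l1: "(\<lambda>n. f\<^sub>b (k n) z) \<longlonglongrightarrow> ift G z" and l2: "(\<lambda>n. mulx (f\<^sub>b (k n)) z) \<longlonglongrightarrow> ift H z" for z
    using BG BH fs(6,7) by simp_all
  show thesis
  proof
    show "bounded_supp G" "bounded_supp H" using BG BH by blast+
    show "continuous_on (box_sq (c + 1)) G"
      by (rule continuous_on_eq[OF continuous_on_fst[OF g]]) (simp add: G_def)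
    show "mulx (ift G) = ift H"
    proof
      fix z
      have "(\<lambda>n. mulx (f\<^sub>b (k n)) z) \<longlonglongrightarrow> mulx (ift G) z"
        unfolding mulx_def by (intro tendsto_intros l1)
      then show "mulx (ift G) z = ift H z" using l2 by (rule LIMSEQ_unique)
    qed
    show "cmod (ift G z - u z) \<le> \<epsilon> * A" if "z \<in> box_sq 1" for z
      by (rule LIMSEQ_le_const2[OF tendsto_norm[OF tendsto_diff[OF l1 tendsto_const]]]) (use fs(8)[OF that] in blast)
  qed (use off c0 in auto)
qed

section \<open>Entire functions of two variables\<close>

text \<open>Continuity of the two coefficients is included so that integrals over a parameter can be
  differentiated and stay in the class.\<close>

definition C1_holo :: "(complex \<times> complex \<Rightarrow> complex) \<Rightarrow> bool" where
  "C1_holo P \<longleftrightarrow> (\<exists>A B. continuous_on UNIV A \<and> continuous_on UNIV B \<and>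
     (\<forall>w. (P has_derivative (\<lambda>h. A w * fst h + B w * snd h)) (at w)))"

lemma C1_holoE:
  assumes "C1_holo P"
  obtains A B where "continuous_on UNIV A" "continuous_on UNIV B"
    "\<And>w. (P has_derivative (\<lambda>h. A w * fst h + B w * snd h)) (at w)"
  using assms unfolding C1_holo_def by blast

lemma C1_holo_continuous: "C1_holo P \<Longrightarrow> continuous_on UNIV P"
  unfolding C1_holo_def by (meson continuous_at_imp_continuous_on has_derivative_continuous)

lemma C1_holo_const: "C1_holo (\<lambda>w. c)"
  unfolding C1_holo_def by (intro exI[of _ "\<lambda>_. 0"]) auto

lemma C1_holo_add:
  assumes "C1_holo P" "C1_holo Q"
  shows "C1_holo (\<lambda>w. P w + Q w)"
proof -
  obtain A B where AB: "continuous_on UNIV A" "continuous_on UNIV B"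
    and dP: "\<And>w. (P has_derivative (\<lambda>h. A w * fst h + B w * snd h)) (at w)"
    by (rule C1_holoE[OF assms(1)]) blast
  obtain C D where CD: "continuous_on UNIV C" "continuous_on UNIV D"
    and dQ: "\<And>w. (Q has_derivative (\<lambda>h. C w * fst h + D w * snd h)) (at w)"
    by (rule C1_holoE[OF assms(2)]) blast
  have "((\<lambda>w. P w + Q w) has_derivative (\<lambda>h. (A w + C w) * fst h + (B w + D w) * snd h)) (at w)" for w
    using has_derivative_add[OF dP dQ, of w] by (simp add: algebra_simps)
  moreover have "continuous_on UNIV (\<lambda>w. A w + C w)" "continuous_on UNIV (\<lambda>w. B w + D w)"
    by (intro continuous_intros AB CD)+
  ultimately show ?thesis unfolding C1_holo_def
    by (intro exI[of _ "\<lambda>w. A w + C w"] exI[of _ "\<lambda>w. B w + D w"] conjI allI)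
qed

lemma C1_holo_mult:
  assumes "C1_holo P" "C1_holo Q"
  shows "C1_holo (\<lambda>w. P w * Q w)"
proof -
  note cP = C1_holo_continuous[OF assms(1)] and cQ = C1_holo_continuous[OF assms(2)]
  obtain A B where AB: "continuous_on UNIV A" "continuous_on UNIV B"
    and dP: "\<And>w. (P has_derivative (\<lambda>h. A w * fst h + B w * snd h)) (at w)"
    by (rule C1_holoE[OF assms(1)]) blast
  obtain C D where CD: "continuous_on UNIV C" "continuous_on UNIV D"
    and dQ: "\<And>w. (Q has_derivative (\<lambda>h. C w * fst h + D w * snd h)) (at w)"
    by (rule C1_holoE[OF assms(2)]) blast
  have "((\<lambda>w. P w * Q w) has_derivative (\<lambda>h. (P w * C w + A w * Q w) * fst h + (P w * D w + B w * Q w) * snd h)) (at w)" for w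
    using has_derivative_mult[OF dP dQ, of w] by (simp add: algebra_simps)
  moreover have "continuous_on UNIV (\<lambda>w. P w * C w + A w * Q w)" "continuous_on UNIV (\<lambda>w. P w * D w + B w * Q w)"
    by (intro continuous_intros AB CD cP cQ)+
  ultimately show ?thesis unfolding C1_holo_def
    by (intro exI[of _ "\<lambda>w. P w * C w + A w * Q w"] exI[of _ "\<lambda>w. P w * D w + B w * Q w"] conjI allI)
qed

text \<open>The derivative packaged as a bounded linear map, so that it can itself be integrated
  over the parameter.\<close>

definition lin2 :: "complex \<Rightarrow> complex \<Rightarrow> (complex \<times> complex) \<Rightarrow>\<^sub>L complex" where
  "lin2 a b = (blinfun_mult_right a o\<^sub>L fst_blinfun) + (blinfun_mult_right b o\<^sub>L snd_blinfun)"

lemma lin2_apply: "blinfun_apply (lin2 a b) h = a * fst h + b * snd h"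
  by (simp add: lin2_def blinfun.add_left)

lemma continuous_on_lin2:
  assumes "continuous_on S a" "continuous_on S b"
  shows "continuous_on S (\<lambda>x. lin2 (a x) (b x))"
  unfolding lin2_def
  by (intro continuous_on_add bounded_bilinear.continuous_on[OF bounded_bilinear_blinfun_compose] continuous_on_const
      bounded_linear.continuous_on[OF bounded_linear_blinfun_mult_right] assms)

text \<open>The Leibniz rule, read off in coefficients: integrating the derivative integrates its
  two coefficients, so complex linearity is preserved.\<close>

lemma has_derivative_integral2:
  fixes \<Phi> A B :: "complex \<times> complex \<Rightarrow> 'b::euclidean_space \<Rightarrow> complex"
  assumes d: "\<And>w t. t \<in> cbox a b \<Longrightarrow> ((\<lambda>w. \<Phi> w t) has_derivative (\<lambda>h. A w t * fst h + B w t * snd h)) (at w)"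
    and c: "continuous_on (UNIV \<times> cbox a b) (\<lambda>(w, t). \<Phi> w t)"
    and cA: "continuous_on (UNIV \<times> cbox a b) (\<lambda>(w, t). A w t)"
    and cB: "continuous_on (UNIV \<times> cbox a b) (\<lambda>(w, t). B w t)"
  shows "((\<lambda>w. integral (cbox a b) (\<Phi> w)) has_derivative
      (\<lambda>h. integral (cbox a b) (A w) * fst h + integral (cbox a b) (B w) * snd h)) (at w)"
    "continuous_on UNIV (\<lambda>w. integral (cbox a b) (A w))" "continuous_on UNIV (\<lambda>w. integral (cbox a b) (B w))"
proof -
  have cont: "continuous_on (cbox a b) (C w)" if "continuous_on (UNIV \<times> cbox a b) (\<lambda>(w, t). C w t)" for C :: "complex \<times> complex \<Rightarrow> 'b \<Rightarrow> complex" and w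
    using continuous_on_compose2[OF that continuous_on_Pair[OF continuous_on_const continuous_on_id], of w "cbox a b"]
    by auto
  have i: "A w integrable_on cbox a b" "B w integrable_on cbox a b" for w
    by (intro integrable_continuous cont cA cB)+
  have cl: "continuous_on (UNIV \<times> cbox a b) (\<lambda>(w, t). lin2 (A w t) (B w t))"
    using continuous_on_lin2[OF cA[unfolded case_prod_beta'] cB[unfolded case_prod_beta']] by (simp add: case_prod_beta')
  have D: "((\<lambda>w. integral (cbox a b) (\<Phi> w)) has_derivative integral (cbox a b) (\<lambda>t. lin2 (A w t) (B w t))) (at w within UNIV)"
  proof (rule leibniz_rule)
    show "((\<lambda>w. \<Phi> w t) has_derivative blinfun_apply (lin2 (A w t) (B w t))) (at w within UNIV)" if "t \<in> cbox a b" for w t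
      using d[OF that, of w] by (simp add: lin2_apply[abs_def])
    show "\<Phi> w integrable_on cbox a b" for w by (intro integrable_continuous cont c)
  qed (use cl in auto)
  have E: "blinfun_apply (integral (cbox a b) (\<lambda>t. lin2 (A w t) (B w t))) h
      = integral (cbox a b) (A w) * fst h + integral (cbox a b) (B w) * snd h" for h
  proof -
    have "continuous_on (cbox a b) (\<lambda>t. lin2 (A w t) (B w t))" by (intro continuous_on_lin2 cont cA cB)
    then have "(\<lambda>t. lin2 (A w t) (B w t)) integrable_on cbox a b" by (rule integrable_continuous)
    from integral_linear[OF this blinfun.bounded_linear_left[of h]]
    have "blinfun_apply (integral (cbox a b) (\<lambda>t. lin2 (A w t) (B w t))) h = integral (cbox a b) (\<lambda>t. A w t * fst h + B w t * snd h)"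
      by (simp add: o_def lin2_apply)
    also have "\<dots> = integral (cbox a b) (A w) * fst h + integral (cbox a b) (B w) * snd h"
      using i by (simp add: integral_add integrable_on_mult_left)
    finally show ?thesis .
  qed
  show "((\<lambda>w. integral (cbox a b) (\<Phi> w)) has_derivative
      (\<lambda>h. integral (cbox a b) (A w) * fst h + integral (cbox a b) (B w) * snd h)) (at w)"
    using has_derivative_eq_rhs[OF D ext[OF E]] by simp
  show "continuous_on UNIV (\<lambda>w. integral (cbox a b) (A w))" "continuous_on UNIV (\<lambda>w. integral (cbox a b) (B w))"
    by (intro integral_continuous_on_param cA cB)+
qed

text \<open>The easy half of Paley-Wiener: over a compact set of frequencies the exponentials extend
  to complex arguments and the integral can be differentiated there.\<close>

lemma C1_holo_exp_integral:
  assumes G: "continuous_on (cbox a b) G"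
  shows "C1_holo (\<lambda>w. integral (cbox a b) (\<lambda>t::plane. G t * exp (\<i> * (of_real (fst t) * fst w + of_real (snd t) * snd w))))"
proof -
  let ?E = "\<lambda>w (t::plane). exp (\<i> * (of_real (fst t) * fst w + of_real (snd t) * snd w))"
  have cG: "continuous_on (UNIV \<times> cbox a b) (\<lambda>p. G (snd p))"
    by (rule continuous_on_compose2[OF G]) (auto intro!: continuous_intros)
  have d: "((\<lambda>w. G t * ?E w t) has_derivative
      (\<lambda>h. (G t * ?E w t * (\<i> * of_real (fst t))) * fst h + (G t * ?E w t * (\<i> * of_real (snd t))) * snd h)) (at w)" for w t
  proof -
    have "((\<lambda>w. \<i> * (of_real (fst t) * fst w + of_real (snd t) * snd w)) has_derivative
        (\<lambda>h. \<i> * (of_real (fst t) * fst h + of_real (snd t) * snd h))) (at w)"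
      by (intro derivative_intros)
    from has_derivative_mult_right[OF has_derivative_compose[OF this DERIV_exp[unfolded has_field_derivative_def]], of "G t"]
    show ?thesis by (simp add: algebra_simps)
  qed
  have c: "continuous_on (UNIV \<times> cbox a b) (\<lambda>(w, t). G t * ?E w t)"
    "continuous_on (UNIV \<times> cbox a b) (\<lambda>(w, t). G t * ?E w t * (\<i> * of_real (fst t)))"
    "continuous_on (UNIV \<times> cbox a b) (\<lambda>(w, t). G t * ?E w t * (\<i> * of_real (snd t)))"
    unfolding case_prod_beta' by (intro continuous_intros cG)+
  show ?thesis
    unfolding C1_holo_def using has_derivative_integral2[OF d c] by blast
qed

section \<open>Antiderivatives in the first variable\<close>

text \<open>Writing the integral from 0 to x as x times an average handles negative x without
  orientation, makes sense for complex x, and splits off the factor x that a multiplier can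
  absorb.\<close>

definition antideriv :: "(plane \<Rightarrow> complex) \<Rightarrow> plane \<Rightarrow> complex" where
  "antideriv F z = of_real (fst z) * (LINT s|lborel. indicator {0..1} s *\<^sub>R F (s * fst z, snd z))"

lemma unit_interval_integral:
  fixes f :: "real \<Rightarrow> complex"
  assumes "continuous_on {0..1} f"
  shows "integrable lborel (\<lambda>s. indicator {0..1} s *\<^sub>R f s)"
    "(LINT s|lborel. indicator {0..1} s *\<^sub>R f s) = integral {0..1} f"
proof -
  show i: "integrable lborel (\<lambda>s. indicator {0..1} s *\<^sub>R f s)"
    using borel_integrable_compact[OF compact_Icc assms] by simp
  show "(LINT s|lborel. indicator {0..1} s *\<^sub>R f s) = integral {0..1} f"
    using set_borel_integral_eq_integral(2)[of "{0..1}" f] i by (simp add: set_integrable_def set_lebesgue_integral_def)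
qed

definition extends :: "(complex \<times> complex \<Rightarrow> complex) \<Rightarrow> (plane \<Rightarrow> complex) \<Rightarrow> bool" where
  "extends P F \<longleftrightarrow> C1_holo P \<and> (\<forall>x y. F (x, y) = P (of_real x, of_real y))"

lemma extends_continuous: "extends P F \<Longrightarrow> continuous_on UNIV F"
proof -
  assume e: "extends P F"
  then have "F = (\<lambda>z. P (of_real (fst z), of_real (snd z)))" by (auto simp: extends_def)
  then show ?thesis
    using e by (auto simp: extends_def intro!: continuous_on_compose2[OF C1_holo_continuous] continuous_intros)
qed

lemma entire_function_extends: "extends P F \<Longrightarrow> entire_function F"
  unfolding extends_def entire_function_def C1_holo_def case_prod_beta' by metis

text \<open>Both \<open>\<partial>/\<partial>z\<close> of \<open>z \<integral>\<^sub>0\<^sup>1 P (s z, w) ds\<close> and \<open>P (z, w)\<close> equal \<open>\<integral>\<^sub>0\<^sup>1 d/ds (s P (s z, w)) ds\<close>.\<close>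

lemma antideriv_extends:
  assumes e: "extends P F"
  shows "extends (\<lambda>w. fst w * integral {0..1} (\<lambda>s. P (of_real s * fst w, snd w))) (antideriv F)"
    and "D\<^sub>x (antideriv F) = F"
proof -
  have P: "C1_holo P" and FP: "\<And>x y. F (x, y) = P (of_real x, of_real y)" using e by (auto simp: extends_def)
  obtain A B where c: "continuous_on UNIV A" "continuous_on UNIV B"
    and d: "\<And>w. (P has_derivative (\<lambda>h. A w * fst h + B w * snd h)) (at w)"
    by (rule C1_holoE[OF P]) blast
  let ?m = "\<lambda>w (s::real). (of_real s * fst w, snd w)"
  let ?J = "\<lambda>w. integral (cbox 0 1) (\<lambda>s. P (?m w s))"
  let ?A = "\<lambda>w. integral (cbox 0 1) (\<lambda>s. A (?m w s) * of_real s)"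
  let ?B = "\<lambda>w. integral (cbox 0 1) (\<lambda>s. B (?m w s))"
  have cm: "continuous_on (UNIV \<times> cbox 0 1) (\<lambda>p. C (of_real (snd p) * fst (fst p), snd (fst p)))" if "continuous_on UNIV C" for C :: "complex \<times> complex \<Rightarrow> complex"
    by (rule continuous_on_compose2[OF that]) (auto intro!: continuous_intros)
  have dm: "((\<lambda>w. P (?m w s)) has_derivative (\<lambda>h. (A (?m w s) * of_real s) * fst h + B (?m w s) * snd h)) (at w)" for w s
  proof -
    have "((\<lambda>w. ?m w s) has_derivative (\<lambda>h. (of_real s * fst h, snd h))) (at w)"
      by (intro derivative_intros)
    from has_derivative_compose[OF this d] show ?thesis by (simp add: mult.assoc)
  qed
  have c': "continuous_on (UNIV \<times> cbox 0 1) (\<lambda>(w, s). P (?m w s))"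
    "continuous_on (UNIV \<times> cbox 0 1) (\<lambda>(w, s). A (?m w s) * of_real s)"
    "continuous_on (UNIV \<times> cbox 0 1) (\<lambda>(w, s). B (?m w s))"
    unfolding case_prod_beta' by (intro continuous_intros cm c C1_holo_continuous[OF P])+
  note L = has_derivative_integral2[OF dm c']
  have key: "?J w + fst w * ?A w = P w" for w
  proof -
    have "((\<lambda>s. P (?m w s) + of_real s * (A (?m w s) * fst w)) has_integral (of_real 1 * P (?m w 1) - of_real 0 * P (?m w 0))) {0..1}"
    proof (rule fundamental_theorem_of_calculus)
      fix s :: real
      have "((\<lambda>s. ?m w s) has_derivative (\<lambda>h. (of_real h * fst w, 0))) (at s)"
        by (intro derivative_intros)
      from has_derivative_compose[OF this d]
      have "((\<lambda>s. P (?m w s)) has_vector_derivative A (?m w s) * fst w) (at s)"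
        by (simp add: has_vector_derivative_def scaleR_conv_of_real mult_ac)
      moreover have "((\<lambda>s. complex_of_real s) has_vector_derivative 1) (at s)"
        by (auto simp: has_vector_derivative_def scaleR_conv_of_real intro!: derivative_eq_intros)
      ultimately have "((\<lambda>s. of_real s * P (?m w s)) has_vector_derivative (of_real s * (A (?m w s) * fst w) + 1 * P (?m w s))) (at s)"
        by (intro has_vector_derivative_mult)
      then show "((\<lambda>s. of_real s * P (?m w s)) has_vector_derivative (P (?m w s) + of_real s * (A (?m w s) * fst w))) (at s within {0..1})"
        by (simp add: has_vector_derivative_at_within add.commute)
    qed simp
    then have "integral (cbox 0 1) (\<lambda>s. P (?m w s) + fst w * (A (?m w s) * of_real s)) = P w"
      by (intro integral_unique) (simp add: mult_ac)
    moreover have "(\<lambda>s. P (?m w s)) integrable_on cbox 0 1" "(\<lambda>s. A (?m w s) * of_real s) integrable_on cbox 0 1"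
      by (intro integrable_continuous continuous_intros continuous_on_compose2[OF C1_holo_continuous[OF P]] continuous_on_compose2[OF c(1)]; auto)+
    ultimately show ?thesis by (simp add: integral_add integrable_on_mult_right)
  qed
  have D: "((\<lambda>w. fst w * ?J w) has_derivative (\<lambda>h. P w * fst h + (fst w * ?B w) * snd h)) (at w)" for w
  proof -
    have "((\<lambda>w. fst w * ?J w) has_derivative (\<lambda>h. fst w * (?A w * fst h + ?B w * snd h) + fst h * ?J w)) (at w)"
      by (intro has_derivative_mult L(1) derivative_intros)
    moreover have "fst w * (?A w * fst h + ?B w * snd h) + fst h * ?J w = P w * fst h + (fst w * ?B w) * snd h" for h
      unfolding key[of w, symmetric] by (simp add: algebra_simps)
    ultimately show ?thesis by simp
  qed
  have eq: "antideriv F (x, y) = of_real x * ?J (of_real x, of_real y)" for x y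
  proof -
    have "continuous_on {0..1} (\<lambda>s. F (s * x, y))"
      by (rule continuous_on_compose2[OF extends_continuous[OF e]]) (auto intro!: continuous_intros)
    from unit_interval_integral(2)[OF this] show ?thesis by (simp add: antideriv_def FP)
  qed
  have "continuous_on UNIV (\<lambda>w. fst w * ?B w)" by (intro continuous_intros L(3))
  then have "C1_holo (\<lambda>w. fst w * ?J w)"
    unfolding C1_holo_def using D C1_holo_continuous[OF P] by blast
  then show "extends (\<lambda>w. fst w * integral {0..1} (\<lambda>s. P (of_real s * fst w, snd w))) (antideriv F)"
    using eq by (simp add: extends_def)
  show "D\<^sub>x (antideriv F) = F"
  proof
    fix z :: plane
    let ?i = "\<lambda>z::plane. (complex_of_real (fst z), complex_of_real (snd z))"
    have "antideriv F = (\<lambda>z. fst (?i z) * ?J (?i z))" using eq by auto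
    moreover have "((\<lambda>z. fst (?i z) * ?J (?i z)) has_derivative
       (\<lambda>h. P (?i z) * fst (?i h) + (fst (?i z) * ?B (?i z)) * snd (?i h))) (at z)"
      by (rule has_derivative_compose[OF _ D]) (intro derivative_intros)
    ultimately have "(antideriv F has_derivative (\<lambda>h. P (?i z) * fst (?i h) + (fst (?i z) * ?B (?i z)) * snd (?i h))) (at z)" by simp
    from partial_x_eq[OF this] show "D\<^sub>x (antideriv F) z = F z"
      using FP[of "fst z" "snd z"] by simp
  qed
qed

section \<open>Functions with bounded spectrum\<close>

text \<open>The spectral bound says that the Fourier transform of \<open>F\<close> is a measure of mass at most \<open>M\<close>
  supported in \<open>box_sq c\<close>.\<close>

definition spectral_bound :: "real \<Rightarrow> real \<Rightarrow> (plane \<Rightarrow> complex) \<Rightarrow> bool" where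
  "spectral_bound c M F \<longleftrightarrow> 0 \<le> M \<and> (\<forall>\<phi> S. test_fun \<phi> \<longrightarrow> (\<forall>z\<in>box_sq c. cmod (\<phi> z) \<le> S) \<longrightarrow>
     cmod (LINT z|lborel. F z * fourier \<phi> z) \<le> M * S)"

text \<open>A bound on the whole plane is demanded besides the spectral one because it justifies
  interchanging the average over dilations with the pairing. \<open>antideriv F\<close> may grow
  linearly, so only its product with a suitable multiplier returns to this class.\<close>

definition band_fun :: "real \<Rightarrow> (plane \<Rightarrow> complex) \<Rightarrow> bool" where
  "band_fun c F \<longleftrightarrow> (\<exists>P. extends P F) \<and> (\<exists>B. \<forall>z. cmod (F z) \<le> B) \<and> (\<exists>M. spectral_bound c M F)"

lemma integrable_bounded_mult:
  fixes F \<psi> :: "plane \<Rightarrow> complex"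
  assumes F: "F \<in> borel_measurable borel" "\<And>z. cmod (F z) \<le> B" and \<psi>: "integrable lborel \<psi>"
  shows "integrable lborel (\<lambda>z. F z * \<psi> z)"
proof (rule Bochner_Integration.integrable_bound)
  show "integrable lborel (\<lambda>z. B * cmod (\<psi> z))" using \<psi> by simp
  have "0 \<le> B" using order_trans[OF norm_ge_zero F(2)] .
  then show "AE z in lborel. norm (F z * \<psi> z) \<le> norm (B * cmod (\<psi> z))"
    by (intro AE_I2) (simp add: norm_mult mult_right_mono F(2))
qed (use F(1) borel_measurable_integrable[OF \<psi>] in simp)

lemma ift_duality:
  assumes G: "integrable lborel G" and \<psi>: "integrable lborel \<psi>"
  shows "(LINT z|lborel. ift G z * \<psi> z) = (LINT w|lborel. G w * ift \<psi> w)"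
proof -
  define k where "k = (\<lambda>(z, w). G w * cis (w \<bullet> z) * \<psi> z)"
  have "integrable (lborel \<Otimes>\<^sub>M lborel) k"
  proof (rule integrable_prod_bound[OF \<psi> G])
    have [measurable]: "G \<in> borel_measurable borel" "\<psi> \<in> borel_measurable borel"
      using G \<psi> by (auto dest: borel_measurable_integrable)
    have "(\<lambda>p::plane \<times> plane. G (snd p)) \<in> borel_measurable borel" "(\<lambda>p::plane \<times> plane. \<psi> (fst p)) \<in> borel_measurable borel"
      by (rule measurable_compose[of _ _ borel], intro borel_measurable_continuous_onI continuous_intros, simp)+
    moreover have "(\<lambda>p::plane \<times> plane. cis (snd p \<bullet> fst p)) \<in> borel_measurable borel"
      by (intro borel_measurable_continuous_onI continuous_intros)
    ultimately show "k \<in> borel_measurable borel" unfolding k_def case_prod_beta' by simp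
  qed (simp add: k_def norm_mult)
  then have "(LINT w|lborel. LINT z|lborel. k (z, w)) = (LINT z|lborel. LINT w|lborel. k (z, w))"
    by (intro lborel_pair.Fubini_integral) simp
  moreover have "(LINT w|lborel. k (z, w)) = ift G z * \<psi> z" for z
    unfolding ift_def integral_mult_left_zero[symmetric] k_def by simp
  moreover have "(LINT z|lborel. k (z, w)) = G w * ift \<psi> w" for w
    unfolding ift_def integral_mult_right_zero[symmetric] k_def by (simp add: mult_ac inner_commute)
  ultimately show ?thesis by simp
qed

lemma norm_integral_le:
  fixes f :: "'a \<Rightarrow> complex"
  assumes "integrable M g" "\<And>x. cmod (f x) \<le> g x"
  shows "cmod (integral\<^sup>L M f) \<le> integral\<^sup>L M g"
proof -
  have "cmod (integral\<^sup>L M f) \<le> (LINT x|M. cmod (f x))" by (rule integral_norm_bound)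
  also have "\<dots> \<le> integral\<^sup>L M g"
    by (rule integral_mono'[OF assms(1)]) (use assms(2) order_trans[OF norm_ge_zero assms(2)] in auto)
  finally show ?thesis .
qed

text \<open>By duality and inversion the pairing is the integral of \<open>G * \<phi>\<close>: the
  measure has density \<open>G\<close>.\<close>

lemma spectral_bound_ift:
  assumes G: "integrable lborel G" "\<And>\<xi>. \<xi> \<notin> box_sq c \<Longrightarrow> G \<xi> = 0"
  shows "spectral_bound c (LINT w|lborel. cmod (G w)) (ift G)"
  unfolding spectral_bound_def
proof (intro conjI allI impI)
  fix \<phi> S assume t: "test_fun \<phi>" and S: "\<forall>z\<in>box_sq c. cmod (\<phi> z) \<le> S"
  have "(LINT z|lborel. ift G z * fourier \<phi> z) = (LINT w|lborel. G w * \<phi> w)"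
    using ift_duality[OF G(1), of "fourier \<phi>"] t test_fun_inversion[OF t] by (simp add: test_fun_def)
  also have "cmod \<dots> \<le> (LINT w|lborel. cmod (G w) * S)"
  proof (rule norm_integral_le)
    show "cmod (G w * \<phi> w) \<le> cmod (G w) * S" for w
      using S G(2)[of w] by (cases "w \<in> box_sq c") (auto simp: norm_mult intro: mult_left_mono)
  qed (use G in simp)
  finally show "cmod (LINT z|lborel. ift G z * fourier \<phi> z) \<le> (LINT w|lborel. cmod (G w)) * S" by simp
qed (simp add: integral_nonneg_AE)

text \<open>Substitution moves the dilation to the test function. Its Jacobian \<open>s\<close>
  cancels against the factor \<open>1 / s\<close> of \<open>fourier_scale_x\<close>, so the mass
  \<open>M\<close> is the same for all \<open>s\<close>.\<close>

lemma spectral_bound_scaled: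
  assumes F: "spectral_bound c M F" "continuous_on UNIV F" and t: "test_fun \<phi>" and s: "0 < s"
    and S: "\<And>z. z \<in> box_sq c \<Longrightarrow> cmod (\<phi> (s * fst z, snd z)) \<le> S"
  shows "cmod (LINT z|lborel. F (s * fst z, snd z) * fourier \<phi> z) \<le> M * S"
proof -
  define \<psi> where "\<psi> z = F z * fourier \<phi> (fst z / s, snd z)" for z
  have "integrable lborel (\<lambda>z. fourier \<phi> (0 + (1 / s) * fst z, 0 + 1 * snd z))"
    by (rule integrable_plane_affine) (use s t in \<open>auto simp: test_fun_def\<close>)
  from borel_measurable_integrable[OF this] have "\<psi> \<in> borel_measurable borel"
    unfolding \<psi>_def[abs_def] using borel_measurable_continuous_onI[OF F(2)] by simp
  from integral_plane_affine[OF _ _ this, of s 1 0 0]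
  have "(LINT z|lborel. \<psi> z) = of_real s * (LINT z|lborel. F (s * fst z, snd z) * fourier \<phi> z)"
    using s by (simp add: \<psi>_def scaleR_conv_of_real)
  then have "(LINT z|lborel. F (s * fst z, snd z) * fourier \<phi> z) = of_real (1 / s) * (LINT z|lborel. \<psi> z)"
    using s by simp
  also have "\<dots> = (LINT z|lborel. F z * fourier (\<lambda>z. \<phi> (s * fst z, snd z)) z)"
    unfolding fourier_scale_x(1)[OF t s] \<psi>_def integral_mult_right_zero[symmetric] by (simp add: mult_ac)
  also have "cmod \<dots> \<le> M * S"
  proof -
    have "\<forall>z\<in>box_sq c. cmod (\<phi> (s * fst z, snd z)) \<le> S" using S by blast
    with F(1) fourier_scale_x(2)[OF t s] show ?thesis unfolding spectral_bound_def by simp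
  qed
  finally show ?thesis .
qed

text \<open>The bound on \<open>F\<close> justifies Fubini, and an estimate uniform in
  \<open>s\<close> passes to the average over the unit interval.\<close>

lemma average_bound:
  fixes F \<psi> :: "plane \<Rightarrow> complex"
  assumes F: "continuous_on UNIV F" "\<And>z. cmod (F z) \<le> B" and \<psi>: "integrable lborel \<psi>"
    and K: "\<And>s. 0 < s \<Longrightarrow> s \<le> 1 \<Longrightarrow> cmod (LINT z|lborel. F (s * fst z, snd z) * \<psi> z) \<le> K"
  shows "cmod (LINT z|lborel. (LINT s|lborel. indicator {0..1} s *\<^sub>R F (s * fst z, snd z)) * \<psi> z) \<le> K"
proof -
  define k where "k = (\<lambda>(s::real, z::plane). (indicator {0..1} s *\<^sub>R F (s * fst z, snd z)) * \<psi> z)"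
  have i: "integrable lborel (\<lambda>s::real. B * indicator {0..1} s :: real)"
    by (intro integrable_mult_right integrable_real_indicator) auto
  have "integrable (lborel \<Otimes>\<^sub>M lborel) k"
  proof (rule integrable_prod_bound[OF i \<psi>])
    have [measurable]: "\<psi> \<in> borel_measurable borel" using \<psi> by (auto dest: borel_measurable_integrable)
    have "(\<lambda>p::real \<times> plane. \<psi> (snd p)) \<in> borel_measurable borel" "(\<lambda>p::real \<times> plane. indicator {0..1} (fst p) :: real) \<in> borel_measurable borel"
      by (rule measurable_compose[of _ _ borel], intro borel_measurable_continuous_onI continuous_intros, simp)+
    moreover have "(\<lambda>p::real \<times> plane. F (fst p * fst (snd p), snd (snd p))) \<in> borel_measurable borel"
      by (intro borel_measurable_continuous_onI continuous_intros continuous_on_compose2[OF F(1)]) auto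
    ultimately show "k \<in> borel_measurable borel" unfolding k_def case_prod_beta' by simp
    have "0 \<le> B" using order_trans[OF norm_ge_zero F(2)] .
    then show "norm (k (s, z)) \<le> norm (B * indicator {0..1} s :: real) * norm (\<psi> z)" for s z
      using F(2)[of "(s * fst z, snd z)"] by (auto simp: k_def norm_mult indicator_def intro!: mult_right_mono)
  qed
  then have int: "integrable (lborel \<Otimes>\<^sub>M lborel) (case_prod (\<lambda>s z. k (s, z)))" by simp
  have "(LINT z|lborel. (LINT s|lborel. indicator {0..1} s *\<^sub>R F (s * fst z, snd z)) * \<psi> z) = (LINT z|lborel. LINT s|lborel. k (s, z))"
    unfolding integral_mult_left_zero[symmetric] k_def prod.case ..
  also have "\<dots> = (LINT s|lborel. LINT z|lborel. k (s, z))"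
    by (rule lborel_pair.Fubini_integral[OF int])
  also have "cmod \<dots> \<le> (LINT s|lborel. cmod (LINT z|lborel. k (s, z)))"
    by (rule integral_norm_bound)
  also have "\<dots> \<le> (LINT s|lborel. K * indicator {0..1} (s::real) :: real)"
  proof (rule integral_mono_AE)
    show "integrable lborel (\<lambda>s. cmod (LINT z|lborel. k (s, z)))"
      using lborel_pair.integrable_fst[OF int] by simp
    \<comment> \<open>At \<open>s = 0\<close> the dilation degenerates and the premise says nothing,
      but a single point is null.\<close>
    show "AE s in lborel. cmod (LINT z|lborel. k (s, z)) \<le> K * indicator {0..1} s"
      using AE_lborel_singleton[of 0]
    proof eventually_elim
      case (elim s)
      show ?case
      proof (cases "s \<in> {0..1}")
        case True
        then show ?thesis using elim K[of s] by (simp add: k_def)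
      qed (simp add: k_def)
    qed
  qed auto
  finally show ?thesis by simp
qed

text \<open>The integral is taken over the larger square \<open>box_sq b\<close>, on which
  \<open>G\<close> is continuous, so the holomorphic extension is an exponential integral with
  continuous density.\<close>

lemma band_fun_ift:
  assumes G: "bounded_supp G" "continuous_on (box_sq b) G" "\<And>\<xi>. \<xi> \<notin> box_sq c \<Longrightarrow> G \<xi> = 0" and "c \<le> b"
  shows "band_fun c (ift G)"
proof -
  note i = bounded_supp_integrable[OF G(1)]
  let ?P = "\<lambda>w. integral (cbox (- b, - b) (b, b)) (\<lambda>t::plane. G t * exp (\<i> * (of_real (fst t) * fst w + of_real (snd t) * snd w)))"
  have "ift G (x, y) = ?P (of_real x, of_real y)" for x y
  proof -
    have off: "G t = 0" if "t \<notin> cbox (- b, - b) (b, b)" for t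
    proof -
      have "t \<notin> box_sq c" using that \<open>c \<le> b\<close> by (cases t) (auto simp: box_sq_def cbox_Pair_eq)
      then show ?thesis by (rule G(3))
    qed
    have e: "G t * cis (t \<bullet> (x, y)) = G t * exp (\<i> * (of_real (fst t) * of_real x + of_real (snd t) * of_real y))" for t
      by (simp add: cis_conv_exp inner_prod_def algebra_simps)
    have "ift G (x, y) = (LINT t:cbox (- b, - b) (b, b)|lborel. G t * cis (t \<bullet> (x, y)))"
      unfolding ift_def set_lebesgue_integral_def
      by (rule Bochner_Integration.integral_cong) (use off in \<open>auto simp: indicator_def\<close>)
    also have "\<dots> = integral (cbox (- b, - b) (b, b)) (\<lambda>t. G t * cis (t \<bullet> (x, y)))"
      by (rule set_borel_integral_eq_integral(2))
         (use integrable_mult_cis[OF i] in \<open>auto simp: set_integrable_def intro!: integrable_mult_indicator\<close>)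
    finally show ?thesis by (simp add: e)
  qed
  then have "extends ?P (ift G)"
    unfolding extends_def using C1_holo_exp_integral[OF G(2)[unfolded box_sq_eq_cbox]] by simp
  moreover have "\<exists>B. \<forall>z. cmod (ift G z) \<le> B" using norm_ift_le[OF i] by blast
  ultimately show ?thesis
    unfolding band_fun_def using spectral_bound_ift[OF i G(3)] by blast
qed

text \<open>Since \<open>U \<cdot> \<integral>\<^sub>0\<^sup>x F = (x U) \<cdot> \<integral>\<^sub>0\<^sup>1 F (s x, y) ds\<close>, the transform of the product is a convolution of the
  measures belonging to \<open>H\<close> and to the dilations of \<open>F\<close>.\<close>

lemma band_fun_mult_antideriv:
  assumes F: "band_fun c F" and U: "extends P\<^sub>U U" "mulx U = ift H" and H: "bounded_supp H" "\<And>\<xi>. \<xi> \<notin> box_sq d \<Longrightarrow> H \<xi> = 0"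
  shows "band_fun (c + d) (\<lambda>z. U z * antideriv F z)"
proof -
  note iH = bounded_supp_integrable[OF H(1)]
  obtain P B M where P: "extends P F" and B: "\<And>z. cmod (F z) \<le> B" and M: "spectral_bound c M F"
    using F unfolding band_fun_def by blast
  note cF = extends_continuous[OF P]
  define avg where "avg z = (LINT s|lborel. indicator {0..1} s *\<^sub>R F (s * fst z, snd z))" for z
  \<comment> \<open>The factor x contained in \<open>antideriv\<close> is the one that turns
    \<open>U\<close> into \<open>ift H\<close>.\<close>
  have eq: "U z * antideriv F z = ift H z * avg z" for z
    unfolding U(2)[symmetric] by (simp add: antideriv_def avg_def mulx_def)
  have avg: "cmod (avg z) \<le> B" for z
  proof -
    have "cmod (avg z) \<le> (LINT s|lborel. B * indicator {0..1} (s::real))"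
      unfolding avg_def
    proof (rule norm_integral_le)
      show "cmod (indicator {0..1} s *\<^sub>R F (s * fst z, snd z)) \<le> B * indicator {0..1} s" for s
        using B by (auto simp: indicator_def)
    qed (intro integrable_mult_right integrable_real_indicator, auto)
    then show ?thesis by simp
  qed
  define N where "N = (LINT w|lborel. cmod (H w))"
  have N: "0 \<le> N" by (simp add: N_def)
  have iN: "cmod (ift H z) \<le> N" for z unfolding N_def by (rule norm_ift_le[OF iH])
  have ciH: "continuous_on UNIV (ift H)"
    using U extends_continuous[OF U(1)] unfolding U(2)[symmetric] mulx_def[abs_def] by (intro continuous_intros)
  have "cmod (U z * antideriv F z) \<le> N * B" for z
    unfolding eq norm_mult by (intro mult_mono iN avg N norm_ge_zero)
  moreover have "\<exists>Q. extends Q (\<lambda>z. U z * antideriv F z)"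
  proof -
    obtain P' where P': "extends P' (antideriv F)" using antideriv_extends(1)[OF P] by blast
    have "extends (\<lambda>w. P\<^sub>U w * P' w) (\<lambda>z. U z * antideriv F z)"
      using U(1) P' by (simp add: extends_def C1_holo_mult)
    then show ?thesis by blast
  qed
  moreover have "spectral_bound (c + d) (N * M) (\<lambda>z. U z * antideriv F z)"
    unfolding spectral_bound_def
  proof (intro conjI allI impI)
    show "0 \<le> N * M" using N M by (simp add: spectral_bound_def)
    fix \<phi> S assume t: "test_fun \<phi>" and S: "\<forall>z\<in>box_sq (c + d). cmod (\<phi> z) \<le> S"
    have iF: "integrable lborel (fourier \<phi>)" using t by (simp add: test_fun_def)
    have m: "ift H \<in> borel_measurable borel" using ciH by (rule borel_measurable_continuous_onI)
    have "cmod (LINT z|lborel. avg z * (ift H z * fourier \<phi> z)) \<le> N * (M * S)"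
      unfolding avg_def
    proof (rule average_bound[OF cF B])
      show "integrable lborel (\<lambda>z. ift H z * fourier \<phi> z)"
        by (rule integrable_bounded_mult[OF m iN iF])
      fix s :: real assume s: "0 < s" "s \<le> 1"
      define \<psi> where "\<psi> z = F (s * fst z, snd z) * fourier \<phi> z" for z
      have i\<psi>: "integrable lborel \<psi>"
        unfolding \<psi>_def
        by (rule integrable_bounded_mult[OF _ B iF])
           (intro borel_measurable_continuous_onI continuous_on_compose2[OF cF] continuous_intros, auto)
      have "(LINT z|lborel. F (s * fst z, snd z) * (ift H z * fourier \<phi> z)) = (LINT z|lborel. ift H z * \<psi> z)"
        by (simp add: \<psi>_def mult_ac)
      \<comment> \<open>Duality turns multiplication by \<open>ift H\<close> into integration over
        the frequencies \<zeta> of \<open>H\<close>.\<close>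
      also have "\<dots> = (LINT \<zeta>|lborel. H \<zeta> * ift \<psi> \<zeta>)"
        by (rule ift_duality[OF iH i\<psi>])
      also have "cmod \<dots> \<le> (LINT \<zeta>|lborel. cmod (H \<zeta>) * (M * S))"
      proof (rule norm_integral_le)
        show "cmod (H \<zeta> * ift \<psi> \<zeta>) \<le> cmod (H \<zeta>) * (M * S)" for \<zeta>
        proof (cases "\<zeta> \<in> box_sq d")
          case True
          \<comment> \<open>The exponential in \<open>ift\<close> is a modulation, hence a shift of
            the test function by \<zeta>; this is where the two squares add.\<close>
          have "ift \<psi> \<zeta> = (LINT z|lborel. F (s * fst z, snd z) * fourier (\<lambda>z. \<phi> (z + \<zeta>)) z)"
            unfolding fourier_shift(1)[OF t] ift_def \<psi>_def by (simp add: mult_ac inner_commute)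
          also have "cmod \<dots> \<le> M * S"
          proof (rule spectral_bound_scaled[OF M cF fourier_shift(2)[OF t] s(1)])
            fix z assume z: "z \<in> box_sq c"
            \<comment> \<open>Here \<open>s \<le> 1\<close> enters: the contracted point stays in
              \<open>box_sq c\<close>.\<close>
            have "\<bar>s * fst z\<bar> \<le> c" "\<bar>snd z\<bar> \<le> c"
              using mult_mono[of s 1 "\<bar>fst z\<bar>" c] z s by (cases z; auto simp: box_sq_def abs_mult)+
            then have "(s * fst z, snd z) + \<zeta> \<in> box_sq (c + d)"
              using True by (cases \<zeta>) (auto simp: box_sq_def)
            then show "cmod (\<phi> ((s * fst z, snd z) + \<zeta>)) \<le> S" using S by blast
          qed
          finally show ?thesis unfolding norm_mult by (rule mult_left_mono) simp
        qed (simp add: H(2))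
      qed (use iH in simp)
      finally show "cmod (LINT z|lborel. F (s * fst z, snd z) * (ift H z * fourier \<phi> z)) \<le> N * (M * S)"
        by (simp add: N_def)
    qed
    then show "cmod (LINT z|lborel. U z * antideriv F z * fourier \<phi> z) \<le> N * M * S"
      unfolding eq by (simp add: mult_ac)
  qed
  ultimately show ?thesis unfolding band_fun_def by blast
qed

lemma band_fun_add:
  assumes F: "band_fun c F" and G: "band_fun d G" and "c \<le> d"
  shows "band_fun d (\<lambda>z. F z + a * G z)"
proof -
  obtain P B M where P: "extends P F" and B: "\<And>z. cmod (F z) \<le> B" and M: "spectral_bound c M F"
    using F unfolding band_fun_def by blast
  obtain Q C N where Q: "extends Q G" and C: "\<And>z. cmod (G z) \<le> C" and N: "spectral_bound d N G"
    using G unfolding band_fun_def by blast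
  have "extends (\<lambda>w. P w + a * Q w) (\<lambda>z. F z + a * G z)"
    using P Q unfolding extends_def by (auto intro!: C1_holo_add C1_holo_mult C1_holo_const)
  moreover have "cmod (F z + a * G z) \<le> B + cmod a * C" for z
    using norm_triangle_ineq[of "F z" "a * G z"] B[of z] mult_left_mono[OF C[of z], of "cmod a"] by (simp add: norm_mult)
  moreover have "spectral_bound d (M + cmod a * N) (\<lambda>z. F z + a * G z)"
    unfolding spectral_bound_def
  proof (intro conjI allI impI)
    show "0 \<le> M + cmod a * N" using M N by (simp add: spectral_bound_def)
    fix \<phi> S assume t: "test_fun \<phi>" and S: "\<forall>z\<in>box_sq d. cmod (\<phi> z) \<le> S"
    have i: "integrable lborel (fourier \<phi>)" using t by (simp add: test_fun_def)
    have iF: "integrable lborel (\<lambda>z. F z * fourier \<phi> z)" and iG: "integrable lborel (\<lambda>z. G z * fourier \<phi> z)"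
      using extends_continuous[OF P] extends_continuous[OF Q]
      by (auto intro!: integrable_bounded_mult[OF _ B i] integrable_bounded_mult[OF _ C i] borel_measurable_continuous_onI)
    have "box_sq c \<subseteq> box_sq d" using \<open>c \<le> d\<close> by (auto simp: box_sq_def)
    then have "\<forall>z\<in>box_sq c. cmod (\<phi> z) \<le> S" using S by blast
    then have b: "cmod (LINT z|lborel. F z * fourier \<phi> z) \<le> M * S" "cmod (LINT z|lborel. G z * fourier \<phi> z) \<le> N * S"
      using M N t S unfolding spectral_bound_def by blast+
    have "(LINT z|lborel. (F z + a * G z) * fourier \<phi> z) = (LINT z|lborel. F z * fourier \<phi> z) + a * (LINT z|lborel. G z * fourier \<phi> z)"
      using iF iG by (simp add: distrib_right mult.assoc)
    also have "cmod \<dots> \<le> M * S + cmod a * (N * S)"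
      using norm_triangle_ineq[of "LINT z|lborel. F z * fourier \<phi> z" "a * (LINT z|lborel. G z * fourier \<phi> z)"]
        b(1) mult_left_mono[OF b(2), of "cmod a"] by (simp add: norm_mult)
    finally show "cmod (LINT z|lborel. (F z + a * G z) * fourier \<phi> z) \<le> (M + cmod a * N) * S"
      by (simp add: distrib_right mult.assoc)
  qed
  ultimately show ?thesis unfolding band_fun_def by blast
qed

text \<open>No multiplier is left to absorb the factor x of \<open>antideriv\<close>. It passes to
  the transform, where it becomes the x-derivative of the test function, and the rest is an average
  of dilations as before.\<close>

lemma antideriv_spectral_bound:
  assumes F: "band_fun c F"
  shows "\<exists>M\<ge>0. \<forall>\<phi> S. schwartz \<phi> \<longrightarrow> (\<forall>z\<in>box_sq c. cmod (D\<^sub>x \<phi> z) \<le> S) \<longrightarrow>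
    cmod (LINT z|lborel. antideriv F z * fourier \<phi> z) \<le> M * S"
proof -
  obtain P B M where P: "extends P F" and B: "\<And>z. cmod (F z) \<le> B" and M: "spectral_bound c M F"
    using F unfolding band_fun_def by blast
  note cF = extends_continuous[OF P]
  have "cmod (LINT z|lborel. antideriv F z * fourier \<phi> z) \<le> M * S"
    if \<phi>: "schwartz \<phi>" and S: "\<forall>z\<in>box_sq c. cmod (D\<^sub>x \<phi> z) \<le> S" for \<phi> S
  proof -
    note t = schwartz_test_fun[OF \<phi>]
    have "cmod (LINT z|lborel. (LINT s|lborel. indicator {0..1} s *\<^sub>R F (s * fst z, snd z)) * fourier (D\<^sub>x \<phi>) z) \<le> M * S"
    proof (rule average_bound[OF cF B])
      show "integrable lborel (fourier (D\<^sub>x \<phi>))" using t(2) by (simp add: test_fun_def)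
      fix s :: real assume s: "0 < s" "s \<le> 1"
      show "cmod (LINT z|lborel. F (s * fst z, snd z) * fourier (D\<^sub>x \<phi>) z) \<le> M * S"
      proof (rule spectral_bound_scaled[OF M cF t(2) s(1)])
        fix z assume z: "z \<in> box_sq c"
        have "\<bar>s * fst z\<bar> \<le> c" "\<bar>snd z\<bar> \<le> c"
          using mult_mono[of s 1 "\<bar>fst z\<bar>" c] z s by (cases z; auto simp: box_sq_def abs_mult)+
        then have "(s * fst z, snd z) \<in> box_sq c" by (auto simp: box_sq_def)
        then show "cmod (D\<^sub>x \<phi> (s * fst z, snd z)) \<le> S" using S by blast
      qed
    qed
    moreover have "(LINT s|lborel. indicator {0..1} s *\<^sub>R F (s * fst z, snd z)) * fourier (D\<^sub>x \<phi>) z = \<i> * (antideriv F z * fourier \<phi> z)" for z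
      unfolding t(3) antideriv_def mulx_def by (simp only: mult_ac)
    ultimately show ?thesis by (simp add: norm_mult)
  qed
  then show ?thesis using M unfolding spectral_bound_def by blast
qed

section \<open>The distribution defined by an antiderivative\<close>

lemma seminorm_nonneg: "schwartz \<phi> \<Longrightarrow> 0 \<le> schwartz_seminorm i j a b \<phi>"
  by (rule order_trans[OF _ seminorm_bound[of \<phi> "(0, 0)"]]) simp_all

lemma seminorm_le_sum:
  assumes "schwartz \<phi>" "i \<le> N" "j \<le> N" "a \<le> N" "b \<le> N"
  shows "schwartz_seminorm i j a b \<phi> \<le> (\<Sum>i\<le>N. \<Sum>j\<le>N. \<Sum>a\<le>N. \<Sum>b\<le>N. schwartz_seminorm i j a b \<phi>)"
proof -
  note nn = seminorm_nonneg[OF assms(1)]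
  have "schwartz_seminorm i j a b \<phi> \<le> (\<Sum>b\<le>N. schwartz_seminorm i j a b \<phi>)"
    by (rule member_le_sum) (use assms nn in auto)
  also have "\<dots> \<le> (\<Sum>a\<le>N. \<Sum>b\<le>N. schwartz_seminorm i j a b \<phi>)"
    by (rule member_le_sum) (use assms nn in \<open>auto intro!: sum_nonneg\<close>)
  also have "\<dots> \<le> (\<Sum>j\<le>N. \<Sum>a\<le>N. \<Sum>b\<le>N. schwartz_seminorm i j a b \<phi>)"
    by (rule member_le_sum) (use assms nn in \<open>auto intro!: sum_nonneg\<close>)
  also have "\<dots> \<le> (\<Sum>i\<le>N. \<Sum>j\<le>N. \<Sum>a\<le>N. \<Sum>b\<le>N. schwartz_seminorm i j a b \<phi>)"
    by (rule member_le_sum) (use assms nn in \<open>auto intro!: sum_nonneg\<close>)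
  finally show ?thesis .
qed

lemma norm_unit_average_le:
  fixes f :: "real \<Rightarrow> complex"
  assumes "\<And>s. s \<in> {0..1} \<Longrightarrow> cmod (f s) \<le> B"
  shows "cmod (LINT s|lborel. indicator {0..1} s *\<^sub>R f s) \<le> B"
proof -
  have "cmod (LINT s|lborel. indicator {0..1} s *\<^sub>R f s) \<le> (LINT s|lborel. B * indicator {0..1} (s::real))"
  proof (rule norm_integral_le)
    show "cmod (indicator {0..1} s *\<^sub>R f s) \<le> B * indicator {0..1} s" for s
      using assms by (auto simp: indicator_def)
  qed (intro integrable_mult_right integrable_real_indicator, auto)
  then show ?thesis by simp
qed

lemma norm_antideriv_le:
  assumes "\<And>z. cmod (F z) \<le> B"
  shows "cmod (antideriv F z) \<le> \<bar>fst z\<bar> * B"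
  unfolding antideriv_def norm_mult norm_of_real
  by (intro mult_left_mono norm_unit_average_le assms) simp

lemma partial_x_off_support:
  assumes "z \<notin> fsupport \<phi>"
  shows "D\<^sub>x \<phi> z = 0"
proof -
  have "(\<phi> has_derivative (\<lambda>_. 0)) (at z)"
    by (rule has_derivative_transform_within_open[OF has_derivative_const, of "- fsupport \<phi>"])
       (use assms in \<open>auto simp: fsupportD open_Compl fsupport_def[of \<phi>, THEN arg_cong[of _ _ closed]]\<close>)
  from partial_x_eq[OF this] show ?thesis .
qed

lemma fourier_add:
  assumes "integrable lborel \<phi>" "integrable lborel \<psi>"
  shows "fourier (\<lambda>z. \<phi> z + \<psi> z) = (\<lambda>\<xi>. fourier \<phi> \<xi> + fourier \<psi> \<xi>)"
proof
  fix \<xi>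
  have "ift (\<lambda>z. \<phi> z + \<psi> z) (- \<xi>) = ift \<phi> (- \<xi>) + ift \<psi> (- \<xi>)"
    unfolding ift_def distrib_right
    by (rule Bochner_Integration.integral_add) (intro integrable_mult_cis assms)+
  then show "fourier (\<lambda>z. \<phi> z + \<psi> z) \<xi> = fourier \<phi> \<xi> + fourier \<psi> \<xi>"
    by (simp only: fourier_eq_ift distrib_left)
qed

locale antideriv_distribution =
  fixes c :: real and F :: "plane \<Rightarrow> complex"
  assumes F: "band_fun c F"
begin

abbreviation T :: distr where
  "T \<equiv> fourier_distr (distr_of (antideriv F))"

lemma ex_bound: "\<exists>B. \<forall>z. cmod (antideriv F z) \<le> \<bar>fst z\<bar> * B"
  using F norm_antideriv_le[of F] unfolding band_fun_def by blast

lemma antideriv_measurable: "antideriv F \<in> borel_measurable borel"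
proof -
  obtain P where "extends P F" using F unfolding band_fun_def by blast
  from extends_continuous[OF antideriv_extends(1)[OF this]] show ?thesis
    by (rule borel_measurable_continuous_onI)
qed

lemma integrable_mult:
  assumes "integrable lborel (mulx \<phi>)" "\<phi> \<in> borel_measurable borel"
  shows "integrable lborel (\<lambda>z. antideriv F z * \<phi> z)"
proof -
  obtain B where B: "\<And>z. cmod (antideriv F z) \<le> \<bar>fst z\<bar> * B" using ex_bound by blast
  show ?thesis
  proof (rule Bochner_Integration.integrable_bound)
    show "integrable lborel (\<lambda>z. B * cmod (mulx \<phi> z))" using assms(1) by simp
    have "cmod (antideriv F z * \<phi> z) \<le> \<bar>B * cmod (mulx \<phi> z)\<bar>" for z
      using mult_right_mono[OF B[of z], of "cmod (\<phi> z)"] by (simp add: norm_mult mulx_def mult_ac)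
    then show "AE z in lborel. norm (antideriv F z * \<phi> z) \<le> norm (B * cmod (mulx \<phi> z))" by simp
  qed (use antideriv_measurable assms(2) in simp)
qed

lemma integrable_schwartz:
  assumes "schwartz \<phi>"
  shows "integrable lborel (\<lambda>z. antideriv F z * \<phi> z)" "integrable lborel (\<lambda>z. antideriv F z * fourier \<phi> z)"
proof -
  have m: "all_moments \<phi>" using schwartz_all_moments[OF assms, of 0 0] by (simp add: mderiv_0_0)
  show "integrable lborel (\<lambda>z. antideriv F z * \<phi> z)"
    by (rule integrable_mult[OF all_moments_integrable(1)[OF all_moments_mul(1)[OF m]]])
       (use all_moments_integrable(1)[OF m] in \<open>auto dest: borel_measurable_integrable\<close>)
  show "integrable lborel (\<lambda>z. antideriv F z * fourier \<phi> z)"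
    by (rule integrable_mult[OF fourier_schwartz_integrable(2)[OF assms]])
       (use fourier_schwartz_integrable(1)[OF assms] in \<open>auto dest: borel_measurable_integrable\<close>)
qed

lemma is_tempered_function: "tempered_function (antideriv F)"
  unfolding tempered_function_def tempered_distribution_def
proof (intro conjI allI impI)
  note i = integrable_schwartz(1)
  show "integrable lborel (\<lambda>z. antideriv F z * \<phi> z)" if "schwartz \<phi>" for \<phi> using i[OF that] .
  show "distr_of (antideriv F) (\<lambda>z. \<phi> z + \<psi> z) = distr_of (antideriv F) \<phi> + distr_of (antideriv F) \<psi>"
    if "schwartz \<phi>" "schwartz \<psi>" for \<phi> \<psi>
    using i[OF that(1)] i[OF that(2)] by (simp add: distr_of_def distrib_left)
  show "distr_of (antideriv F) (\<lambda>z. a * \<phi> z) = a * distr_of (antideriv F) \<phi>" for a \<phi>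
    by (simp add: distr_of_def mult.left_commute)
  obtain B where B: "\<And>z. cmod (antideriv F z) \<le> \<bar>fst z\<bar> * B" using ex_bound by blast
  have B0: "0 \<le> B" using order_trans[OF norm_ge_zero B[of "(1, 0)"]] by simp
  define I where "I = (LINT z|lborel. 1 / weight z)"
  have I: "0 \<le> I" unfolding I_def using weight_pos by (intro integral_nonneg_AE AE_I2) (simp add: less_imp_le)
  \<comment> \<open>The growth \<open>|x|\<close> together with the square in \<open>weight\<close>
    needs powers of x up to 3, which fixes the range of the seminorms; 4 counts the terms of the
    expanded weight.\<close>
  have "cmod (distr_of (antideriv F) \<phi>) \<le> (4 * B * I) * (\<Sum>i\<le>3. \<Sum>j\<le>3. \<Sum>a\<le>3. \<Sum>b\<le>3. schwartz_seminorm i j a b \<phi>)"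
    (is "_ \<le> _ * ?S") if \<phi>: "schwartz \<phi>" for \<phi>
  proof -
    have "cmod (distr_of (antideriv F) \<phi>) \<le> (LINT z|lborel. (4 * B * ?S) * (1 / weight z))"
      unfolding distr_of_def
    proof (rule norm_integral_le)
      show "integrable lborel (\<lambda>z. (4 * B * ?S) * (1 / weight z))"
        by (intro integrable_mult_right integrable_inverse_weight)
      fix z
      have decay: "weight z * (\<bar>fst z\<bar> * cmod (\<phi> z)) \<le> schwartz_seminorm 1 0 0 0 \<phi> + schwartz_seminorm 3 0 0 0 \<phi>
          + schwartz_seminorm 1 2 0 0 \<phi> + schwartz_seminorm 3 2 0 0 \<phi>"
        using schwartz_decay[OF \<phi>, of z 1 0 0 0] by (simp add: mderiv_0_0 numeral_2_eq_2 numeral_3_eq_3)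
      have "weight z * (\<bar>fst z\<bar> * cmod (\<phi> z)) \<le> 4 * ?S"
        using decay seminorm_le_sum[OF \<phi>, of 1 3 0 0 0] seminorm_le_sum[OF \<phi>, of 3 3 0 0 0]
          seminorm_le_sum[OF \<phi>, of 1 3 2 0 0] seminorm_le_sum[OF \<phi>, of 3 3 2 0 0]
        by simp
      then have "B * (\<bar>fst z\<bar> * cmod (\<phi> z)) \<le> B * (4 * ?S / weight z)"
        using weight_pos[of z] B0 by (intro mult_left_mono) (simp_all add: pos_le_divide_eq mult.commute)
      moreover have "cmod (antideriv F z * \<phi> z) \<le> B * (\<bar>fst z\<bar> * cmod (\<phi> z))"
        using mult_right_mono[OF B[of z], of "cmod (\<phi> z)"] by (simp add: norm_mult mult_ac)
      ultimately show "cmod (antideriv F z * \<phi> z) \<le> (4 * B * ?S) * (1 / weight z)" by (simp add: mult_ac)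
    qed
    also have "\<dots> = (4 * B * I) * ?S" unfolding I_def by (subst integral_mult_right_zero) (simp only: mult_ac)
    finally show ?thesis .
  qed
  then show "\<exists>C N. \<forall>\<phi>. schwartz \<phi> \<longrightarrow> cmod (distr_of (antideriv F) \<phi>) \<le>
      C * (\<Sum>i\<le>N. \<Sum>j\<le>N. \<Sum>a\<le>N. \<Sum>b\<le>N. schwartz_seminorm i j a b \<phi>)" by blast
qed

text \<open>The single estimate from which continuity, order and support of the transform all
  follow.\<close>

lemma fourier_distr_bound:
  "\<exists>M\<ge>0. \<forall>\<phi> S. schwartz \<phi> \<longrightarrow> (\<forall>z\<in>box_sq c. cmod (D\<^sub>x \<phi> z) \<le> S) \<longrightarrow>
    cmod (T \<phi>) \<le> M * S"
  using antideriv_spectral_bound[OF F] by (simp add: fourier_distr_def distr_of_def)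

lemma partial_x_mderiv: "D\<^sub>x \<phi> = mderiv 1 0 \<phi>"
  by (simp add: mderiv_def)

lemma fourier_tempered: "tempered_distribution (T)"
  unfolding tempered_distribution_def
proof (intro conjI allI impI)
  show "T (\<lambda>z. \<phi> z + \<psi> z) = T \<phi> + T \<psi>"
    if "schwartz \<phi>" "schwartz \<psi>" for \<phi> \<psi>
  proof -
    have "integrable lborel \<phi>" "integrable lborel \<psi>"
      using schwartz_test_fun(1) that by (auto simp: test_fun_def)
    then show ?thesis
      using integrable_schwartz(2)[OF that(1)] integrable_schwartz(2)[OF that(2)]
      by (simp add: fourier_distr_def distr_of_def fourier_add distrib_left)
  qed
  show "T (\<lambda>z. a * \<phi> z) = a * T \<phi>" for a \<phi>
    by (simp add: fourier_distr_def distr_of_def fourier_cmult mult.left_commute)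
  obtain M where M: "0 \<le> M" "\<And>\<phi> S. schwartz \<phi> \<Longrightarrow> \<forall>z\<in>box_sq c. cmod (D\<^sub>x \<phi> z) \<le> S \<Longrightarrow>
    cmod (T \<phi>) \<le> M * S" using fourier_distr_bound by blast
  have "cmod (T \<phi>) \<le> M * (\<Sum>i\<le>1. \<Sum>j\<le>1. \<Sum>a\<le>1. \<Sum>b\<le>1. schwartz_seminorm i j a b \<phi>)"
    if "schwartz \<phi>" for \<phi>
  proof (rule M(2)[OF that], intro ballI)
    fix z
    have "cmod (D\<^sub>x \<phi> z) \<le> schwartz_seminorm 0 0 1 0 \<phi>"
      using seminorm_bound[OF that, of z 0 0 1 0] by (simp only: partial_x_mderiv power_0 mult_1)
    also have "\<dots> \<le> (\<Sum>i\<le>1. \<Sum>j\<le>1. \<Sum>a\<le>1. \<Sum>b\<le>1. schwartz_seminorm i j a b \<phi>)"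
      by (rule seminorm_le_sum[OF that]) simp_all
    finally show "cmod (D\<^sub>x \<phi> z) \<le> (\<Sum>i\<le>1. \<Sum>j\<le>1. \<Sum>a\<le>1. \<Sum>b\<le>1. schwartz_seminorm i j a b \<phi>)" .
  qed
  then show "\<exists>C N. \<forall>\<phi>. schwartz \<phi> \<longrightarrow> cmod (T \<phi>) \<le>
      C * (\<Sum>i\<le>N. \<Sum>j\<le>N. \<Sum>a\<le>N. \<Sum>b\<le>N. schwartz_seminorm i j a b \<phi>)" by blast
qed

lemma fourier_order: "order_at_most 1 (T)"
  unfolding order_at_most_def
proof (intro allI impI)
  fix K :: "plane set" assume "compact K"
  obtain M where M: "0 \<le> M" "\<And>\<phi> S. schwartz \<phi> \<Longrightarrow> \<forall>z\<in>box_sq c. cmod (D\<^sub>x \<phi> z) \<le> S \<Longrightarrow>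
    cmod (T \<phi>) \<le> M * S" using fourier_distr_bound by blast
  show "\<exists>M. \<forall>\<phi>. schwartz \<phi> \<longrightarrow> fsupport \<phi> \<subseteq> K \<longrightarrow> cmod (T \<phi>) \<le>
      M * (SUP (a, b)\<in>{(a, b). a + b \<le> 1}. SUP z\<in>K. cmod (mderiv a b \<phi> z))"
  proof (cases "K = {}")
    \<comment> \<open>A real supremum over the empty set carries no information, but here
      \<open>\<phi>\<close> has empty support and \<open>T \<phi> = 0\<close>, so the constant 0
      will do.\<close>
    case True
    have "cmod (T \<phi>) \<le> 0" if "schwartz \<phi>" "fsupport \<phi> \<subseteq> K" for \<phi>
      using M(2)[OF that(1), of 0] partial_x_off_support[of _ \<phi>] that(2) True by auto
    then show ?thesis by (intro exI[of _ 0]) simp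
  next
    case False
    then obtain z\<^sub>0 where z\<^sub>0: "z\<^sub>0 \<in> K" by blast
    have "cmod (T \<phi>) \<le>
      M * (SUP (a, b)\<in>{(a, b). a + b \<le> 1}. SUP z\<in>K. cmod (mderiv a b \<phi> z))" (is "_ \<le> M * ?S")
      if \<phi>: "schwartz \<phi>" "fsupport \<phi> \<subseteq> K" for \<phi>
    proof (rule M(2)[OF \<phi>(1)])
      \<comment> \<open>A real supremum is an upper bound only for a bounded family; there are
        finitely many multi-indices.\<close>
      have "finite {(a::nat, b::nat). a + b \<le> 1}"
        by (rule finite_subset[of _ "{..1} \<times> {..1}"]) auto
      then have 1: "(SUP z\<in>K. cmod (mderiv 1 0 \<phi> z)) \<le> ?S"
        using cSUP_upper[of "(1, 0)" "{(a, b). a + b \<le> 1}" "\<lambda>(a, b). SUP z\<in>K. cmod (mderiv a b \<phi> z)"]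
        by (simp add: bdd_above_finite)
      have 2: "cmod (mderiv 1 0 \<phi> z) \<le> (SUP z\<in>K. cmod (mderiv 1 0 \<phi> z))" if "z \<in> K" for z
      proof (rule cSUP_upper[OF that])
        show "bdd_above ((\<lambda>z. cmod (mderiv 1 0 \<phi> z)) ` K)"
          by (rule bdd_aboveI2[of _ _ "schwartz_seminorm 0 0 1 0 \<phi>"])
             (use seminorm_bound[OF \<phi>(1), of _ 0 0 1 0] in simp)
      qed
      have S0: "0 \<le> ?S" using order_trans[OF norm_ge_zero order_trans[OF 2[OF z\<^sub>0] 1]] .
      show "\<forall>z\<in>box_sq c. cmod (D\<^sub>x \<phi> z) \<le> ?S"
      proof
        fix z
        show "cmod (D\<^sub>x \<phi> z) \<le> ?S"
        proof (cases "z \<in> K")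
          case True
          show ?thesis unfolding partial_x_mderiv by (rule order_trans[OF 2[OF True] 1])
        next
          case False
          then have "D\<^sub>x \<phi> z = 0" using \<phi>(2) by (intro partial_x_off_support) blast
          then show ?thesis using S0 by (simp only: norm_zero)
        qed
      qed
    qed
    then show ?thesis by blast
  qed
qed

lemma fourier_support: "distr_support (T) \<subseteq> box_sq c"
proof -
  obtain M where M: "0 \<le> M" "\<And>\<phi> S. schwartz \<phi> \<Longrightarrow> \<forall>z\<in>box_sq c. cmod (D\<^sub>x \<phi> z) \<le> S \<Longrightarrow>
    cmod (T \<phi>) \<le> M * S" using fourier_distr_bound by blast
  have "T \<phi> = 0" if "schwartz \<phi>" "fsupport \<phi> \<subseteq> - box_sq c" for \<phi>
  proof -
    \<comment> \<open>The derivative vanishes off the support of \<open>\<phi>\<close>, so the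
      estimate applies with \<open>S = 0\<close>.\<close>
    have "\<forall>z\<in>box_sq c. cmod (D\<^sub>x \<phi> z) \<le> 0"
      using partial_x_off_support[of _ \<phi>] that(2) by auto
    from M(2)[OF that(1) this] show ?thesis by simp
  qed
  moreover have "open (- box_sq c)" by (simp add: compact_box_sq compact_imp_closed open_Compl)
  ultimately show ?thesis unfolding distr_support_def by blast
qed

end

section \<open>The fixed point iteration\<close>

primrec picard :: "(plane \<Rightarrow> complex) \<Rightarrow> (plane \<Rightarrow> complex) \<Rightarrow> nat \<Rightarrow> plane \<Rightarrow> complex" where
  "picard a b 0 = a"
| "picard a b (Suc k) = (\<lambda>z. a z + (- \<i>) * (b z * antideriv (picard a b k) z))"

lemma band_fun_continuous: "band_fun c F \<Longrightarrow> continuous_on UNIV F"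
  unfolding band_fun_def using extends_continuous by blast

lemma band_fun_picard:
  assumes a: "band_fun c a" and b: "band_fun d b" "mulx b = ift H" and H: "bounded_supp H" "\<And>\<xi>. \<xi> \<notin> box_sq d \<Longrightarrow> H \<xi> = 0"
    and d: "0 \<le> d"
  shows "band_fun (c + real k * d) (picard a b k)"
proof (induction k)
  case (Suc k)
  obtain P where P: "extends P b" using b(1) unfolding band_fun_def by blast
  have "band_fun (c + real k * d + d) (\<lambda>z. b z * antideriv (picard a b k) z)"
    by (rule band_fun_mult_antideriv[OF Suc P b(2) H])
  then have "band_fun (c + real k * d + d) (picard a b (Suc k))"
    unfolding picard.simps using d by (intro band_fun_add[OF a]) simp_all
  then show ?case by (simp add: algebra_simps)
qed (simp add: a)

text \<open>The segment from \<open>(0, y)\<close> to \<open>(x, y)\<close> stays in the square and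
  has length at most 1, so integration has norm at most 1 there; all contraction comes from the
  factor \<open>b\<close>.\<close>

lemma norm_antideriv_le_on_box:
  assumes F: "\<And>w. w \<in> box_sq 1 \<Longrightarrow> cmod (F w) \<le> S" and z: "z \<in> box_sq 1"
  shows "cmod (antideriv F z) \<le> S"
proof -
  have x: "\<bar>fst z\<bar> \<le> 1" "\<bar>snd z\<bar> \<le> 1" using z by (auto simp: box_sq_def)
  have "cmod (LINT s|lborel. indicator {0..1} s *\<^sub>R F (s * fst z, snd z)) \<le> S"
  proof (intro norm_unit_average_le F)
    fix s :: real assume "s \<in> {0..1}"
    then have "\<bar>s * fst z\<bar> \<le> 1" using mult_mono[of "\<bar>s\<bar>" 1 "\<bar>fst z\<bar>" 1] x by (simp add: abs_mult)
    then show "(s * fst z, snd z) \<in> box_sq 1" using x by (auto simp: box_sq_def)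
  qed
  from mult_mono[OF x(1) this] show ?thesis
    by (simp add: antideriv_def norm_mult)
qed

lemma antideriv_diff:
  assumes "continuous_on UNIV F" "continuous_on UNIV G"
  shows "antideriv F z - antideriv G z = antideriv (\<lambda>w. F w - G w) z"
proof -
  have "integrable lborel (\<lambda>s. indicator {0..1} s *\<^sub>R C (s * fst z, snd z))" if "continuous_on UNIV C" for C :: "plane \<Rightarrow> complex"
    by (intro unit_interval_integral continuous_on_compose2[OF that] continuous_intros) auto
  from this[OF assms(1)] this[OF assms(2)] show ?thesis
    by (simp add: antideriv_def scaleR_diff_right right_diff_distrib)
qed

locale iteration =
  fixes a b :: "plane \<Rightarrow> complex" and \<alpha> \<gamma> :: real
  assumes cont: "\<And>k. continuous_on UNIV (picard a b k)"
    and a: "\<And>z. z \<in> box_sq 1 \<Longrightarrow> cmod (a z) \<le> \<alpha>" and b: "\<And>z. z \<in> box_sq 1 \<Longrightarrow> cmod (b z) \<le> \<gamma>"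
    and \<gamma>: "\<gamma> < 1"
begin

lemma nonneg: "0 \<le> \<alpha>" "0 \<le> \<gamma>"
  using order_trans[OF norm_ge_zero a[of 0]] order_trans[OF norm_ge_zero b[of 0]] by (simp_all add: box_sq_def zero_prod_def)

text \<open>\<open>\<alpha> / (1 - \<gamma>)\<close> is the fixed point of
  \<open>t \<mapsto> \<alpha> + \<gamma> t\<close>, hence a bound that the step preserves.\<close>

lemma picard_bound: "z \<in> box_sq 1 \<Longrightarrow> cmod (picard a b k z) \<le> \<alpha> / (1 - \<gamma>)"
proof (induction k arbitrary: z)
  case 0
  have "\<alpha> * (1 - \<gamma>) \<le> \<alpha> * 1" using nonneg by (intro mult_left_mono) auto
  then have "\<alpha> \<le> \<alpha> / (1 - \<gamma>)" using \<gamma> by (simp add: pos_le_divide_eq)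
  with a[OF 0] show ?case by simp
next
  case (Suc k)
  have "cmod (b z * antideriv (picard a b k) z) \<le> \<gamma> * (\<alpha> / (1 - \<gamma>))"
    unfolding norm_mult using b[OF Suc.prems] nonneg norm_antideriv_le_on_box[OF Suc.IH Suc.prems]
    by (intro mult_mono) auto
  moreover have "\<alpha> + \<gamma> * (\<alpha> / (1 - \<gamma>)) = \<alpha> / (1 - \<gamma>)" using \<gamma> by (simp add: field_simps)
  ultimately show ?case
    using norm_triangle_ineq[of "a z" "- \<i> * (b z * antideriv (picard a b k) z)"] a[OF Suc.prems] by (simp add: norm_mult)
qed

text \<open>The term \<open>a\<close> cancels between successive iterates and each step brings one
  factor \<gamma>; the first difference already has one, since the iteration starts at
  \<open>a\<close> and not at 0.\<close>

lemma picard_diff_bound: "z \<in> box_sq 1 \<Longrightarrow> cmod (picard a b (Suc k) z - picard a b k z) \<le> \<gamma> ^ Suc k * \<alpha>"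
proof (induction k arbitrary: z)
  case 0
  have "cmod (b z * antideriv a z) \<le> \<gamma> * \<alpha>"
    unfolding norm_mult using b[OF 0] nonneg norm_antideriv_le_on_box[OF a 0] by (intro mult_mono) auto
  then show ?case by (simp add: norm_mult)
next
  case (Suc k)
  have "picard a b (Suc (Suc k)) z - picard a b (Suc k) z =
      - \<i> * (b z * antideriv (\<lambda>w. picard a b (Suc k) w - picard a b k w) z)"
    unfolding antideriv_diff[OF cont cont, symmetric] by (simp add: algebra_simps)
  also have "cmod \<dots> \<le> \<gamma> * (\<gamma> ^ Suc k * \<alpha>)"
    unfolding norm_mult using b[OF Suc.prems] nonneg norm_antideriv_le_on_box[OF Suc.IH Suc.prems]
    by (simp del: picard.simps power_Suc) (intro mult_mono; simp)
  finally show ?case by (simp add: mult.assoc)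
qed

text \<open>The last iterate was computed with \<open>b\<close> and its predecessor, while the
  equation asks for \<open>g\<close> and the iterate itself. Replacing \<open>b\<close> by
  \<open>g\<close> costs the term with \<eta>, replacing the predecessor the geometric one.\<close>

lemma residual_bound:
  assumes f: "cmod (a z - f) \<le> \<delta>" and g: "cmod (g - b z) \<le> \<eta>" "cmod g \<le> G" and z: "z \<in> box_sq 1"
  shows "cmod (picard a b n z + \<i> * g * antideriv (picard a b n) z - f) \<le> \<delta> + \<eta> * (\<alpha> / (1 - \<gamma>)) + G * (\<gamma> ^ n * \<alpha>)"
proof -
  have G: "0 \<le> G" "0 \<le> \<eta>" using order_trans[OF norm_ge_zero] g by blast+
  have J: "cmod (antideriv (picard a b k) z) \<le> \<alpha> / (1 - \<gamma>)" for k
    by (rule norm_antideriv_le_on_box[OF picard_bound z])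
  have pos: "0 \<le> \<alpha> / (1 - \<gamma>)" using nonneg \<gamma> by simp
  show ?thesis
  proof (cases n)
    \<comment> \<open>There is no predecessor: the term \<open>\<i> * g * antideriv a z\<close> is
      bounded as a whole by \<open>G * \<alpha>\<close>, and the middle summand of the claim only
      has to be nonnegative.\<close>
    case 0
    have "cmod (g * antideriv a z) \<le> G * \<alpha>"
      unfolding norm_mult using norm_antideriv_le_on_box[OF a z] g(2) G by (intro mult_mono) auto
    then have "cmod (\<i> * g * antideriv a z) \<le> G * \<alpha>" by (simp add: norm_mult)
    moreover have "cmod (a z + \<i> * g * antideriv a z - f) \<le> cmod (a z - f) + cmod (\<i> * g * antideriv a z)"
      using norm_triangle_ineq[of "a z - f" "\<i> * g * antideriv a z"] by (simp add: algebra_simps)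
    moreover have "0 \<le> \<eta> * (\<alpha> / (1 - \<gamma>))" by (rule mult_nonneg_nonneg[OF G(2) pos])
    ultimately show ?thesis using f 0 by simp
  next
    case (Suc m)
    let ?u = "a z - f" and ?v = "(g - b z) * antideriv (picard a b m) z"
      and ?w = "g * antideriv (\<lambda>w. picard a b (Suc m) w - picard a b m w) z"
    have w: "?w = g * (antideriv (picard a b (Suc m)) z - antideriv (picard a b m) z)"
      by (simp only: antideriv_diff[OF cont cont])
    have "picard a b (Suc m) z = a z - \<i> * (b z * antideriv (picard a b m) z)" by simp
    then have "picard a b n z + \<i> * g * antideriv (picard a b n) z - f = ?u + \<i> * (?v + ?w)"
      unfolding Suc w by (simp add: algebra_simps del: picard.simps)
    also have "cmod \<dots> \<le> cmod ?u + (cmod ?v + cmod ?w)"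
      using norm_triangle_ineq[of ?u "\<i> * (?v + ?w)"] norm_triangle_ineq[of ?v ?w] by (simp add: norm_mult)
    also have "\<dots> \<le> \<delta> + (\<eta> * (\<alpha> / (1 - \<gamma>)) + G * (\<gamma> ^ n * \<alpha>))"
      unfolding norm_mult Suc
      by (intro add_mono f mult_mono g J norm_antideriv_le_on_box[OF picard_diff_bound z] G norm_ge_zero)
    finally show ?thesis by (simp add: add.assoc)
  qed
qed

end

section \<open>Smooth extensions\<close>

lemma has_smooth_extension_continuous:
  assumes "has_smooth_extension S f"
  shows "continuous_on S f"
proof -
  obtain U F where U: "open U" "S \<subseteq> U" "smooth_on U F" "\<And>z. z \<in> S \<Longrightarrow> F z = f z"
    using assms unfolding has_smooth_extension_def by blast
  have "Ck_on 0 U F" using U(3) unfolding smooth_on_def by blast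
  then have "continuous_on S F" using U(2) continuous_on_subset by auto
  then show ?thesis by (rule continuous_on_eq) (rule U(4))
qed

text \<open>The one-sided derivatives at the edges agree with the derivative of a smooth extension,
  which is continuous.\<close>

lemma continuous_partial_x_smooth_extension:
  fixes g :: "plane \<Rightarrow> real"
  assumes "has_smooth_extension (box_sq 1) g"
  shows "continuous_on (box_sq 1) (partial_x (box_sq 1) g)"
proof -
  obtain U F where U: "open U" "box_sq 1 \<subseteq> U" "smooth_on U F" "\<And>z. z \<in> box_sq 1 \<Longrightarrow> F z = g z"
    using assms unfolding has_smooth_extension_def by blast
  have "Ck_on 1 U F" using U(3) unfolding smooth_on_def by blast
  then have d: "\<And>z. z \<in> U \<Longrightarrow> F differentiable (at z)" and c: "continuous_on U (D\<^sub>x F)" by auto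
  have "D\<^sub>x F z = partial_x (box_sq 1) g z" if z: "z \<in> box_sq 1" for z
  proof -
    obtain x y where xy: "z = (x, y)" "x \<in> {-1..1}" "y \<in> {-1..1}" using z by (auto simp: box_sq_def)
    have slice: "{t. (t, y) \<in> box_sq 1} = {-1..1}" using xy by (auto simp: box_sq_def)
    have "((\<lambda>t. (t, y)) has_derivative (\<lambda>h. (h, 0))) (at x)"
      by (intro has_derivative_Pair has_derivative_ident has_derivative_const)
    from has_derivative_compose[OF this has_derivative_partials[OF d]]
    have "((\<lambda>t. F (t, y)) has_vector_derivative D\<^sub>x F z) (at x)"
      using z U(2) by (auto simp: has_vector_derivative_def xy)
    then have "((\<lambda>t. F (t, y)) has_vector_derivative D\<^sub>x F z) (at x within {-1..1})"
      by (rule has_vector_derivative_at_within)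
    then have "((\<lambda>t. g (t, y)) has_vector_derivative D\<^sub>x F z) (at x within {-1..1})"
      by (rule has_vector_derivative_transform[rotated 2]) (use U(4) xy in \<open>auto simp: box_sq_def\<close>)
    then have "vector_derivative (\<lambda>t. g (t, y)) (at x within {-1..1}) = D\<^sub>x F z"
      using xy by (intro vector_derivative_within_closed_interval) auto
    then show ?thesis by (simp add: partial_x_def[of "box_sq 1"] xy slice)
  qed
  then show ?thesis
    by (intro continuous_on_eq[OF continuous_on_subset[OF c U(2)]])
qed

section \<open>The approximate solution and its bounds\<close>

theorem theorem3p4:
  fixes f :: "real \<times> real \<Rightarrow> complex" and g :: "real \<times> real \<Rightarrow> real"
    and g\<^sub>x :: "real \<times> real \<Rightarrow> real" and Q :: "(real \<times> real) set"
    and \<epsilon> G\<^sub>1 c\<^sub>f c\<^sub>g :: real and n :: int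
  assumes Q: "Q = {-1..1} \<times> {-1..1}"
    and f: "has_smooth_extension Q f"
    and g: "has_smooth_extension Q g"
    and g\<^sub>x: "g\<^sub>x = partial_x Q g"
    and G\<^sub>1: "G\<^sub>1 = (GREATEST r. r \<in> (\<lambda>z. \<bar>g\<^sub>x z\<bar>) ` Q)"
    and G\<^sub>1_less: "G\<^sub>1 < 1 / 2"
    and \<epsilon>: "0 < \<epsilon>" "\<epsilon> < 1"
    and c\<^sub>f: "c\<^sub>f = approx_bandlimit Q f \<epsilon>"
    and c\<^sub>f_pos: "0 < c\<^sub>f"
    and c\<^sub>g: "c\<^sub>g = approx_bandlimit Q (\<lambda>z. complex_of_real (g\<^sub>x z)) \<epsilon>"
    and c\<^sub>g_pos: "0 < c\<^sub>g"
    and n: "n = \<lfloor>ln \<epsilon> / ln (2 * G\<^sub>1)\<rfloor>"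
  shows "\<exists>p :: real \<times> real \<Rightarrow> complex.
    entire_function p \<and> tempered_function p \<and>
    tempered_distribution (fourier_distr (distr_of p)) \<and>
    order_at_most 1 (fourier_distr (distr_of p)) \<and>
    distr_support (fourier_distr (distr_of p)) \<subseteq> box_sq (c\<^sub>f + real_of_int n * c\<^sub>g) \<and>
    (\<forall>z\<in>Q. ennreal (cmod (partial_x UNIV p z + \<i> * complex_of_real (g\<^sub>x z) * p z - f z))
        \<le> ennreal (3 * \<epsilon> * (1 + G\<^sub>1 / (1 - 2 * G\<^sub>1))) * Linf_norm Q f) \<and>
    Linf_norm Q p \<le> ennreal (2 / (1 - 2 * G\<^sub>1)) * Linf_norm Q f \<and>
    Linf_norm Q (partial_x UNIV p) \<le> ennreal (4 * (1 + G\<^sub>1 / (1 - 2 * G\<^sub>1))) * Linf_norm Q f"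
proof -
  have Q: "Q = box_sq 1" by (simp add: Q box_sq_def)
  have l: "box_sq 1 \<in> sets lebesgue" by (simp add: box_sq_eq_cbox)
  have cf: "continuous_on (box_sq 1) f" using has_smooth_extension_continuous[OF f] by (simp add: Q)
  have cg: "continuous_on (box_sq 1) g\<^sub>x"
    using continuous_partial_x_smooth_extension[OF g[unfolded Q]] by (simp add: g\<^sub>x Q)
  have "box_sq 1 \<noteq> {}" by (auto simp: box_sq_def)
  then obtain z\<^sub>1 where z\<^sub>1: "z\<^sub>1 \<in> box_sq 1" "\<And>z. z \<in> box_sq 1 \<Longrightarrow> \<bar>g\<^sub>x z\<bar> \<le> \<bar>g\<^sub>x z\<^sub>1\<bar>"
    using continuous_attains_sup[OF compact_box_sq _ continuous_on_rabs[OF cg]] by blast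
  \<comment> \<open>By compactness the maximum is attained, so \<open>GREATEST\<close> really
    denotes it.\<close>
  have "G\<^sub>1 = \<bar>g\<^sub>x z\<^sub>1\<bar>" unfolding G\<^sub>1 Q by (rule Greatest_equality) (use z\<^sub>1 in auto)
  then have gG: "\<And>z. z \<in> box_sq 1 \<Longrightarrow> \<bar>g\<^sub>x z\<bar> \<le> G\<^sub>1" and G0: "0 \<le> G\<^sub>1" using z\<^sub>1 by simp_all
  obtain A where A: "0 \<le> A" "Linf_norm (box_sq 1) f = ennreal A" "\<And>z. z \<in> box_sq 1 \<Longrightarrow> cmod (f z) \<le> A"
    by (rule Linf_norm_eq_ennreal[OF compact_box_sq box_sq_subset_closure_interior cf]) auto
  have cgc: "continuous_on (box_sq 1) (\<lambda>z. complex_of_real (g\<^sub>x z))" by (intro continuous_intros cg)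
  obtain D where D: "0 \<le> D" "Linf_norm (box_sq 1) (\<lambda>z. complex_of_real (g\<^sub>x z)) = ennreal D"
    by (rule Linf_norm_eq_ennreal[OF compact_box_sq box_sq_subset_closure_interior cgc]) auto
  \<comment> \<open>The approximation of \<open>g\<^sub>x\<close> is controlled relative to the
    essential norm \<open>D\<close>; only its comparison with the maximum is needed.\<close>
  have "ennreal D \<le> ennreal G\<^sub>1"
    unfolding D(2)[symmetric] by (rule Linf_norm_le[OF l cgc]) (use gG in \<open>simp add: ennreal_leI\<close>)
  then have DG: "D \<le> G\<^sub>1" using G0 by simp
  obtain Gf Hf where Gf: "bounded_supp Gf" "continuous_on (box_sq (c\<^sub>f + 1)) Gf" "\<And>\<xi>. \<xi> \<notin> box_sq c\<^sub>f \<Longrightarrow> Gf \<xi> = 0"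
      "\<And>z. z \<in> box_sq 1 \<Longrightarrow> cmod (ift Gf z - f z) \<le> \<epsilon> * A"
    by (rule bandlimited_limit[OF cf A(2,1) \<epsilon> c\<^sub>f[unfolded Q]]) blast
  obtain Gg Hg where Gg: "bounded_supp Gg" "continuous_on (box_sq (c\<^sub>g + 1)) Gg" "\<And>\<xi>. \<xi> \<notin> box_sq c\<^sub>g \<Longrightarrow> Gg \<xi> = 0"
      "\<And>z. z \<in> box_sq 1 \<Longrightarrow> cmod (ift Gg z - g\<^sub>x z) \<le> \<epsilon> * D"
    and Hg: "bounded_supp Hg" "\<And>\<xi>. \<xi> \<notin> box_sq c\<^sub>g \<Longrightarrow> Hg \<xi> = 0" "mulx (ift Gg) = ift Hg"
    by (rule bandlimited_limit[OF cgc D(2,1) \<epsilon> c\<^sub>g[unfolded Q]]) blast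
  define a where "a = ift Gf"
  define b where "b = ift Gg"
  have ba: "band_fun c\<^sub>f a" unfolding a_def by (rule band_fun_ift[OF Gf(1-3)]) linarith+
  have bb: "band_fun c\<^sub>g b" unfolding b_def by (rule band_fun_ift[OF Gg(1-3)]) linarith+
  have bk: "band_fun (c\<^sub>f + real k * c\<^sub>g) (picard a b k)" for k
    by (rule band_fun_picard[OF ba bb Hg(3)[folded b_def] Hg(1,2)]) (use c\<^sub>g_pos in auto)
  \<comment> \<open>The tolerance of the approximations adds a factor \<open>1 + \<epsilon>\<close>
    below 2. This is the origin of the 2 in \<open>2 * G\<^sub>1\<close>, in \<open>n\<close> and in
    the bound for \<open>p\<close>.\<close>
  define \<alpha> where "\<alpha> = (1 + \<epsilon>) * A"
  define \<gamma> where "\<gamma> = (1 + \<epsilon>) * G\<^sub>1"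
  have \<alpha>: "0 \<le> \<alpha>" "\<alpha> \<le> 2 * A" unfolding \<alpha>_def using \<epsilon> A(1) by (auto intro!: mult_right_mono)
  have \<gamma>: "0 \<le> \<gamma>" "\<gamma> \<le> 2 * G\<^sub>1" unfolding \<gamma>_def using \<epsilon> G0 by (auto intro!: mult_right_mono)
  have fa: "cmod (a z - f z) \<le> \<epsilon> * A" if "z \<in> box_sq 1" for z
    using Gf(4)[OF that] by (simp add: a_def)
  have gb: "cmod (g\<^sub>x z - b z) \<le> \<epsilon> * G\<^sub>1" if "z \<in> box_sq 1" for z
    using order_trans[OF Gg(4)[OF that] mult_left_mono[OF DG less_imp_le[OF \<epsilon>(1)]]]
    by (simp add: b_def norm_minus_commute)
  interpret it: iteration a b \<alpha> \<gamma>
  proof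
    show "continuous_on UNIV (picard a b k)" for k by (rule band_fun_continuous[OF bk])
    show "cmod (a z) \<le> \<alpha>" if "z \<in> box_sq 1" for z
      using norm_triangle_sub[of "a z" "f z"] fa[OF that] A(3)[OF that] by (simp add: \<alpha>_def algebra_simps)
    show "cmod (b z) \<le> \<gamma>" if "z \<in> box_sq 1" for z
      using norm_triangle_sub[of "b z" "complex_of_real (g\<^sub>x z)"] gb[OF that] gG[OF that]
      by (simp add: \<gamma>_def algebra_simps norm_minus_commute)
    show "\<gamma> < 1" using \<gamma> G\<^sub>1_less by simp
  qed
  have n0: "0 \<le> n" and pow: "(2 * G\<^sub>1) ^ Suc (nat n) \<le> \<epsilon>"
  proof -
    \<comment> \<open>For \<open>G\<^sub>1 = 0\<close> the conventions \<open>ln 0 = 0\<close> and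
      \<open>x / 0 = 0\<close> give \<open>n = 0\<close>, and the power with exponent
      \<open>Suc (nat n)\<close> is then 0.\<close>
    show "0 \<le> n"
    proof (cases "G\<^sub>1 = 0")
      case False
      then have "ln (2 * G\<^sub>1) \<le> 0" using G0 G\<^sub>1_less by simp
      moreover have "ln \<epsilon> \<le> 0" using \<epsilon> by simp
      ultimately show ?thesis unfolding n by (simp add: divide_nonpos_nonpos)
    qed (simp add: n)
    show "(2 * G\<^sub>1) ^ Suc (nat n) \<le> \<epsilon>"
    proof (cases "G\<^sub>1 = 0")
      case False
      then have G: "0 < 2 * G\<^sub>1" "ln (2 * G\<^sub>1) < 0" using G0 G\<^sub>1_less by simp_all
      \<comment> \<open>The floor puts \<open>n + 1\<close>, and not \<open>n\<close>, above the
        quotient; multiplying by the negative logarithm reverses the inequality. Hence the exponent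
        \<open>Suc (nat n)\<close>.\<close>
      have "ln \<epsilon> / ln (2 * G\<^sub>1) < real_of_int n + 1" unfolding n by linarith
      also have "\<dots> = real (Suc (nat n))" using \<open>0 \<le> n\<close> by simp
      finally have "real (Suc (nat n)) * ln (2 * G\<^sub>1) < ln \<epsilon>" using G(2) by (simp only: neg_divide_less_eq)
      then have "ln ((2 * G\<^sub>1) ^ Suc (nat n)) < ln \<epsilon>" using G(1) by (subst ln_realpow) auto
      then show ?thesis using G(1) \<epsilon> by (subst (asm) ln_less_cancel_iff) auto
    qed (use \<epsilon> in simp)
  qed
  define N where "N = nat n"
  define F where "F = picard a b N"
  have bF: "band_fun (c\<^sub>f + real_of_int n * c\<^sub>g) F"
    using bk[of N] n0 by (simp add: F_def N_def)
  interpret p: antideriv_distribution "c\<^sub>f + real_of_int n * c\<^sub>g" F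
    by standard (rule bF)
  obtain P where P: "extends P F" using bF unfolding band_fun_def by blast
  note ep = antideriv_extends[OF P]
  define \<kappa> where "\<kappa> = 1 - 2 * G\<^sub>1"
  have \<kappa>: "0 < \<kappa>" using G\<^sub>1_less by (simp add: \<kappa>_def)
  have \<alpha>\<gamma>: "\<alpha> / (1 - \<gamma>) \<le> 2 / \<kappa> * A"
  proof -
    have "\<alpha> / (1 - \<gamma>) \<le> (2 * A) / \<kappa>"
      using \<alpha> \<gamma> \<kappa> A(1) by (intro frac_le) (auto simp: \<kappa>_def)
    then show ?thesis by simp
  qed
  have lin: "x \<le> B \<Longrightarrow> 0 \<le> B' \<Longrightarrow> B = B' * A \<Longrightarrow> ennreal x \<le> ennreal B' * Linf_norm (box_sq 1) f" for x B B'
    using A(1,2) by (simp add: ennreal_mult[symmetric] ennreal_leI)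
  have residual: "cmod (F z + \<i> * complex_of_real (g\<^sub>x z) * antideriv F z - f z) \<le> 3 * \<epsilon> * (1 + G\<^sub>1 / \<kappa>) * A"
    if z: "z \<in> box_sq 1" for z
  proof -
    have "cmod (F z + \<i> * complex_of_real (g\<^sub>x z) * antideriv F z - f z) \<le> \<epsilon> * A + (\<epsilon> * G\<^sub>1) * (\<alpha> / (1 - \<gamma>)) + G\<^sub>1 * (\<gamma> ^ N * \<alpha>)"
      unfolding F_def by (rule it.residual_bound[OF fa[OF z] gb[OF z] _ z]) (use gG[OF z] in simp)
    also have "\<dots> \<le> \<epsilon> * A + (\<epsilon> * G\<^sub>1) * (2 / \<kappa> * A) + G\<^sub>1 * ((2 * G\<^sub>1) ^ N * (2 * A))"
      using \<epsilon> G0 \<alpha> \<gamma> by (intro add_mono mult_left_mono mult_mono power_mono \<alpha>\<gamma>) auto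
    \<comment> \<open>The outer factor \<open>G\<^sub>1\<close> and the 2 in \<open>2 * A\<close>
      supply the missing power, from \<open>N\<close> to \<open>N + 1\<close>.\<close>
    also have "G\<^sub>1 * ((2 * G\<^sub>1) ^ N * (2 * A)) = (2 * G\<^sub>1) ^ Suc (nat n) * A" by (simp add: N_def)
    also have "\<dots> \<le> \<epsilon> * A" by (rule mult_right_mono[OF pow A(1)])
    finally have "cmod (F z + \<i> * complex_of_real (g\<^sub>x z) * antideriv F z - f z) \<le> \<epsilon> * A + (\<epsilon> * G\<^sub>1) * (2 / \<kappa> * A) + \<epsilon> * A" by simp
    \<comment> \<open>The two outer errors are each at most \<open>\<epsilon> * A\<close> and the
      middle one doubles \<open>G\<^sub>1 / \<kappa>\<close>, so the constant 2 comes out; the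
      claimed 3 leaves room.\<close>
    also have "\<dots> = 2 * (\<epsilon> * (1 + G\<^sub>1 / \<kappa>) * A)" using \<kappa> by (simp add: algebra_simps)
    also have "\<dots> \<le> 3 * (\<epsilon> * (1 + G\<^sub>1 / \<kappa>) * A)" using \<epsilon> G0 \<kappa> A(1) by (intro mult_right_mono) auto
    finally show ?thesis by (simp add: mult.assoc)
  qed
  have Fb: "cmod (F z) \<le> 2 / \<kappa> * A" if "z \<in> box_sq 1" for z
    using it.picard_bound[OF that, of N] \<alpha>\<gamma> unfolding F_def by linarith
  \<comment> \<open>The x-derivative of \<open>p\<close> is \<open>F\<close>, bounded by
    \<open>2 / \<kappa> * A\<close>; the claimed bound is larger because
    \<open>4 * \<kappa> + 4 * G\<^sub>1 = 4 - 4 * G\<^sub>1 \<ge> 2\<close>.\<close>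
  have e4: "2 / \<kappa> \<le> 4 * (1 + G\<^sub>1 / \<kappa>)"
  proof -
    have "2 / \<kappa> \<le> (4 * \<kappa> + 4 * G\<^sub>1) / \<kappa>"
      using \<kappa> G\<^sub>1_less by (intro divide_right_mono) (auto simp: \<kappa>_def)
    also have "\<dots> = 4 * (1 + G\<^sub>1 / \<kappa>)" using \<kappa> by (simp add: add_divide_distrib distrib_left)
    finally show ?thesis .
  qed
  show ?thesis
    unfolding Q ep(2)
  proof (intro exI[of _ "antideriv F"] conjI ballI)
    show "entire_function (antideriv F)" by (rule entire_function_extends[OF ep(1)])
    show "tempered_function (antideriv F)" by (rule p.is_tempered_function)
    show "tempered_distribution (fourier_distr (distr_of (antideriv F)))" by (rule p.fourier_tempered)
    show "order_at_most 1 (fourier_distr (distr_of (antideriv F)))" by (rule p.fourier_order)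
    show "distr_support (fourier_distr (distr_of (antideriv F))) \<subseteq> box_sq (c\<^sub>f + real_of_int n * c\<^sub>g)"
      by (rule p.fourier_support)
    show "ennreal (cmod (partial_x UNIV (antideriv F) z + \<i> * complex_of_real (g\<^sub>x z) * antideriv F z - f z))
        \<le> ennreal (3 * \<epsilon> * (1 + G\<^sub>1 / (1 - 2 * G\<^sub>1))) * Linf_norm (box_sq 1) f" if "z \<in> box_sq 1" for z
      unfolding ep(2) \<kappa>_def[symmetric] using \<epsilon> G0 \<kappa> by (intro lin[OF residual[OF that]]) auto
    show "Linf_norm (box_sq 1) (antideriv F) \<le> ennreal (2 / (1 - 2 * G\<^sub>1)) * Linf_norm (box_sq 1) f"
      unfolding \<kappa>_def[symmetric]
    proof (rule Linf_norm_le[OF l])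
      show "continuous_on (box_sq 1) (antideriv F)"
        using extends_continuous[OF ep(1)] by (rule continuous_on_subset) simp
    qed (use \<kappa> in \<open>auto intro!: lin[OF norm_antideriv_le_on_box[OF Fb]]\<close>)
    show "Linf_norm (box_sq 1) (partial_x UNIV (antideriv F)) \<le> ennreal (4 * (1 + G\<^sub>1 / (1 - 2 * G\<^sub>1))) * Linf_norm (box_sq 1) f"
      unfolding ep(2) \<kappa>_def[symmetric]
    proof (rule Linf_norm_le[OF l])
      show "continuous_on (box_sq 1) F"
        using extends_continuous[OF P] by (rule continuous_on_subset) simp
      show "ennreal (cmod (F z)) \<le> ennreal (4 * (1 + G\<^sub>1 / \<kappa>)) * Linf_norm (box_sq 1) f" if "z \<in> box_sq 1" for z
        using G0 \<kappa> by (intro lin[OF order_trans[OF Fb[OF that] mult_right_mono[OF e4 A(1)]]]) auto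
    qed
  qed
qed

end
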